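(* Let $m$ be a positive integer and assume the standard conditions hold. Assume moreover (i) $h(t)\sim\lambda t^{-1}\log t$ as $t\to\infty$ for some $\lambda>0$; (ii) $h$ is smoothly varying (necessarily of index $-1$) of order $m$. Then for every positive integer $k\le m$, as $t\to\infty$, $$\overline G(t)=\sum_{i\in\mathbb Z}\mathbb I\{c_i\succeq c_{(1)}e^{-k/\lambda}\}\,\big(\mathsf L_{G\natural\mathsf M_{c_i}F,\;k+\lfloor\lambda\log|c_i/c_{(1)}|\rfloor}\,\overline{\mathsf M_{c_i}F}\big)(t)+o\big(h(t)^k\,\overline{\mathsf M_{c_{(1)}}F}(t)\big),$$ where $\lfloor\cdot\rfloor$ denotes the integer part and $\mathbb I$ the indicator function.
   Context: Let $(X_i)_{i\in\mathbb Z}$ be independent random variables with common distribution function $F$. Let $(c_i)_{i\in\mathbb Z}$ be real weights tending to $0$ at infinity, and let $G$ be the distribution function of $\sum_{i\in\mathbb Z}c_iX_i$. For a distribution function $K$ write $\overline K=1-K$. For a real $c$, $\mathsf M_cK$ denotes the distribution function of $cY$ when $Y$ has distribution $K$; thus $\overline{\mathsf M_cK}(t)=\overline K(t/c)$ for $c>0$, and $\mathsf M_0K$ is the point mass at $0$. The hazard rate of $F$ is $h=F'/\overline F$, assumed to exist for all large $t$, so that $\overline F(t)=\overline F(t_0)\exp(-\int_{t_0}^t h(u)\,du)$ for $t\ge t_0$. $F$ is tail balanced if $\overline F(t)/F(-t)$ has a positive finite limit as $t\to\infty$; then $h_-$ denotes the hazard rate of $\mathsf M_{-1}F$. $F$ is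 strongly tail balanced if it is tail balanced and every property assumed of $h$ is also satisfied by $h_-$. The standard conditions are: $\sum_{i\in\mathbb Z}|c_i|^\delta<\infty$ for some $\delta\in(0,1)$, and either $F$ vanishes on a neighborhood of $-\infty$ or $F$ is strongly tail balanced. A function $h$ is smoothly varying of index $\alpha$ and order $m$ (written $h\in SR_{\alpha,m}$) if it is ultimately $m$ times continuously differentiable and $h^{(m)}$ is regularly varying of index $\alpha-m$. Ordering of reals: $a\prec b$ means $\overline{\mathsf M_aF}=o(\overline{\mathsf M_bF})$ at infinity; $a\equiv b$ means there is $\epsilon>0$ with $\epsilon\overline{\mathsf M_aF}\le\overline{\mathsf M_bF}\le\epsilon^{-1}\overline{\mathsf M_aF}$ ultimately; $a\preceq b$ means $a\prec b$ or $a\equiv b$; $a\succ b$, $a\succeq b$ are the reverse relations. $(c_{(i)})_{i\ge1}$ denotes the weights $(c_i)$ listed in nonincreasing $\prec$-order without multiplicity; in particular $c_{(1)}$ is a $\prec$-maximal weight. For a distribution $K$ with $m$ finite moments $\mu_{K,i}=\int x^i\,dK(x)$, its Laplace character of order $m$ is the differential operator $\mathsf L_{K,m}=\sum_{0\le i\le m}\frac{(-1)^i}{i!}\mu_{K,i}\mathrm D^i$, where $\mathrm D$ denotes differentiation (and $\mathrm D^0$ the identity). $G\natural\mathsf M_{c_i}F$ denotes the distribution of $\sum_{j\in\mathbb Z\setminus\{i\}}c_jX_j$. *)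

theory Defs
  imports "HOL-Probability.Probability" "HOL-Library.Landau_Symbols"
begin

definition Mbar :: "real measure \<Rightarrow> real \<Rightarrow> real \<Rightarrow> real" where
  "Mbar K c t = 1 - cdf (distr K borel (\<lambda>x. c * x)) t"

definition is_hazard_rate :: "(real \<Rightarrow> real) \<Rightarrow> (real \<Rightarrow> real) \<Rightarrow> bool" where
  "is_hazard_rate F h \<longleftrightarrow>
     (\<forall>\<^sub>F t in at_top. F t < 1 \<and> (F has_real_derivative (h t * (1 - F t))) (at t))"

definition regularly_varying :: "real \<Rightarrow> (real \<Rightarrow> real) \<Rightarrow> bool" where
  "regularly_varying \<alpha> g \<longleftrightarrow>
     (\<forall>\<^sub>F t in at_top. g t \<noteq> 0) \<and>
     (\<forall>x>0. ((\<lambda>t. g (x * t) / g t) \<longlongrightarrow> x powr \<alpha>) at_top)"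

definition smoothly_varying :: "real \<Rightarrow> nat \<Rightarrow> (real \<Rightarrow> real) \<Rightarrow> bool" where
  "smoothly_varying \<alpha> m h \<longleftrightarrow>
     (\<exists>t0. (\<forall>t>t0. \<forall>j<m. ((deriv ^^ j) h has_real_derivative (deriv ^^ Suc j) h t) (at t))
           \<and> continuous_on {t0<..} ((deriv ^^ m) h))
     \<and> regularly_varying (\<alpha> - real m) ((deriv ^^ m) h)"

definition tail_prec :: "real measure \<Rightarrow> real \<Rightarrow> real \<Rightarrow> bool" where
  "tail_prec K a b \<longleftrightarrow> Mbar K a \<in> o(Mbar K b)"

definition tail_equiv :: "real measure \<Rightarrow> real \<Rightarrow> real \<Rightarrow> bool" where
  "tail_equiv K a b \<longleftrightarrow> (\<exists>\<epsilon>>0. \<forall>\<^sub>F t in at_top.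
      \<epsilon> * Mbar K a t \<le> Mbar K b t \<and> Mbar K b t \<le> Mbar K a t / \<epsilon>)"

definition tail_preceq :: "real measure \<Rightarrow> real \<Rightarrow> real \<Rightarrow> bool" where
  "tail_preceq K a b \<longleftrightarrow> tail_prec K a b \<or> tail_equiv K a b"

definition laplace_char :: "real measure \<Rightarrow> nat \<Rightarrow> (real \<Rightarrow> real) \<Rightarrow> real \<Rightarrow> real" where
  "laplace_char K n f t =
     (\<Sum>j\<le>n. (-1) ^ j / fact j * integral\<^sup>L K (\<lambda>x. x ^ j) * (deriv ^^ j) f t)"

end

theory Submission
  imports Defs "HOL-Real_Asymp.Real_Asymp"
begin

text \<open>
  Since \<open>h(t) \<sim> \<lambda> ln t / t\<close>, the tail of \<open>F\<close> is \<open>exp (- (\<lambda>/2 + o(1)) ln\<^sup>2 t)\<close>: all moments are finite, two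
  summands of order \<open>t\<close> are far rarer than one, and replacing the weight \<open>a\<close> by \<open>b < a\<close> divides the tail by
  \<open>t\<close> to the power \<open>\<lambda> ln (a/b) + o(1)\<close>. Hence, with \<open>W\<^sub>i\<close> the sum without its \<open>i\<close>th term, the tail of the
  whole sum is, up to negligible terms, the sum over the finitely many weights \<open>c\<^sub>i\<close> above \<open>c\<^sub>(\<^sub>1\<^sub>) e\<^sup>-\<^sup>k\<^sup>/\<^sup>\<lambda>\<close> of the
  expectation of the tail of \<open>c\<^sub>i X\<^sub>i\<close> at \<open>t - W\<^sub>i\<close>, restricted to \<open>W\<^sub>i \<le> t/2\<close>. Smooth variation of \<open>h\<close> makes the
  \<open>j\<close>th derivative of the tail equivalent to \<open>(- h)\<^sup>j\<close> times the tail, and Taylor's formula under the expectation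
  produces the Laplace characters.
\<close>

section \<open>Derivatives of tails with a smoothly varying hazard rate\<close>

text \<open>Two obstacles shape the argument. Tails of this order have no exponential moments, so
  Chernoff's bound is available only after truncating the summands at a small multiple of
  \<open>t\<close>. What remains is measured on the scale
  \<open>exp (- (\<kappa> * (ln t)\<^sup>2))\<close>: one large summand corresponds to
  \<open>\<kappa> = lam / 2\<close>, two large summands reach every \<open>\<kappa> < lam\<close>,
  and powers of \<open>t\<close> do not count there, so an error with
  \<open>\<kappa> > lam / 2\<close> is below every term of the expansion. Moreover infinitely many
  weights occur, so the bounds for single summands are arranged to carry a factor
  \<open>\<bar>c i\<bar>\<close> that can be summed. The orders of the Laplace characters come from
  matching powers of \<open>t\<close>: relative to the leading tail, the \<open>j\<close>th
  derivative of the tail of \<open>c i * X i\<close> has size \<open>t\<close> to the power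
  \<open>- j - lam * ln \<bar>c i1 / c i\<bar>\<close> up to lower order factors, and the error
  allows the power \<open>- k\<close>. The integer part selects the orders \<open>j\<close> that are
  not absorbed.\<close>

lemma eventually_at_top_nhds:
  fixes P :: "real \<Rightarrow> bool"
  assumes "eventually P at_top"
  shows "\<forall>\<^sub>F t in at_top. eventually P (nhds t)"
proof -
  obtain T where "\<And>t. t \<ge> T \<Longrightarrow> P t"
    using assms by (auto simp: eventually_at_top_linorder)
  moreover have "\<forall>\<^sub>F x in nhds t. x \<ge> T" if "t > T" for t
    using eventually_nhds_in_open[of "{T<..}" t] that by (auto elim: eventually_mono)
  ultimately show ?thesis
    by (intro eventually_mono[OF eventually_gt_at_top[of T]]) (blast intro: eventually_mono)
qed

text \<open>A monotone function is ultimately of one sign, so a sign of the derivative is inherited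
  by the function. Iterated, this carries the sign of the highest derivative down to all lower
  ones.\<close>

lemma ultimately_sign_from_deriv:
  fixes f g :: "real \<Rightarrow> real"
  assumes d: "\<forall>\<^sub>F t in at_top. (f has_real_derivative g t) (at t)"
    and g: "(\<forall>\<^sub>F t in at_top. g t \<ge> 0) \<or> (\<forall>\<^sub>F t in at_top. g t \<le> 0)"
  shows "(\<exists>T. mono_on {T..} f) \<or> (\<exists>T. antimono_on {T..} f)"
    and "(\<forall>\<^sub>F t in at_top. f t \<ge> 0) \<or> (\<forall>\<^sub>F t in at_top. f t \<le> 0)"
proof -
  have *: "\<exists>T. mono_on {T..} f" if d: "\<forall>\<^sub>F t in at_top. (f has_real_derivative g t) (at t)"
    and "\<forall>\<^sub>F t in at_top. g t \<ge> 0" for f g :: "real \<Rightarrow> real"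
  proof -
    have "\<forall>\<^sub>F t in at_top. (f has_real_derivative g t) (at t) \<and> g t \<ge> 0"
      using that by eventually_elim auto
    then obtain T where T: "\<And>t. t \<ge> T \<Longrightarrow> (f has_real_derivative g t) (at t) \<and> g t \<ge> 0"
      by (auto simp: eventually_at_top_linorder)
    have "mono_on {T..} f"
    proof (rule mono_onI)
      fix r s assume "r \<in> {T..}" "r \<le> s"
      then show "f r \<le> f s"
        using T by (intro DERIV_nonneg_imp_nondecreasing[of r s f]) (meson atLeast_iff order.trans)+
    qed
    then show ?thesis by blast
  qed
  have **: "\<exists>T. antimono_on {T..} f" if "\<forall>\<^sub>F t in at_top. g t \<le> 0"
  proof -
    have "\<exists>T. mono_on {T..} (\<lambda>t. - f t)"
    proof (rule *[where g="\<lambda>t. - g t"])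
      show "\<forall>\<^sub>F t in at_top. ((\<lambda>t. - f t) has_real_derivative - g t) (at t)"
        using d by eventually_elim (rule DERIV_minus)
    qed (use that in simp)
    then show ?thesis by (auto simp: monotone_on_def)
  qed
  show A: "(\<exists>T. mono_on {T..} f) \<or> (\<exists>T. antimono_on {T..} f)"
    using g *[OF d] ** by blast
  then consider T where "mono_on {T..} f" | T where "antimono_on {T..} f" by blast
  then show "(\<forall>\<^sub>F t in at_top. f t \<ge> 0) \<or> (\<forall>\<^sub>F t in at_top. f t \<le> 0)"
  proof cases
    case 1
    show ?thesis
    proof (cases "\<exists>s\<ge>T. f s \<ge> 0")
      case True
      then obtain s where "s \<ge> T" "f s \<ge> 0" by blast
      then have "f t \<ge> 0" if "t \<ge> s" for t using monotone_onD[OF 1, of s t] that by auto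
      then have "\<forall>\<^sub>F t in at_top. f t \<ge> 0"
        by (intro eventually_mono[OF eventually_ge_at_top[of s]])
      then show ?thesis ..
    next
      case False
      then have "\<forall>\<^sub>F t in at_top. f t \<le> 0"
        by (intro eventually_mono[OF eventually_ge_at_top[of T]]) (meson False less_imp_le not_le)
      then show ?thesis ..
    qed
  next
    case 2
    show ?thesis
    proof (cases "\<exists>s\<ge>T. f s \<le> 0")
      case True
      then obtain s where "s \<ge> T" "f s \<le> 0" by blast
      then have "f t \<le> 0" if "t \<ge> s" for t using monotone_onD[OF 2, of s t] that by auto
      then have "\<forall>\<^sub>F t in at_top. f t \<le> 0"
        by (intro eventually_mono[OF eventually_ge_at_top[of s]])
      then show ?thesis ..
    next
      case False
      then have "\<forall>\<^sub>F t in at_top. f t \<ge> 0"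
        by (intro eventually_mono[OF eventually_ge_at_top[of T]]) (meson False less_imp_le not_le)
      then show ?thesis ..
    qed
  qed
qed

text \<open>The mean value theorem on \<open>[t/2, t]\<close> or on \<open>[t, 2 t]\<close>,
  according to whether \<open>\<bar>g\<bar>\<close> decreases or increases.\<close>
lemma monotone_deriv_bound:
  fixes f g :: "real \<Rightarrow> real"
  assumes d: "\<forall>\<^sub>F t in at_top. (f has_real_derivative g t) (at t)"
    and mono: "(\<exists>T. mono_on {T..} g) \<or> (\<exists>T. antimono_on {T..} g)"
    and sign: "(\<forall>\<^sub>F t in at_top. g t \<ge> 0) \<or> (\<forall>\<^sub>F t in at_top. g t \<le> 0)"
  shows "\<forall>\<^sub>F t in at_top. \<bar>g t\<bar> \<le> 2 / t * (\<bar>f (t/2)\<bar> + \<bar>f t\<bar> + \<bar>f (2*t)\<bar>)"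
proof -
  obtain T1 where T1: "\<And>t. t \<ge> T1 \<Longrightarrow> (f has_real_derivative g t) (at t)"
    using d by (auto simp: eventually_at_top_linorder)
  have "\<exists>T. (\<forall>s\<ge>T. \<forall>t\<ge>s. \<bar>g s\<bar> \<le> \<bar>g t\<bar>) \<or> (\<forall>s\<ge>T. \<forall>t\<ge>s. \<bar>g t\<bar> \<le> \<bar>g s\<bar>)"
  proof -
    obtain T2 where T2: "(\<forall>t\<ge>T2. g t \<ge> 0) \<or> (\<forall>t\<ge>T2. g t \<le> 0)"
      using sign by (auto simp: eventually_at_top_linorder)
    have "\<exists>T. (\<forall>s\<ge>T. \<forall>t\<ge>s. g s \<le> g t) \<or> (\<forall>s\<ge>T. \<forall>t\<ge>s. g t \<le> g s)"
      using mono
    proof (elim disjE exE)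
      fix T assume "mono_on {T..} g"
      then have "\<forall>s\<ge>T. \<forall>t\<ge>s. g s \<le> g t" by (auto simp: monotone_on_def)
      then show ?thesis by blast
    next
      fix T assume "antimono_on {T..} g"
      then have "\<forall>s\<ge>T. \<forall>t\<ge>s. g t \<le> g s" by (auto simp: monotone_on_def)
      then show ?thesis by blast
    qed
    then obtain T3 where T3: "(\<forall>s\<ge>T3. \<forall>t\<ge>s. g s \<le> g t) \<or> (\<forall>s\<ge>T3. \<forall>t\<ge>s. g t \<le> g s)"
      by blast
    show ?thesis
    proof (rule exI[of _ "max T2 T3"])
      show "(\<forall>s\<ge>max T2 T3. \<forall>t\<ge>s. \<bar>g s\<bar> \<le> \<bar>g t\<bar>) \<or> (\<forall>s\<ge>max T2 T3. \<forall>t\<ge>s. \<bar>g t\<bar> \<le> \<bar>g s\<bar>)"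
        using T2 T3
      proof (elim disjE)
        assume "\<forall>t\<ge>T2. 0 \<le> g t" "\<forall>s\<ge>T3. \<forall>t\<ge>s. g s \<le> g t"
        then show ?thesis by (intro disjI1) simp
      next
        assume "\<forall>t\<ge>T2. 0 \<le> g t" "\<forall>s\<ge>T3. \<forall>t\<ge>s. g t \<le> g s"
        then show ?thesis by (intro disjI2) simp
      next
        assume "\<forall>t\<ge>T2. g t \<le> 0" "\<forall>s\<ge>T3. \<forall>t\<ge>s. g s \<le> g t"
        then show ?thesis by (intro disjI2) simp
      next
        assume "\<forall>t\<ge>T2. g t \<le> 0" "\<forall>s\<ge>T3. \<forall>t\<ge>s. g t \<le> g s"
        then show ?thesis by (intro disjI1) simp
      qed
    qed
  qed
  then obtain T2 where
    T2: "(\<forall>s\<ge>T2. \<forall>t\<ge>s. \<bar>g s\<bar> \<le> \<bar>g t\<bar>) \<or> (\<forall>s\<ge>T2. \<forall>t\<ge>s. \<bar>g t\<bar> \<le> \<bar>g s\<bar>)" by blast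
  show ?thesis
  proof (rule eventually_mono[OF eventually_ge_at_top[of "max 1 (2 * max (max 1 T1) T2)"]])
    fix t :: real assume "max 1 (2 * max (max 1 T1) T2) \<le> t"
    then have t: "t \<ge> 1" "t/2 \<ge> T1" "t/2 \<ge> T2" "t \<ge> T1" "t \<ge> T2" by auto
    have pos: "0 < t" using t by simp
    from T2 have "\<bar>g t\<bar> * (t/2) \<le> \<bar>f (t/2)\<bar> + \<bar>f t\<bar> + \<bar>f (2*t)\<bar>"
    proof
      assume inc: "\<forall>s\<ge>T2. \<forall>t\<ge>s. \<bar>g s\<bar> \<le> \<bar>g t\<bar>"
      obtain z where z: "t < z" "z < 2*t" "f (2*t) - f t = (2*t - t) * g z"
        using MVT2[of t "2*t" f g] T1 t by auto
      have "\<bar>g t\<bar> * (t/2) \<le> \<bar>g z\<bar> * t"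
        by (rule mult_mono) (use inc z t in auto)
      also have "\<dots> = \<bar>f (2*t) - f t\<bar>"
        unfolding z(3) using pos by (simp add: abs_mult)
      also have "\<dots> \<le> \<bar>f (2*t)\<bar> + \<bar>f t\<bar>" by simp
      finally show ?thesis by simp
    next
      assume dec: "\<forall>s\<ge>T2. \<forall>t\<ge>s. \<bar>g t\<bar> \<le> \<bar>g s\<bar>"
      obtain z where z: "t/2 < z" "z < t" "f t - f (t/2) = (t - t/2) * g z"
        using MVT2[of "t/2" t f g] T1 t by auto
      have "\<bar>g t\<bar> * (t/2) \<le> \<bar>g z\<bar> * (t/2)"
        by (rule mult_mono) (use dec z t in auto)
      also have "\<dots> = \<bar>f t - f (t/2)\<bar>"
        unfolding z(3) using pos by (simp add: abs_mult)
      also have "\<dots> \<le> \<bar>f t\<bar> + \<bar>f (t/2)\<bar>" by simp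
      finally show ?thesis by simp
    qed
    then show "\<bar>g t\<bar> \<le> 2 / t * (\<bar>f (t/2)\<bar> + \<bar>f t\<bar> + \<bar>f (2*t)\<bar>)"
      using pos by (simp add: field_simps)
  qed
qed

text \<open>Of the regular variation of \<open>h\<^sup>(\<^sup>m\<^sup>)\<close> only its constant ultimate sign is used: it makes
  every lower derivative ultimately monotone.\<close>
lemma smoothly_varying_derivs:
  fixes h :: "real \<Rightarrow> real"
  assumes sv: "smoothly_varying \<alpha> m h" and h: "h \<in> O(\<lambda>t. ln t / t)"
  shows "\<And>j. j < m \<Longrightarrow> \<forall>\<^sub>F t in at_top. ((deriv ^^ j) h has_real_derivative (deriv ^^ Suc j) h t) (at t)"
    and "\<And>j. j < m \<Longrightarrow> (deriv ^^ j) h \<in> O(\<lambda>t. ln t / t / t ^ j)"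
proof -
  obtain t0 where t0: "\<And>t j. t > t0 \<Longrightarrow> j < m \<Longrightarrow>
      ((deriv ^^ j) h has_real_derivative (deriv ^^ Suc j) h t) (at t)"
    and cont: "continuous_on {t0<..} ((deriv ^^ m) h)"
    and nz: "\<forall>\<^sub>F t in at_top. (deriv ^^ m) h t \<noteq> 0"
    using sv unfolding smoothly_varying_def regularly_varying_def by blast
  show chain: "\<forall>\<^sub>F t in at_top. ((deriv ^^ j) h has_real_derivative (deriv ^^ Suc j) h t) (at t)"
    if "j < m" for j
    by (rule eventually_mono[OF eventually_gt_at_top[of t0]]) (use t0 that in blast)
  let ?sg = "\<lambda>j. (\<forall>\<^sub>F t in at_top. (deriv ^^ j) h t \<ge> 0) \<or> (\<forall>\<^sub>F t in at_top. (deriv ^^ j) h t \<le> 0)"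
  \<comment> \<open>The highest derivative is continuous and ultimately nonzero, so the intermediate
    value theorem forbids a change of sign.\<close>
  have top: "?sg m"
  proof -
    obtain T where T: "\<And>t. t \<ge> T \<Longrightarrow> (deriv ^^ m) h t \<noteq> 0" "T > t0"
      using nz unfolding eventually_at_top_linorder
      by (metis gt_ex linear order.strict_trans2 order.trans)
    have c: "continuous_on {T..s} ((deriv ^^ m) h)" for s
      by (rule continuous_on_subset[OF cont]) (use T in auto)
    have "0 < (deriv ^^ m) h t \<longleftrightarrow> 0 < (deriv ^^ m) h T" if "t \<ge> T" for t
    proof (rule ccontr)
      assume "\<not> ?thesis"
      then have "(deriv ^^ m) h t \<le> 0 \<and> 0 \<le> (deriv ^^ m) h T \<or> (deriv ^^ m) h T \<le> 0 \<and> 0 \<le> (deriv ^^ m) h t"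
        by auto
      then have "\<exists>x\<ge>T. x \<le> t \<and> (deriv ^^ m) h x = 0"
        using IVT'[of "(deriv ^^ m) h" T 0 t] IVT2'[of "(deriv ^^ m) h" t 0 T] that c[of t] by auto
      then show False using T by blast
    qed
    then have "(\<forall>t\<ge>T. (deriv ^^ m) h t \<ge> 0) \<or> (\<forall>t\<ge>T. (deriv ^^ m) h t \<le> 0)"
      by (meson less_imp_le not_less)
    then show ?thesis unfolding eventually_at_top_linorder by blast
  qed
  have sg: "?sg (m - i)" if "i \<le> m" for i
    using that
  proof (induction i)
    case 0 then show ?case using top by simp
  next
    case (Suc i)
    then have "Suc (m - Suc i) = m - i" by auto
    then show ?case
      using ultimately_sign_from_deriv(2)[OF chain[of "m - Suc i"]] Suc by auto
  qed
  have sg: "?sg j" if "j \<le> m" for j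
    using sg[of "m - j"] that by auto
  show "(deriv ^^ j) h \<in> O(\<lambda>t. ln t / t / t ^ j)" if "j < m" for j
    using that
  proof (induction j)
    case 0 then show ?case using h by simp
  next
    case (Suc j)
    let ?f = "(deriv ^^ j) h" and ?g = "(deriv ^^ Suc j) h"
    have IH: "?f \<in> O(\<lambda>t. ln t / t / t ^ j)" using Suc by simp
    \<comment> \<open>The mean value bound evaluates the lower derivative at \<open>t/2\<close> and
      \<open>2*t\<close>; rescaling changes its order only by a constant.\<close>
    have sc: "(\<lambda>t. ?f (c * t)) \<in> O(\<lambda>t. ln t / t / t ^ j)" if "c > 0" for c
    proof -
      have "filterlim (\<lambda>t. c * t) at_top at_top" using that by real_asymp
      then have "(\<lambda>t. ?f (c * t)) \<in> O(\<lambda>t. ln (c * t) / (c * t) / (c * t) ^ j)"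
        using landau_o.big.compose[OF IH] by blast
      also have "(\<lambda>t. ln (c * t) / (c * t) / (c * t) ^ j) \<in> O(\<lambda>t. (ln (c * t) / (c * t)) * (1 / t ^ j))"
        by (rule bigoI[where c="1 / c ^ j"], rule always_eventually)
          (use that in \<open>simp add: power_mult_distrib abs_mult field_simps\<close>)
      also have "(\<lambda>t. (ln (c * t) / (c * t)) * (1 / t ^ j)) \<in> O(\<lambda>t. ln t / t * (1 / t ^ j))"
      proof (rule landau_o.big.mult_right)
        show "(\<lambda>t. ln (c * t) / (c * t)) \<in> O(\<lambda>t. ln t / t)"
          using that by real_asymp
      qed
      finally show ?thesis by simp
    qed
    have "?g \<in> O(\<lambda>t. 2 / t * (\<bar>?f (t/2)\<bar> + \<bar>?f t\<bar> + \<bar>?f (2*t)\<bar>))"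
    proof (rule bigoI[where c=1])
      have "\<forall>\<^sub>F t in at_top. \<bar>?g t\<bar> \<le> 2 / t * (\<bar>?f (t/2)\<bar> + \<bar>?f t\<bar> + \<bar>?f (2*t)\<bar>)"
      proof (rule monotone_deriv_bound)
        show "\<forall>\<^sub>F t in at_top. (?f has_real_derivative ?g t) (at t)"
          by (rule chain) (use Suc.prems in simp)
        \<comment> \<open>Monotonicity of the derivative of order \<open>Suc j\<close> needs the
          sign of the next one, which is known because \<open>Suc j < m\<close>.\<close>
        show "(\<exists>T. mono_on {T..} ?g) \<or> (\<exists>T. antimono_on {T..} ?g)"
          by (rule ultimately_sign_from_deriv(1)[OF chain sg]) (use Suc.prems in simp_all)
        show "?sg (Suc j)"
          by (rule sg) (use Suc.prems in simp)
      qed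
      then show "\<forall>\<^sub>F t in at_top. norm (?g t) \<le> 1 * norm (2 / t * (\<bar>?f (t/2)\<bar> + \<bar>?f t\<bar> + \<bar>?f (2*t)\<bar>))"
        unfolding mult_1 real_norm_def by eventually_elim (rule order.trans[OF _ abs_ge_self])
    qed
    also have "(\<lambda>t. 2 / t * (\<bar>?f (t/2)\<bar> + \<bar>?f t\<bar> + \<bar>?f (2*t)\<bar>)) \<in> O(\<lambda>t. 1 / t * (ln t / t / t ^ j))"
      using sc[of "1/2"] sc[of 2] IH
    proof (intro landau_o.big.mult)
      show "(\<lambda>t::real. 2 / t) \<in> O(\<lambda>t. 1 / t)" by real_asymp
    qed (intro sum_in_bigo; simp del: funpow.simps)
    also have "(\<lambda>t::real. 1 / t * (ln t / t / t ^ j)) = (\<lambda>t. ln t / t / t ^ Suc j)"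
      by (rule ext) (simp add: ac_simps)
    finally show ?case .
  qed
qed

text \<open>\<open>deriv_bigo r \<phi> g\<close> says \<open>g\<^sup>(\<^sup>i\<^sup>) = O(\<phi> / t\<^sup>i)\<close> for \<open>i \<le> r\<close>; stated recursively, it passes to
  products by the product rule alone.\<close>
primrec deriv_bigo :: "nat \<Rightarrow> (real \<Rightarrow> real) \<Rightarrow> (real \<Rightarrow> real) \<Rightarrow> bool" where
  "deriv_bigo 0 \<phi> g \<longleftrightarrow> g \<in> O(\<phi>)"
| "deriv_bigo (Suc r) \<phi> g \<longleftrightarrow> g \<in> O(\<phi>) \<and>
     (\<exists>g'. (\<forall>\<^sub>F t in at_top. (g has_real_derivative g' t) (at t)) \<and> deriv_bigo r (\<lambda>t. \<phi> t / t) g')"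

section \<open>Closure of derivative bounds under sums and products\<close>

lemma deriv_bigo_imp_bigo: "deriv_bigo r \<phi> g \<Longrightarrow> g \<in> O(\<phi>)"
  by (cases r) auto

lemma deriv_bigo_Suc_D: "deriv_bigo (Suc r) \<phi> g \<Longrightarrow> deriv_bigo r \<phi> g"
proof (induction r arbitrary: \<phi> g)
  case (Suc r)
  then obtain g' where "g \<in> O(\<phi>)" "\<forall>\<^sub>F t in at_top. (g has_real_derivative g' t) (at t)"
    "deriv_bigo (Suc r) (\<lambda>t. \<phi> t / t) g'" by auto
  moreover have "deriv_bigo r (\<lambda>t. \<phi> t / t) g'"
    by (rule Suc.IH) (use calculation in simp)
  ultimately show ?case unfolding deriv_bigo.simps by blast
qed simp

lemma deriv_bigo_mono:
  assumes "deriv_bigo r \<phi> g" "\<phi> \<in> O(\<psi>)"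
  shows "deriv_bigo r \<psi> g"
  using assms
proof (induction r arbitrary: \<phi> \<psi> g)
  case 0
  then show ?case using landau_o.big_trans by auto
next
  case (Suc r)
  then obtain g' where g': "g \<in> O(\<phi>)" "\<forall>\<^sub>F t in at_top. (g has_real_derivative g' t) (at t)"
    "deriv_bigo r (\<lambda>t. \<phi> t / t) g'" by auto
  have "(\<lambda>t. \<phi> t / t) \<in> O(\<lambda>t. \<psi> t / t)"
    using Suc.prems(2) by (intro landau_o.big.divide_right) (auto intro: eventually_gt_at_top eventually_mono[OF eventually_gt_at_top[of 0]])
  then show ?case using Suc.IH[OF g'(3)] g' landau_o.big_trans[OF g'(1) Suc.prems(2)] by auto
qed

lemma deriv_bigo_add:
  assumes "deriv_bigo r \<phi> f" "deriv_bigo r \<phi> g"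
  shows "deriv_bigo r \<phi> (\<lambda>t. f t + g t)"
  using assms
proof (induction r arbitrary: \<phi> f g)
  case 0
  then show ?case by (auto intro: sum_in_bigo)
next
  case (Suc r)
  then obtain f' g' where *: "\<forall>\<^sub>F t in at_top. (f has_real_derivative f' t) (at t)"
    "\<forall>\<^sub>F t in at_top. (g has_real_derivative g' t) (at t)"
    "deriv_bigo r (\<lambda>t. \<phi> t / t) f'" "deriv_bigo r (\<lambda>t. \<phi> t / t) g'"
    and O: "f \<in> O(\<phi>)" "g \<in> O(\<phi>)" by auto
  have "\<forall>\<^sub>F t in at_top. ((\<lambda>t. f t + g t) has_real_derivative f' t + g' t) (at t)"
    using *(1,2) by eventually_elim (rule DERIV_add)
  moreover have "(\<lambda>t. f t + g t) \<in> O(\<phi>)" using O by (rule sum_in_bigo)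
  ultimately show ?case
    unfolding deriv_bigo.simps using Suc.IH[OF *(3,4)] by (intro conjI exI)
qed

lemma deriv_bigo_mult:
  assumes "deriv_bigo r \<phi> f" "deriv_bigo r \<psi> g"
  shows "deriv_bigo r (\<lambda>t. \<phi> t * \<psi> t) (\<lambda>t. f t * g t)"
  using assms
proof (induction r arbitrary: \<phi> \<psi> f g)
  case 0
  then show ?case by (auto intro: landau_o.big.mult)
next
  case (Suc r)
  then obtain f' g' where *: "\<forall>\<^sub>F t in at_top. (f has_real_derivative f' t) (at t)"
    "\<forall>\<^sub>F t in at_top. (g has_real_derivative g' t) (at t)"
    "deriv_bigo r (\<lambda>t. \<phi> t / t) f'" "deriv_bigo r (\<lambda>t. \<psi> t / t) g'"
    and O: "f \<in> O(\<phi>)" "g \<in> O(\<psi>)" by auto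
  have "\<forall>\<^sub>F t in at_top. ((\<lambda>t. f t * g t) has_real_derivative f' t * g t + g' t * f t) (at t)"
    using *(1,2) by eventually_elim (rule DERIV_mult)
  moreover have "(\<lambda>t. f t * g t) \<in> O(\<lambda>t. \<phi> t * \<psi> t)" using O by (rule landau_o.big.mult)
  moreover have "deriv_bigo r (\<lambda>t. \<phi> t * \<psi> t / t) (\<lambda>t. f' t * g t + g' t * f t)"
  proof (rule deriv_bigo_add)
    show "deriv_bigo r (\<lambda>t. \<phi> t * \<psi> t / t) (\<lambda>t. f' t * g t)"
      using Suc.IH[OF *(3) deriv_bigo_Suc_D[OF Suc.prems(2)]] by (simp add: field_simps)
    show "deriv_bigo r (\<lambda>t. \<phi> t * \<psi> t / t) (\<lambda>t. g' t * f t)"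
      using Suc.IH[OF *(4) deriv_bigo_Suc_D[OF Suc.prems(1)]] by (simp add: field_simps)
  qed
  ultimately show ?case
    unfolding deriv_bigo.simps by (intro conjI exI)
qed

lemma deriv_bigo_higher_deriv:
  assumes "\<And>j. j < r \<Longrightarrow> \<forall>\<^sub>F t in at_top. ((deriv ^^ j) g has_real_derivative (deriv ^^ Suc j) g t) (at t)"
    and "\<And>j. j \<le> r \<Longrightarrow> (deriv ^^ j) g \<in> O(\<lambda>t. \<phi> t / t ^ j)"
  shows "deriv_bigo r \<phi> g"
proof -
  \<comment> \<open>The induction runs on the number \<open>i\<close> of orders still to come, since
    \<open>deriv_bigo\<close> unfolds from a function towards its higher derivatives.\<close>
  have "deriv_bigo i (\<lambda>t. \<phi> t / t ^ (r - i)) ((deriv ^^ (r - i)) g)" if "i \<le> r" for i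
    using that
  proof (induction i)
    case 0
    then show ?case using assms(2)[of r] by simp
  next
    case (Suc i)
    define j where "j = r - Suc i"
    have j: "r - i = Suc j" "j < r" "r - Suc i = j" using Suc.prems by (auto simp: j_def)
    have "deriv_bigo i (\<lambda>t. \<phi> t / t ^ j / t) ((deriv ^^ Suc j) g)"
      using Suc by (simp add: j field_simps)
    then show ?case
      unfolding deriv_bigo.simps j(3) using assms(1)[OF j(2)] assms(2)[of j] j(2) by auto
  qed
  from this[of r] show ?thesis by simp
qed

text \<open>The hazard rate is replaced by its equivalent \<open>lam * ln t / t\<close>, so that the
  same \<open>lam\<close> serves all rescalings of a tail. The expansion of a single tail is proved
  from these properties alone.\<close>

definition reg_tail :: "real \<Rightarrow> nat \<Rightarrow> (real \<Rightarrow> real) \<Rightarrow> bool" where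
  "reg_tail lam m f \<longleftrightarrow> antimono f \<and> (\<forall>t. f t > 0) \<and>
     (\<forall>j<m. \<forall>\<^sub>F t in at_top. ((deriv ^^ j) f has_real_derivative (deriv ^^ Suc j) f t) (at t)) \<and>
     (\<forall>j\<le>m. (deriv ^^ j) f \<sim>[at_top] (\<lambda>t. (- (lam * ln t / t)) ^ j * f t))"

text \<open>An identity valid for all large arguments holds in a neighbourhood of each of them,
  hence may be differentiated.\<close>

lemma has_real_derivative_higher_deriv:
  assumes "\<forall>\<^sub>F t in at_top. (deriv ^^ j) f t = g t"
    and "\<forall>\<^sub>F t in at_top. (g has_real_derivative g' t) (at t)"
  shows "\<forall>\<^sub>F t in at_top. ((deriv ^^ j) f has_real_derivative (deriv ^^ Suc j) f t) (at t)"
    and "\<forall>\<^sub>F t in at_top. (deriv ^^ Suc j) f t = g' t"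
proof -
  have *: "\<forall>\<^sub>F t in at_top. ((deriv ^^ j) f has_real_derivative g' t) (at t)"
    using eventually_at_top_nhds[OF assms(1)] assms(2)
  proof eventually_elim
    case (elim t)
    then show ?case
      using DERIV_cong_ev[of t t "(deriv ^^ j) f" g "g' t" "g' t"] by auto
  qed
  then show "\<forall>\<^sub>F t in at_top. (deriv ^^ Suc j) f t = g' t"
    by eventually_elim (auto intro: DERIV_imp_deriv)
  with * show "\<forall>\<^sub>F t in at_top. ((deriv ^^ j) f has_real_derivative (deriv ^^ Suc j) f t) (at t)"
    by eventually_elim simp
qed

text \<open>Here \<open>f\<^sup>(\<^sup>j\<^sup>) = p\<^sub>j f\<close> with \<open>p\<^sub>0 = 1\<close>, \<open>p\<^sub>j\<^sub>+\<^sub>1 = p\<^sub>j' - h p\<^sub>j\<close>; the derivative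
  \<open>p\<^sub>j'\<close> loses a factor \<open>1/t\<close> and is negligible against \<open>h p\<^sub>j\<close>.\<close>
lemma reg_tail_hazard:
  fixes f h :: "real \<Rightarrow> real"
  assumes anti: "antimono f" and pos: "\<And>t. f t > 0"
    and haz: "\<forall>\<^sub>F t in at_top. (f has_real_derivative - (h t * f t)) (at t)"
    and h: "h \<sim>[at_top] (\<lambda>t. lam * ln t / t)" and lam: "lam > 0"
    and sv: "smoothly_varying (-1) m h"
  shows "reg_tail lam m f"
proof -
  define L where "L = (\<lambda>t::real. ln t / t)"
  have hL: "h \<in> O(L)"
  proof -
    have "h \<in> O(\<lambda>t. lam * ln t / t)" using h by (rule asymp_equiv_imp_bigo)
    also have "(\<lambda>t. lam * ln t / t) \<in> O(L)" unfolding L_def using lam by real_asymp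
    finally show ?thesis .
  qed
  \<comment> \<open>Bounds on \<open>h\<close> up to order \<open>m - 1\<close> suffice: the
    \<open>m\<close>th derivative of \<open>f\<close> involves no higher derivative of
    \<open>h\<close>.\<close>
  have D: "deriv_bigo (m - 1) L h"
    using smoothly_varying_derivs[OF sv hL[unfolded L_def]] hL
    by (intro deriv_bigo_higher_deriv) (cases "m = 0"; auto simp: L_def)+
  \<comment> \<open>The factor \<open>p\<close> is controlled up to order \<open>m - j\<close>: each
    passage from \<open>p\<close> to \<open>p' - h * p\<close> uses up one order.\<close>
  have main: "\<exists>p. (\<forall>\<^sub>F t in at_top. (deriv ^^ j) f t = p t * f t) \<and>
      deriv_bigo (m - j) (\<lambda>t. L t ^ j) p \<and> p \<sim>[at_top] (\<lambda>t. (- (lam * ln t / t)) ^ j) \<and>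
      (\<forall>i<j. \<forall>\<^sub>F t in at_top. ((deriv ^^ i) f has_real_derivative (deriv ^^ Suc i) f t) (at t))"
    if "j \<le> m" for j
    using that
  proof (induction j)
    case 0
    have "deriv_bigo r (\<lambda>_. c) (\<lambda>_. 1)" if "c = 1" for r and c :: real
      using that
    proof (induction r arbitrary: c)
      case (Suc r)
      have "deriv_bigo r \<phi> (\<lambda>_. 0)" for \<phi>
        by (induction r arbitrary: \<phi>) (auto intro: exI[of _ "\<lambda>_. 0"])
      then show ?case using Suc by (auto intro!: exI[of _ "\<lambda>_. 0"])
    qed simp
    then show ?case by (intro exI[of _ "\<lambda>_. 1"]) auto
  next
    case (Suc j)
    then obtain p where p: "\<forall>\<^sub>F t in at_top. (deriv ^^ j) f t = p t * f t"
      "deriv_bigo (m - j) (\<lambda>t. L t ^ j) p" "p \<sim>[at_top] (\<lambda>t. (- (lam * ln t / t)) ^ j)"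
      and chain: "\<forall>i<j. \<forall>\<^sub>F t in at_top. ((deriv ^^ i) f has_real_derivative (deriv ^^ Suc i) f t) (at t)"
      by auto
    have mj: "m - j = Suc (m - Suc j)" using Suc.prems by auto
    obtain p' where p': "\<forall>\<^sub>F t in at_top. (p has_real_derivative p' t) (at t)"
      "deriv_bigo (m - Suc j) (\<lambda>t. L t ^ j / t) p'"
      using p(2) unfolding mj by auto
    define q where "q = (\<lambda>t. p' t + (- h t) * p t)"
    have "\<forall>\<^sub>F t in at_top. ((\<lambda>t. p t * f t) has_real_derivative q t * f t) (at t)"
      using p'(1) haz
    proof eventually_elim
      case (elim t)
      show ?case unfolding q_def
        by (rule DERIV_mult[OF elim, THEN DERIV_cong]) (simp add: algebra_simps)
    qed
    note d = has_real_derivative_higher_deriv[OF p(1) this]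
    have D': "deriv_bigo r L h" if "r \<le> m - 1" for r
      using that D by (induction rule: inc_induct) (auto dest: deriv_bigo_Suc_D simp del: deriv_bigo.simps)
    have neg: "deriv_bigo r \<phi> (\<lambda>t. - g t)" if "deriv_bigo r \<phi> g" for r \<phi> g
      using that
    proof (induction r arbitrary: \<phi> g)
      case (Suc r)
      then obtain g' where g': "g \<in> O(\<phi>)" "\<forall>\<^sub>F t in at_top. (g has_real_derivative g' t) (at t)"
        "deriv_bigo r (\<lambda>t. \<phi> t / t) g'" by auto
      have "\<forall>\<^sub>F t in at_top. ((\<lambda>t. - g t) has_real_derivative - g' t) (at t)"
        using g'(2) by eventually_elim (rule DERIV_minus)
      then show ?case using Suc.IH[OF g'(3)] g'(1) by auto
    qed simp
    \<comment> \<open>The logarithm in \<open>h\<close> decides: differentiating \<open>p\<close>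
      gains \<open>1 / t\<close>, which is of smaller order than the \<open>ln t / t\<close> gained
      from a factor \<open>h\<close>.\<close>
    have o1: "(\<lambda>t::real. 1 / t) \<in> o(L)" unfolding L_def by real_asymp
    have small: "(\<lambda>t. L t ^ j / t) \<in> o(\<lambda>t. L t ^ Suc j)"
      using landau_o.big_small_mult[OF landau_o.big_refl o1, of "\<lambda>t. L t ^ j"]
      by (simp add: mult.commute)
    have qD: "deriv_bigo (m - Suc j) (\<lambda>t. L t ^ Suc j) q"
      unfolding q_def
    proof (rule deriv_bigo_add)
      show "deriv_bigo (m - Suc j) (\<lambda>t. L t ^ Suc j) p'"
        using p'(2) landau_o.small_imp_big[OF small] by (rule deriv_bigo_mono)
      have "deriv_bigo (m - Suc j) (\<lambda>t. L t * L t ^ j) (\<lambda>t. - h t * p t)"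
        using p(2) Suc.prems unfolding mj
        by (intro deriv_bigo_mult neg D') (auto intro: deriv_bigo_Suc_D simp del: deriv_bigo.simps)
      then show "deriv_bigo (m - Suc j) (\<lambda>t. L t ^ Suc j) (\<lambda>t. - h t * p t)" by simp
    qed
    have qa: "q \<sim>[at_top] (\<lambda>t. (- (lam * ln t / t)) ^ Suc j)"
    proof -
      have 1: "(\<lambda>t. - h t * p t) \<sim>[at_top] (\<lambda>t. - (lam * ln t / t) * (- (lam * ln t / t)) ^ j)"
        using h p(3) by (intro asymp_equiv_mult) (auto simp: asymp_equiv_uminus_iff intro: asymp_equiv_uminus)
      have "p' \<in> O(\<lambda>t. L t ^ j / t)" by (rule deriv_bigo_imp_bigo[OF p'(2)])
      also note small
      also have "(\<lambda>t. L t ^ Suc j) \<in> O(\<lambda>t. (- lam) ^ Suc j * L t ^ Suc j)"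
        using lam by simp
      also have "(\<lambda>t. (- lam) ^ Suc j * L t ^ Suc j) = (\<lambda>t. - (lam * ln t / t) * (- (lam * ln t / t)) ^ j)"
        unfolding L_def power_mult_distrib[symmetric] by (simp add: field_simps)
      finally have "p' \<in> o(\<lambda>t. - (lam * ln t / t) * (- (lam * ln t / t)) ^ j)" .
      from iffD2[OF asymp_equiv_add_left[OF this] 1]
      show ?thesis unfolding q_def by (simp only: power_Suc)
    qed
    show ?case
      using d qD qa chain by (intro exI[of _ q]) (auto simp: less_Suc_eq simp del: funpow.simps)
  qed
  show ?thesis
    unfolding reg_tail_def
  proof (intro conjI allI impI anti pos)
    fix j assume "j < m"
    then show "\<forall>\<^sub>F t in at_top. ((deriv ^^ j) f has_real_derivative (deriv ^^ Suc j) f t) (at t)"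
      using main[of "Suc j"] by auto
  next
    fix j assume "j \<le> m"
    then obtain p where p: "\<forall>\<^sub>F t in at_top. (deriv ^^ j) f t = p t * f t"
      "p \<sim>[at_top] (\<lambda>t. (- (lam * ln t / t)) ^ j)" using main by blast
    have "(\<lambda>t. p t * f t) \<sim>[at_top] (\<lambda>t. (- (lam * ln t / t)) ^ j * f t)"
      by (intro asymp_equiv_mult p(2)) simp
    then show "(deriv ^^ j) f \<sim>[at_top] (\<lambda>t. (- (lam * ln t / t)) ^ j * f t)"
      by (rule asymp_equiv_transfer) (use p(1) in \<open>auto elim: eventually_mono\<close>)
  qed
qed

text \<open>By slow variation of the logarithm, \<open>ln (t / c) / (t / c) / c\<close> is
  equivalent to \<open>ln t / t\<close>, so the chain rule reproduces the same asymptotics with the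
  same \<open>lam\<close>.\<close>

lemma reg_tail_scale:
  assumes f: "reg_tail lam m f" and c: "c > 0"
  shows "reg_tail lam m (\<lambda>t. f (t / c))"
proof -
  have anti: "antimono f" and pos: "\<And>t. f t > 0"
    and chain: "\<And>j. j < m \<Longrightarrow> \<forall>\<^sub>F t in at_top. ((deriv ^^ j) f has_real_derivative (deriv ^^ Suc j) f t) (at t)"
    and asy: "\<And>j. j \<le> m \<Longrightarrow> (deriv ^^ j) f \<sim>[at_top] (\<lambda>t. (- (lam * ln t / t)) ^ j * f t)"
    using f unfolding reg_tail_def by auto
  let ?g = "\<lambda>t. f (t / c)"
  have lim: "filterlim (\<lambda>t. t / c) at_top at_top" using c by real_asymp
  have E: "(\<forall>\<^sub>F t in at_top. (deriv ^^ j) ?g t = (deriv ^^ j) f (t / c) / c ^ j) \<and>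
     (\<forall>i<j. \<forall>\<^sub>F t in at_top. ((deriv ^^ i) ?g has_real_derivative (deriv ^^ Suc i) ?g t) (at t))"
    if "j \<le> m" for j
    using that
  proof (induction j)
    case (Suc j)
    have "\<forall>\<^sub>F t in at_top. ((deriv ^^ j) f has_real_derivative (deriv ^^ Suc j) f (t / c)) (at (t / c))"
      using eventually_compose_filterlim[OF chain lim] Suc.prems by auto
    then have "\<forall>\<^sub>F t in at_top. ((\<lambda>t. (deriv ^^ j) f (t / c) / c ^ j) has_real_derivative
        (deriv ^^ Suc j) f (t / c) / c ^ Suc j) (at t)"
    proof eventually_elim
      case (elim t)
      have "((\<lambda>t. t / c) has_real_derivative 1 / c) (at t)"
        using c by (auto intro!: derivative_eq_intros)
      from DERIV_chain2[OF elim this]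
      show ?case using c by (auto intro!: derivative_eq_intros simp del: funpow.simps)
    qed
    from has_real_derivative_higher_deriv[OF conjunct1[OF Suc.IH] this] Suc
    show ?case by (auto simp: less_Suc_eq simp del: funpow.simps)
  qed simp
  show ?thesis
    unfolding reg_tail_def
  proof (intro conjI allI impI)
    show "antimono ?g" using anti c by (auto simp: monotone_def divide_right_mono)
    show "f (t / c) > 0" for t by (rule pos)
    show "\<forall>\<^sub>F t in at_top. ((deriv ^^ j) ?g has_real_derivative (deriv ^^ Suc j) ?g t) (at t)" if "j < m" for j
      using E[of "Suc j"] that by auto
    fix j assume j: "j \<le> m"
    have l: "(\<lambda>t. lam * ln (t / c) / (t / c) / c) \<sim>[at_top] (\<lambda>t. lam * ln t / t)"
    proof -
      have "(\<lambda>t. ln (t / c) / (t / c) / c) \<sim>[at_top] (\<lambda>t. ln t / t)"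
        using c by real_asymp
      from asymp_equiv_mult[OF asymp_equiv_refl this, of "\<lambda>_. lam"]
      show ?thesis by (simp only: times_divide_eq_right)
    qed
    have "(\<lambda>t. (deriv ^^ j) f (t / c) / c ^ j) \<sim>[at_top] (\<lambda>t. ((- (lam * ln (t / c) / (t / c))) ^ j * f (t / c)) / c ^ j)"
      by (intro asymp_equiv_divide asymp_equiv_refl asymp_equiv_compose'[OF asy[OF j] lim])
    also have "(\<lambda>t. ((- (lam * ln (t / c) / (t / c))) ^ j * f (t / c)) / c ^ j) =
        (\<lambda>t. (- (lam * ln (t / c) / (t / c) / c)) ^ j * f (t / c))"
      using c unfolding minus_divide_left power_divide by (simp add: mult.commute divide_simps)
    also have "\<dots> \<sim>[at_top] (\<lambda>t. (- (lam * ln t / t)) ^ j * f (t / c))"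
      by (intro asymp_equiv_mult asymp_equiv_refl asymp_equiv_power asymp_equiv_uminus l)
    finally show "(deriv ^^ j) ?g \<sim>[at_top] (\<lambda>t. (- (lam * ln t / t)) ^ j * f (t / c))"
      by (rule asymp_equiv_transfer) (use E[OF j] in \<open>auto elim: eventually_mono\<close>)
  qed
qed

section \<open>Ratios and Taylor expansion of regular tails\<close>

text \<open>The derivative of \<open>f t * exp (\<mu> / 2 * (ln t)\<^sup>2)\<close> is this
  exponential times the expression in the second hypothesis. Comparison with such log-normal
  profiles takes the place of integrating the hazard rate.\<close>

lemma exp_ln_square_antimono:
  fixes f f' :: "real \<Rightarrow> real"
  assumes f': "\<forall>\<^sub>F t in at_top. (f has_real_derivative f' t) (at t)"
    and neg: "\<forall>\<^sub>F t in at_top. f' t + \<mu> * (ln t / t * f t) \<le> 0"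
  shows "\<exists>T\<ge>1. \<forall>t\<ge>T. \<forall>s\<ge>t. f s * exp (\<mu> / 2 * (ln s)\<^sup>2) \<le> f t * exp (\<mu> / 2 * (ln t)\<^sup>2)"
proof -
  obtain T where T: "\<And>t. t \<ge> T \<Longrightarrow> (f has_real_derivative f' t) (at t) \<and> f' t + \<mu> * (ln t / t * f t) \<le> 0"
    using eventually_conj[OF f' neg] by (auto simp: eventually_at_top_linorder)
  show ?thesis
  proof (intro exI[of _ "max 1 T"] conjI allI impI)
    fix t s :: real assume t: "max 1 T \<le> t" "t \<le> s"
    show "f s * exp (\<mu> / 2 * (ln s)\<^sup>2) \<le> f t * exp (\<mu> / 2 * (ln t)\<^sup>2)"
    proof (rule DERIV_nonpos_imp_nonincreasing[OF t(2)])
      fix x assume x: "t \<le> x" "x \<le> s"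
      then have X: "x > 0" "(f has_real_derivative f' x) (at x)" "f' x + \<mu> * (ln x / x * f x) \<le> 0"
        using T[of x] t by auto
      have D: "((\<lambda>x. f x * exp (\<mu> / 2 * (ln x)\<^sup>2)) has_real_derivative
          exp (\<mu> / 2 * (ln x)\<^sup>2) * (f' x + \<mu> * (ln x / x * f x))) (at x)"
        using X(1,2) by (auto intro!: derivative_eq_intros simp: field_simps)
      show "\<exists>y. ((\<lambda>x. f x * exp (\<mu> / 2 * (ln x)\<^sup>2)) has_real_derivative y) (at x) \<and> y \<le> 0"
        by (rule exI, rule conjI, rule D, rule mult_nonneg_nonpos) (use X(3) in auto)
    qed
  qed simp
qed

context
  fixes lam :: real and m :: nat and f :: "real \<Rightarrow> real"
  assumes f: "reg_tail lam m f" and lam: "lam > 0" and m: "m > 0"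
begin

lemma reg_tail_antimono: "x \<le> y \<Longrightarrow> f y \<le> f x"
  using f unfolding reg_tail_def monotone_def by auto

lemma reg_tail_pos: "f t > 0"
  using f unfolding reg_tail_def by auto

lemma reg_tail_chain:
  assumes "j < m"
  shows "\<forall>\<^sub>F t in at_top. ((deriv ^^ j) f has_real_derivative (deriv ^^ Suc j) f t) (at t)"
  using f assms unfolding reg_tail_def by blast

lemma reg_tail_asymp:
  assumes "j \<le> m"
  shows "((\<lambda>t. (deriv ^^ j) f t / ((ln t / t) ^ j * f t)) \<longlongrightarrow> (- lam) ^ j) at_top"
proof -
  have "(deriv ^^ j) f \<sim>[at_top] (\<lambda>t. (- (lam * ln t / t)) ^ j * f t)"
    using f assms unfolding reg_tail_def by blast
  from asymp_equivD[OF this]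
  have "((\<lambda>t. (- lam) ^ j * (if (deriv ^^ j) f t = 0 \<and> (- (lam * ln t / t)) ^ j * f t = 0 then 1
      else (deriv ^^ j) f t / ((- (lam * ln t / t)) ^ j * f t))) \<longlongrightarrow> (- lam) ^ j * 1) at_top"
    by (intro tendsto_intros)
  then have lim: "((\<lambda>t. (- lam) ^ j * (if (deriv ^^ j) f t = 0 \<and> (- (lam * ln t / t)) ^ j * f t = 0 then 1
      else (deriv ^^ j) f t / ((- (lam * ln t / t)) ^ j * f t))) \<longlongrightarrow> (- lam) ^ j) at_top"
    by (simp only: mult_1_right)
  have "\<forall>\<^sub>F t in at_top. (- lam) ^ j * (if (deriv ^^ j) f t = 0 \<and> (- (lam * ln t / t)) ^ j * f t = 0 then 1
      else (deriv ^^ j) f t / ((- (lam * ln t / t)) ^ j * f t)) = (deriv ^^ j) f t / ((ln t / t) ^ j * f t)"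
  proof (rule eventually_mono[OF eventually_gt_at_top[of 1]])
    fix t :: real assume t: "1 < t"
    have *: "c * (if d = 0 \<and> c * e * g = 0 then 1 else d / (c * e * g)) = d / (e * g)"
      if "c \<noteq> 0" "e \<noteq> 0" "g \<noteq> 0" for c d e g :: real
      using that by auto
    have eq: "(- (lam * ln t / t)) ^ j = (- lam) ^ j * (ln t / t) ^ j"
      unfolding power_mult_distrib[symmetric] by simp
    show "(- lam) ^ j * (if (deriv ^^ j) f t = 0 \<and> (- (lam * ln t / t)) ^ j * f t = 0 then 1
      else (deriv ^^ j) f t / ((- (lam * ln t / t)) ^ j * f t)) = (deriv ^^ j) f t / ((ln t / t) ^ j * f t)"
      unfolding eq by (rule *) (use t lam reg_tail_pos[of t] in auto)
  qed
  with lim show ?thesis by (rule Lim_transform_eventually)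
qed

lemma reg_tail_deriv:
  "\<forall>\<^sub>F t in at_top. (f has_real_derivative deriv f t) (at t)"
  "((\<lambda>t. deriv f t / (ln t / t * f t)) \<longlongrightarrow> - lam) at_top"
  using reg_tail_chain[OF m] reg_tail_asymp[of 1] m by auto

lemma ln_over_self_pos: "t > 1 \<Longrightarrow> ln t / t * f t > 0"
  using reg_tail_pos[of t] by simp

lemma reg_tail_exp_antimono:
  assumes "\<mu> < lam"
  shows "\<exists>T\<ge>1. \<forall>t\<ge>T. \<forall>s\<ge>t. f s * exp (\<mu> / 2 * (ln s)\<^sup>2) \<le> f t * exp (\<mu> / 2 * (ln t)\<^sup>2)"
proof (rule exp_ln_square_antimono[OF reg_tail_deriv(1)])
  have "\<forall>\<^sub>F t in at_top. deriv f t / (ln t / t * f t) < - \<mu>"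
    by (rule order_tendstoD(2)[OF reg_tail_deriv(2)]) (use assms in simp)
  then show "\<forall>\<^sub>F t in at_top. deriv f t + \<mu> * (ln t / t * f t) \<le> 0"
    using eventually_gt_at_top[of 1]
  proof eventually_elim
    case (elim t)
    then have "deriv f t < - \<mu> * (ln t / t * f t)" using pos_divide_less_eq[OF ln_over_self_pos] by blast
    then show ?case by simp
  qed
qed

text \<open>Applied to \<open>- f\<close>, \<open>exp_ln_square_antimono\<close> gives the reverse
  monotonicity once \<open>\<mu>\<close> exceeds \<open>lam\<close>.\<close>

lemma reg_tail_exp_mono:
  assumes "\<mu> > lam"
  shows "\<exists>T\<ge>1. \<forall>t\<ge>T. \<forall>s\<ge>t. f t * exp (\<mu> / 2 * (ln t)\<^sup>2) \<le> f s * exp (\<mu> / 2 * (ln s)\<^sup>2)"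
proof -
  have "\<forall>\<^sub>F t in at_top. - \<mu> < deriv f t / (ln t / t * f t)"
    by (rule order_tendstoD(1)[OF reg_tail_deriv(2)]) (use assms in simp)
  then have "\<forall>\<^sub>F t in at_top. - deriv f t + \<mu> * (ln t / t * - f t) \<le> 0"
    using eventually_gt_at_top[of 1]
  proof eventually_elim
    case (elim t)
    then have "- \<mu> * (ln t / t * f t) < deriv f t" using pos_less_divide_eq[OF ln_over_self_pos] by blast
    then show ?case by simp
  qed
  moreover have "\<forall>\<^sub>F t in at_top. ((\<lambda>t. - f t) has_real_derivative - deriv f t) (at t)"
    using reg_tail_deriv(1) by eventually_elim (rule DERIV_minus)
  ultimately show ?thesis using exp_ln_square_antimono[of "\<lambda>t. - f t" "\<lambda>t. - deriv f t" \<mu>] by simp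
qed

lemma reg_tail_bigo_exp:
  assumes "\<mu> < lam"
  shows "f \<in> O(\<lambda>t. exp (- (\<mu> / 2 * (ln t)\<^sup>2)))"
proof -
  obtain T where T: "T \<ge> 1" "\<And>t s. t \<ge> T \<Longrightarrow> s \<ge> t \<Longrightarrow> f s * exp (\<mu> / 2 * (ln s)\<^sup>2) \<le> f t * exp (\<mu> / 2 * (ln t)\<^sup>2)"
    using reg_tail_exp_antimono[OF assms] by blast
  show ?thesis
  proof (rule bigoI[where c = "f T * exp (\<mu> / 2 * (ln T)\<^sup>2)"], rule eventually_mono[OF eventually_ge_at_top[of T]])
    fix t assume "t \<ge> T"
    then show "norm (f t) \<le> f T * exp (\<mu> / 2 * (ln T)\<^sup>2) * norm (exp (- (\<mu> / 2 * (ln t)\<^sup>2)))"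
      using T(2)[of T t] reg_tail_pos[of t] by (simp add: exp_minus field_simps)
  qed
qed

lemma reg_tail_bigomega_exp:
  assumes "\<mu> > lam"
  shows "(\<lambda>t. exp (- (\<mu> / 2 * (ln t)\<^sup>2))) \<in> O(f)"
proof -
  obtain T where T: "T \<ge> 1" "\<And>t s. t \<ge> T \<Longrightarrow> s \<ge> t \<Longrightarrow> f t * exp (\<mu> / 2 * (ln t)\<^sup>2) \<le> f s * exp (\<mu> / 2 * (ln s)\<^sup>2)"
    using reg_tail_exp_mono[OF assms] by blast
  show ?thesis
  proof (rule bigoI[where c = "1 / (f T * exp (\<mu> / 2 * (ln T)\<^sup>2))"], rule eventually_mono[OF eventually_ge_at_top[of T]])
    fix t assume "t \<ge> T"
    then show "norm (exp (- (\<mu> / 2 * (ln t)\<^sup>2))) \<le> 1 / (f T * exp (\<mu> / 2 * (ln T)\<^sup>2)) * norm (f t)"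
      using T(2)[of T t] reg_tail_pos[of t] reg_tail_pos[of T] by (simp add: exp_minus field_simps)
  qed
qed

section \<open>Potter-type ratio bounds, shifts and Taylor's formula\<close>

lemma reg_tail_ratio_upper:
  assumes "\<mu> > lam"
  shows "\<exists>T\<ge>1. \<forall>t\<ge>T. \<forall>s\<ge>t. f t \<le> f s * exp (\<mu> / 2 * ((ln s)\<^sup>2 - (ln t)\<^sup>2))"
proof -
  obtain T where T: "T \<ge> 1" "\<And>t s. t \<ge> T \<Longrightarrow> s \<ge> t \<Longrightarrow> f t * exp (\<mu> / 2 * (ln t)\<^sup>2) \<le> f s * exp (\<mu> / 2 * (ln s)\<^sup>2)"
    using reg_tail_exp_mono[OF assms] by blast
  have "f t \<le> f s * exp (\<mu> / 2 * ((ln s)\<^sup>2 - (ln t)\<^sup>2))" if "t \<ge> T" "s \<ge> t" for s t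
    using T(2)[OF that] unfolding right_diff_distrib exp_diff
    by (simp only: times_divide_eq_right pos_le_divide_eq[OF exp_gt_zero])
  with T(1) show ?thesis by blast
qed

lemma reg_tail_ratio_lower:
  assumes "\<mu> < lam"
  shows "\<exists>T\<ge>1. \<forall>t\<ge>T. \<forall>s\<ge>t. f s \<le> f t * exp (- (\<mu> / 2 * ((ln s)\<^sup>2 - (ln t)\<^sup>2)))"
proof -
  obtain T where T: "T \<ge> 1" "\<And>t s. t \<ge> T \<Longrightarrow> s \<ge> t \<Longrightarrow> f s * exp (\<mu> / 2 * (ln s)\<^sup>2) \<le> f t * exp (\<mu> / 2 * (ln t)\<^sup>2)"
    using reg_tail_exp_antimono[OF assms] by blast
  have "f s \<le> f t * exp (- (\<mu> / 2 * ((ln s)\<^sup>2 - (ln t)\<^sup>2)))" if "t \<ge> T" "s \<ge> t" for s t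
    using T(2)[OF that] unfolding right_diff_distrib minus_diff_eq exp_diff
    by (simp only: times_divide_eq_right pos_le_divide_eq[OF exp_gt_zero])
  with T(1) show ?thesis by blast
qed

text \<open>Since \<open>(ln t)\<^sup>2 - (ln (t - a))\<^sup>2\<close> tends to 0, the ratio bound
  with any constant above \<open>lam\<close>, here \<open>2 * lam\<close>, shows that the tail is
  insensitive to bounded shifts.\<close>

lemma reg_tail_shift:
  assumes "a > 0"
  shows "((\<lambda>t. f (t - a) / f t) \<longlongrightarrow> 1) at_top" and "((\<lambda>t. f (t + a) / f t) \<longlongrightarrow> 1) at_top"
proof -
  obtain T where T: "T \<ge> 1" "\<And>t s. t \<ge> T \<Longrightarrow> s \<ge> t \<Longrightarrow> f t \<le> f s * exp (2 * lam / 2 * ((ln s)\<^sup>2 - (ln t)\<^sup>2))"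
    using reg_tail_ratio_upper[of "2 * lam"] lam by auto
  show "((\<lambda>t. f (t - a) / f t) \<longlongrightarrow> 1) at_top"
  proof (rule tendsto_sandwich[of "\<lambda>_. 1" _ _ "\<lambda>t. exp (2 * lam / 2 * ((ln t)\<^sup>2 - (ln (t - a))\<^sup>2))"])
    show "\<forall>\<^sub>F t in at_top. 1 \<le> f (t - a) / f t"
      using reg_tail_pos reg_tail_antimono assms by (intro always_eventually) (simp add: le_divide_eq_1_pos)
    show "\<forall>\<^sub>F t in at_top. f (t - a) / f t \<le> exp (2 * lam / 2 * ((ln t)\<^sup>2 - (ln (t - a))\<^sup>2))"
      by (rule eventually_mono[OF eventually_ge_at_top[of "T + a"]])
        (use T(2)[of "_ - a"] reg_tail_pos assms in \<open>simp add: pos_divide_le_eq mult.commute\<close>)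
    show "((\<lambda>t. exp (2 * lam / 2 * ((ln t)\<^sup>2 - (ln (t - a))\<^sup>2))) \<longlongrightarrow> 1) at_top"
      by real_asymp
  qed simp
  have *: "exp (- x) \<le> v / u" if "u \<le> v * exp x" "u > 0" for u v x :: real
    using that by (simp add: exp_minus field_simps)
  show "((\<lambda>t. f (t + a) / f t) \<longlongrightarrow> 1) at_top"
  proof (rule tendsto_sandwich[of "\<lambda>t. exp (- (2 * lam / 2 * ((ln (t + a))\<^sup>2 - (ln t)\<^sup>2)))" _ _ "\<lambda>_. 1"])
    show "\<forall>\<^sub>F t in at_top. f (t + a) / f t \<le> 1"
      using reg_tail_pos reg_tail_antimono assms by (intro always_eventually) (simp add: divide_le_eq_1_pos)
    show "\<forall>\<^sub>F t in at_top. exp (- (2 * lam / 2 * ((ln (t + a))\<^sup>2 - (ln t)\<^sup>2))) \<le> f (t + a) / f t"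
      by (rule eventually_mono[OF eventually_ge_at_top[of T]])
        (intro * T(2) reg_tail_pos; use assms in simp)
    show "((\<lambda>t. exp (- (2 * lam / 2 * ((ln (t + a))\<^sup>2 - (ln t)\<^sup>2)))) \<longlongrightarrow> 1) at_top"
      by real_asymp
  qed simp
qed

text \<open>In this form the asymptotics apply to the unspecified intermediate point of Taylor's
  formula, which stays at bounded distance from \<open>t\<close> while \<open>w\<close> is
  fixed.\<close>

lemma reg_tail_deriv_shift:
  assumes n: "n \<le> m" and \<xi>: "\<forall>\<^sub>F t in at_top. \<bar>\<xi> t - t\<bar> \<le> a" and a: "a > 0"
  shows "((\<lambda>t. (deriv ^^ n) f (\<xi> t) / ((ln t / t) ^ n * f t)) \<longlongrightarrow> (- lam) ^ n) at_top"
proof -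
  have lim: "filterlim \<xi> at_top at_top"
  proof (rule filterlim_at_top_mono)
    show "filterlim (\<lambda>t. t - a) at_top at_top" by real_asymp
    show "\<forall>\<^sub>F t in at_top. t - a \<le> \<xi> t" using \<xi> by eventually_elim linarith
  qed
  have 1: "((\<lambda>t. (deriv ^^ n) f (\<xi> t) / ((ln (\<xi> t) / \<xi> t) ^ n * f (\<xi> t))) \<longlongrightarrow> (- lam) ^ n) at_top"
    by (rule filterlim_compose[OF reg_tail_asymp[OF n] lim])
  have 2: "((\<lambda>t. (ln (\<xi> t) / \<xi> t) / (ln t / t)) \<longlongrightarrow> 1) at_top"
  proof (rule tendsto_sandwich)
    show "((\<lambda>t. (ln (t - a) / (t + a)) / (ln t / t)) \<longlongrightarrow> 1) at_top" by real_asymp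
    show "((\<lambda>t. (ln (t + a) / (t - a)) / (ln t / t)) \<longlongrightarrow> 1) at_top" by real_asymp
    show "\<forall>\<^sub>F t in at_top. (ln (t - a) / (t + a)) / (ln t / t) \<le> (ln (\<xi> t) / \<xi> t) / (ln t / t)"
      using \<xi> eventually_gt_at_top[of "a + 1"]
      by eventually_elim (use a in \<open>intro divide_right_mono frac_le; auto\<close>)
    show "\<forall>\<^sub>F t in at_top. (ln (\<xi> t) / \<xi> t) / (ln t / t) \<le> (ln (t + a) / (t - a)) / (ln t / t)"
      using \<xi> eventually_gt_at_top[of "a + 1"]
      by eventually_elim (use a in \<open>intro divide_right_mono frac_le; auto\<close>)
  qed
  have 3: "((\<lambda>t. f (\<xi> t) / f t) \<longlongrightarrow> 1) at_top"
  proof (rule tendsto_sandwich[OF _ _ reg_tail_shift(2,1)[OF a]])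
    show "\<forall>\<^sub>F t in at_top. f (t + a) / f t \<le> f (\<xi> t) / f t"
      using \<xi> by eventually_elim (intro divide_right_mono reg_tail_antimono less_imp_le[OF reg_tail_pos], linarith)
    show "\<forall>\<^sub>F t in at_top. f (\<xi> t) / f t \<le> f (t - a) / f t"
      using \<xi> by eventually_elim (intro divide_right_mono reg_tail_antimono less_imp_le[OF reg_tail_pos], linarith)
  qed
  have "((\<lambda>t. (deriv ^^ n) f (\<xi> t) / ((ln (\<xi> t) / \<xi> t) ^ n * f (\<xi> t)) *
      ((ln (\<xi> t) / \<xi> t) / (ln t / t)) ^ n * (f (\<xi> t) / f t)) \<longlongrightarrow> (- lam) ^ n * 1 ^ n * 1) at_top"
    by (intro tendsto_mult tendsto_power 1 2 3)
  then have *: "((\<lambda>t. (deriv ^^ n) f (\<xi> t) / ((ln (\<xi> t) / \<xi> t) ^ n * f (\<xi> t)) *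
      ((ln (\<xi> t) / \<xi> t) / (ln t / t)) ^ n * (f (\<xi> t) / f t)) \<longlongrightarrow> (- lam) ^ n) at_top"
    by simp
  have "\<forall>\<^sub>F t in at_top. \<xi> t > 1"
    using lim by (simp add: filterlim_at_top_dense)
  with eventually_gt_at_top[of 1]
  have "\<forall>\<^sub>F t in at_top. (deriv ^^ n) f (\<xi> t) / ((ln (\<xi> t) / \<xi> t) ^ n * f (\<xi> t)) *
      ((ln (\<xi> t) / \<xi> t) / (ln t / t)) ^ n * (f (\<xi> t) / f t) = (deriv ^^ n) f (\<xi> t) / ((ln t / t) ^ n * f t)"
  proof eventually_elim
    case (elim t)
    then have "(ln (\<xi> t) / \<xi> t) ^ n \<noteq> 0" "f (\<xi> t) \<noteq> 0"
      using reg_tail_pos[of "\<xi> t"] by auto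
    have *: "d / (P * F) * (P / Q) * (F / f0) = d / (Q * f0)" if "P \<noteq> 0" "F \<noteq> 0" for d P F Q f0 :: real
      using that by simp
    show ?case unfolding power_divide[of "ln (\<xi> t) / \<xi> t" "ln t / t"] by (rule *) fact+
  qed
  with * show ?thesis by (rule Lim_transform_eventually)
qed

text \<open>The bound \<open>\<bar>w\<bar> \<le> t / 2\<close> keeps the segment between
  \<open>t\<close> and \<open>t - w\<close> above \<open>t / 2\<close>, where the derivatives exist.
  The intermediate point is described only by its distance from \<open>t\<close>, which also covers
  \<open>n = 0\<close> and \<open>w = 0\<close>.\<close>

lemma reg_tail_Taylor:
  assumes n: "n \<le> m"
  shows "\<exists>T. \<forall>t\<ge>T. \<forall>w. \<bar>w\<bar> \<le> t / 2 \<longrightarrow> (\<exists>x. \<bar>x - t\<bar> \<le> \<bar>w\<bar> \<and>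
    f (t - w) = (\<Sum>j<n. (- w) ^ j / fact j * (deriv ^^ j) f t) + (- w) ^ n / fact n * (deriv ^^ n) f x)"
proof -
  have "\<forall>\<^sub>F t in at_top. \<forall>j\<in>{..<n}. ((deriv ^^ j) f has_real_derivative (deriv ^^ Suc j) f t) (at t)"
    by (rule eventually_ball_finite) (use reg_tail_chain n in auto)
  then obtain T where T: "\<And>t j. t \<ge> T \<Longrightarrow> j < n \<Longrightarrow> ((deriv ^^ j) f has_real_derivative (deriv ^^ Suc j) f t) (at t)"
    by (auto simp: eventually_at_top_linorder)
  show ?thesis
  proof (rule exI[of _ "2 * T"], intro allI impI)
    fix t w :: real assume t: "t \<ge> 2 * T" "\<bar>w\<bar> \<le> t / 2"
    consider "n = 0" | "n > 0" "w = 0" | "n > 0" "w \<noteq> 0" by blast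
    then show "\<exists>x. \<bar>x - t\<bar> \<le> \<bar>w\<bar> \<and>
      f (t - w) = (\<Sum>j<n. (- w) ^ j / fact j * (deriv ^^ j) f t) + (- w) ^ n / fact n * (deriv ^^ n) f x"
    proof cases
      case 1
      then show ?thesis by (intro exI[of _ "t - w"]) auto
    next
      case 2
      have "(\<Sum>j<n. (- w) ^ j / fact j * (deriv ^^ j) f t) = (\<Sum>j<n. if j = 0 then f t else 0)"
        by (rule sum.cong) (use 2 in auto)
      with 2 show ?thesis by (intro exI[of _ t]) auto
    next
      case 3
      have "\<exists>x. (if t - w < t then t - w < x \<and> x < t else t < x \<and> x < t - w) \<and>
        f (t - w) = (\<Sum>j<n. ((deriv ^^ j) f t / fact j) * (t - w - t) ^ j) + ((deriv ^^ n) f x / fact n) * (t - w - t) ^ n"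
        by (rule Taylor[where a = "t - \<bar>w\<bar>" and b = "t + \<bar>w\<bar>"]) (use 3 t T in auto)
      then obtain x where "if t - w < t then t - w < x \<and> x < t else t < x \<and> x < t - w"
        "f (t - w) = (\<Sum>j<n. ((deriv ^^ j) f t / fact j) * (t - w - t) ^ j) + ((deriv ^^ n) f x / fact n) * (t - w - t) ^ n"
        by blast
      then show ?thesis
        by (intro exI[of _ x]) (auto simp: mult.commute split: if_splits)
    qed
  qed
qed

text \<open>Dominated convergence, with the two regimes separated by \<open>\<bar>w\<bar> = t / ln t\<close>: below it
  \<open>f (t - w) / f t\<close> stays bounded, above it every power of \<open>t\<close> is at most a power of \<open>\<bar>w\<bar>\<close>.\<close>
lemma reg_tail_expansion:
  fixes \<nu> :: "real measure"
  assumes n: "n \<le> m" and "prob_space \<nu>" and sets: "sets \<nu> = sets borel"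
    and mom: "\<And>p. integrable \<nu> (\<lambda>w. \<bar>w\<bar> ^ p)"
  shows "(\<lambda>t. (\<integral>w. indicator {..t/2} w * f (t - w) \<partial>\<nu>) - laplace_char \<nu> n f t)
    \<in> o(\<lambda>t. (ln t / t) ^ n * f t)"
proof -
  interpret prob_space \<nu> by fact
  define P where "P = (\<lambda>t w. \<Sum>j\<le>n. (- w) ^ j / fact j * (deriv ^^ j) f t)"
  define D where "D = (\<lambda>t w. indicator {..t/2} w * f (t - w) - P t w)"
  define L where "L = (\<lambda>t::real. ln t / t)"
  have meas_f: "f \<in> borel_measurable borel"
  proof -
    have "mono (\<lambda>t. - f t)" using reg_tail_antimono by (auto simp: mono_def)
    from borel_measurable_uminus[OF borel_measurable_mono[OF this]] show ?thesis by simp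
  qed
  have [measurable]: "(\<lambda>w. f (t - w)) \<in> borel_measurable \<nu>" for t
    unfolding measurable_cong_sets[OF sets refl] using meas_f by measurable
  have [measurable]: "indicator {..t} \<in> borel_measurable \<nu>" for t :: real
    unfolding measurable_cong_sets[OF sets refl] by measurable
  have [measurable]: "(\<lambda>w. w) \<in> borel_measurable \<nu>"
    unfolding measurable_cong_sets[OF sets refl] by measurable
  have mom': "integrable \<nu> (\<lambda>w. w ^ p)" for p
    using mom[of p] by (subst integrable_norm_iff[symmetric]) (auto simp: power_abs)
  have int1: "integrable \<nu> (\<lambda>w. indicator {..t/2} w * f (t - w))" for t
  proof (rule integrable_const_bound[where B = "f (t/2)"])
    show "AE w in \<nu>. norm (indicator {..t/2} w * f (t - w)) \<le> f (t/2)"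
      using less_imp_le[OF reg_tail_pos] by (intro AE_I2) (auto simp: indicator_def intro: reg_tail_antimono)
  qed measurable
  have P_eq: "P t w = (\<Sum>j\<le>n. (-1) ^ j / fact j * (deriv ^^ j) f t * w ^ j)" for t w
    unfolding P_def by (intro sum.cong refl) (subst power_minus, simp)
  have int2: "integrable \<nu> (P t)" for t
    unfolding P_eq[abs_def] by (intro Bochner_Integration.integrable_sum integrable_mult_right mom')
  have Pint: "(\<integral>w. P t w \<partial>\<nu>) = laplace_char \<nu> n f t" for t
    unfolding P_eq[abs_def] laplace_char_def
    by (subst Bochner_Integration.integral_sum) (auto intro!: mom' sum.cong)
  have intD: "(\<integral>w. D t w \<partial>\<nu>) = (\<integral>w. indicator {..t/2} w * f (t - w) \<partial>\<nu>) - laplace_char \<nu> n f t" for t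
    unfolding D_def by (subst Bochner_Integration.integral_diff[OF int1 int2]) (simp add: Pint)
  obtain T0 where T0: "\<And>t w. t \<ge> T0 \<Longrightarrow> \<bar>w\<bar> \<le> t / 2 \<Longrightarrow> \<exists>x. \<bar>x - t\<bar> \<le> \<bar>w\<bar> \<and>
    f (t - w) = (\<Sum>j<n. (- w) ^ j / fact j * (deriv ^^ j) f t) + (- w) ^ n / fact n * (deriv ^^ n) f x"
    using reg_tail_Taylor[OF n] by blast
  \<comment> \<open>The term of order \<open>n\<close> taken at \<open>t\<close> is subtracted as
    well, which leaves a difference of two \<open>n\<close>th derivatives: a remainder smaller than
    the last term and not merely of its order.\<close>
  have D_Taylor: "\<exists>x. \<bar>x - t\<bar> \<le> \<bar>w\<bar> \<and> D t w = (- w) ^ n / fact n * ((deriv ^^ n) f x - (deriv ^^ n) f t)"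
    if w: "t \<ge> T0" "\<bar>w\<bar> \<le> t / 2" for t w
  proof -
    from T0[OF w] obtain x where x: "\<bar>x - t\<bar> \<le> \<bar>w\<bar>"
      "f (t - w) = (\<Sum>j<n. (- w) ^ j / fact j * (deriv ^^ j) f t) + (- w) ^ n / fact n * (deriv ^^ n) f x"
      by blast
    have "P t w = (\<Sum>j<n. (- w) ^ j / fact j * (deriv ^^ j) f t) + (- w) ^ n / fact n * (deriv ^^ n) f t"
      unfolding P_def lessThan_Suc_atMost[symmetric] by simp
    then have "D t w = (- w) ^ n / fact n * ((deriv ^^ n) f x - (deriv ^^ n) f t)"
      unfolding D_def using w x by (simp add: indicator_def right_diff_distrib)
    with x show ?thesis by blast
  qed
  have Lf: "L t ^ n * f t > 0" if "t > 1" for t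
    unfolding L_def using that reg_tail_pos[of t] by simp
  have "((\<lambda>t. \<integral>w. D t w / (L t ^ n * f t) \<partial>\<nu>) \<longlongrightarrow> (\<integral>w. 0 \<partial>\<nu>)) at_top"
  proof -
    \<comment> \<open>Any base above the limiting \<open>lam\<close> would do; order 0 is treated
      apart because there the two powers coincide.\<close>
    have b1: "\<forall>\<^sub>F t in at_top. \<forall>j\<in>{..n}. \<bar>(deriv ^^ j) f t\<bar> \<le> (lam + 1) ^ j * (L t ^ j * f t)"
    proof (rule eventually_ball_finite, simp, rule ballI)
      fix j assume j: "j \<in> {..n}"
      show "\<forall>\<^sub>F t in at_top. \<bar>(deriv ^^ j) f t\<bar> \<le> (lam + 1) ^ j * (L t ^ j * f t)"
      proof (cases "j = 0")
        case True
        then show ?thesis using less_imp_le[OF reg_tail_pos] by auto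
      next
        case False
        have "((\<lambda>t. \<bar>(deriv ^^ j) f t / (L t ^ j * f t)\<bar>) \<longlongrightarrow> \<bar>(- lam) ^ j\<bar>) at_top"
          unfolding L_def using j n by (intro tendsto_rabs reg_tail_asymp) auto
        moreover have "\<bar>(- lam) ^ j\<bar> < (lam + 1) ^ j"
          using lam False by (simp add: power_abs power_strict_mono)
        ultimately have "\<forall>\<^sub>F t in at_top. \<bar>(deriv ^^ j) f t / (L t ^ j * f t)\<bar> < (lam + 1) ^ j"
          by (rule order_tendstoD)
        with eventually_gt_at_top[of 1] show ?thesis
        proof eventually_elim
          case (elim t)
          have "L t ^ j * f t > 0" unfolding L_def using elim reg_tail_pos[of t] by simp
          with elim(2) show ?case by (simp add: abs_divide pos_divide_less_eq)
        qed
      qed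
    qed
    then obtain T1 where T1: "\<And>t j. t \<ge> T1 \<Longrightarrow> j \<le> n \<Longrightarrow> \<bar>(deriv ^^ j) f t\<bar> \<le> (lam + 1) ^ j * (L t ^ j * f t)"
      by (auto simp: eventually_at_top_linorder)
    obtain T2 where T2: "T2 \<ge> 1" "\<And>t s. t \<ge> T2 \<Longrightarrow> s \<ge> t \<Longrightarrow> f t \<le> f s * exp (2 * lam / 2 * ((ln s)\<^sup>2 - (ln t)\<^sup>2))"
      using reg_tail_ratio_upper[of "2 * lam"] lam by auto
    \<comment> \<open>\<open>(ln t)\<^sup>2 - (ln (t/2))\<^sup>2\<close> is at most
      \<open>2 * ln t\<close>, so \<open>f (t/2) / f t\<close> is at most \<open>t\<close> to the
      power \<open>2 * lam\<close>, here rounded up.\<close>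
    define N where "N = nat \<lceil>2 * lam\<rceil>"
    have N: "2 * lam \<le> real N" unfolding N_def by linarith
    have b2: "\<forall>\<^sub>F t in at_top. f (t / 2) \<le> t ^ N * f t"
      using eventually_gt_at_top[of "2 * T2"]
    proof eventually_elim
      case (elim t)
      have t: "t > 1" "t / 2 \<ge> T2" "t \<ge> t / 2" using elim T2(1) by auto
      have "(ln t)\<^sup>2 - (ln (t/2))\<^sup>2 = (ln t - ln (t/2)) * (ln t + ln (t/2))" by (simp add: power2_eq_square algebra_simps)
      also have "\<dots> = ln 2 * (2 * ln t - ln 2)" using t by (simp add: ln_div)
      also have "\<dots> \<le> 1 * (2 * ln t)"
      proof (rule mult_mono)
        have "ln 2 \<le> ln t" using elim T2(1) by (intro ln_mono) auto
        then show "0 \<le> 2 * ln t - ln 2" using ln_ge_zero[of 2] by linarith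
      qed (use ln_2_less_1 in auto)
      finally have "2 * lam / 2 * ((ln t)\<^sup>2 - (ln (t/2))\<^sup>2) \<le> 2 * lam * ln t"
        using lam by simp
      also have "\<dots> \<le> real N * ln t" using N t by (intro mult_right_mono) auto
      finally have "exp (2 * lam / 2 * ((ln t)\<^sup>2 - (ln (t/2))\<^sup>2)) \<le> exp (real N * ln t)" by simp
      also have "\<dots> = t ^ N" using t by (simp add: exp_of_nat_mult)
      finally have "f t * exp (2 * lam / 2 * ((ln t)\<^sup>2 - (ln (t/2))\<^sup>2)) \<le> f t * t ^ N"
        by (intro mult_left_mono less_imp_le[OF reg_tail_pos])
      with T2(2)[OF t(2,3)] show ?case by (simp add: mult.commute)
    qed
    \<comment> \<open>\<open>(ln t)\<^sup>2 - (ln (t - t / ln t))\<^sup>2\<close> tends to 2: over a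
      distance \<open>t / ln t\<close> the tail changes by a bounded factor, which dictates where
      the two regimes are separated.\<close>
    have b3: "\<forall>\<^sub>F t in at_top. f (t - t / ln t) \<le> (exp (2 * lam) + 1) * f t"
    proof -
      have "((\<lambda>t. exp (2 * lam / 2 * ((ln t)\<^sup>2 - (ln (t - t / ln t))\<^sup>2))) \<longlongrightarrow> exp (2 * lam)) at_top"
        by real_asymp
      then have "\<forall>\<^sub>F t in at_top. exp (2 * lam / 2 * ((ln t)\<^sup>2 - (ln (t - t / ln t))\<^sup>2)) < exp (2 * lam) + 1"
        by (rule order_tendstoD) simp
      moreover have "\<forall>\<^sub>F t in at_top. t - t / ln t \<ge> T2" by real_asymp
      ultimately show ?thesis
        using eventually_gt_at_top[of 1]
      proof eventually_elim
        case (elim t)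
        have "f (t - t / ln t) \<le> f t * exp (2 * lam / 2 * ((ln t)\<^sup>2 - (ln (t - t / ln t))\<^sup>2))"
          using elim by (intro T2(2)) auto
        also have "\<dots> \<le> f t * (exp (2 * lam) + 1)"
          using elim by (intro mult_left_mono less_imp_le[OF reg_tail_pos]) auto
        finally show ?case by (simp add: mult.commute)
      qed
    qed
    \<comment> \<open>The three factors bound, in turn, the derivative at \<open>x\<close> in terms
      of \<open>L x\<close> and \<open>f x\<close>, the ratio \<open>L x / L t\<close> for
      \<open>x\<close> between \<open>t/2\<close> and \<open>2*t\<close>, and the ratio
      \<open>f x / f t\<close>.\<close>
    define C where "C = (lam + 1) ^ n * (4 ^ n * (exp (2 * lam) + 1))"
    have C0: "C > 0" unfolding C_def using lam by (simp add: add_pos_pos)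
    \<comment> \<open>The first summand serves \<open>\<bar>w\<bar> \<le> t / ln t\<close>. Beyond,
      \<open>t \<le> \<bar>w\<bar> ^ 2\<close>, and the factor \<open>t ^ (N + n)\<close> turns into
      \<open>\<bar>w\<bar> ^ (2 * (N + n))\<close>.\<close>
    define G where "G = (\<lambda>w. 2 * C * \<bar>w\<bar> ^ n + \<bar>w\<bar> ^ (2 * (N + n)) * (1 + (\<Sum>j\<le>n. (lam + 1) ^ j * \<bar>w\<bar> ^ j)))"
    have G0: "G w \<ge> 0" for w
      unfolding G_def using C0 lam by (intro add_nonneg_nonneg mult_nonneg_nonneg sum_nonneg) auto
    have dom: "\<forall>\<^sub>F t in at_top. \<forall>w. \<bar>D t w\<bar> \<le> G w * (L t ^ n * f t)"
    proof -
      have e: "\<forall>\<^sub>F t::real in at_top. t / ln t \<le> t / 2" "\<forall>\<^sub>F t::real in at_top. 1 / t \<le> ln t / t"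
        "\<forall>\<^sub>F t::real in at_top. t \<le> (t / ln t) ^ 2" "\<forall>\<^sub>F t::real in at_top. ln t / t \<le> 1"
        "\<forall>\<^sub>F t::real in at_top. ln (2 * t) / (t / 2) \<le> 4 * (ln t / t)"
        by real_asymp+
      show ?thesis
        using e b2 b3 eventually_gt_at_top[of 2] eventually_ge_at_top[of T0] eventually_ge_at_top[of "2 * T1"] eventually_ge_at_top[of T1]
      proof eventually_elim
        case (elim t)
        show ?case
        proof
          fix w
          have ft: "f t > 0" by (rule reg_tail_pos)
          have L1: "1 / t \<le> L t" "L t \<le> 1" "0 < L t" using elim by (auto simp: L_def)
          show "\<bar>D t w\<bar> \<le> G w * (L t ^ n * f t)"
          proof (cases "\<bar>w\<bar> \<le> t / ln t")
            case True
            have bnd: "\<bar>(deriv ^^ n) f x\<bar> \<le> C * (L t ^ n * f t)" if x: "\<bar>x - t\<bar> \<le> t / ln t" for x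
            proof -
              have x': "t / 2 \<le> x" "x \<le> 2 * t" using x elim(1) \<open>2 < t\<close> by linarith+
              have "\<bar>(deriv ^^ n) f x\<bar> \<le> (lam + 1) ^ n * (L x ^ n * f x)"
                using T1[of x n] x' elim by auto
              also have "\<dots> \<le> (lam + 1) ^ n * ((4 * L t) ^ n * ((exp (2 * lam) + 1) * f t))"
              proof (intro mult_left_mono mult_mono power_mono)
                have "L x \<le> ln (2 * t) / (t / 2)"
                  unfolding L_def using x' elim by (intro frac_le) auto
                then show "L x \<le> 4 * L t" using elim unfolding L_def by linarith
                show "0 \<le> L x" unfolding L_def using x' elim by auto
                have "f x \<le> f (t - t / ln t)" using x by (intro reg_tail_antimono) auto
                with elim show "f x \<le> (exp (2 * lam) + 1) * f t" by linarith
              qed (use lam L1 less_imp_le[OF reg_tail_pos] in auto)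
              also have "\<dots> = C * (L t ^ n * f t)"
                unfolding C_def power_mult_distrib by (simp only: ac_simps)
              finally show ?thesis .
            qed
            have "t \<ge> T0" "\<bar>w\<bar> \<le> t / 2" using elim(1) \<open>T0 \<le> t\<close> True by linarith+
            from D_Taylor[OF this] obtain x where x: "\<bar>x - t\<bar> \<le> \<bar>w\<bar>"
              "D t w = (- w) ^ n / fact n * ((deriv ^^ n) f x - (deriv ^^ n) f t)" by blast
            have "\<bar>D t w\<bar> = \<bar>w\<bar> ^ n / fact n * \<bar>(deriv ^^ n) f x - (deriv ^^ n) f t\<bar>"
              unfolding x(2) by (simp add: abs_mult power_abs)
            also have "\<dots> \<le> \<bar>w\<bar> ^ n / 1 * (2 * (C * (L t ^ n * f t)))"
            proof (intro mult_mono divide_left_mono)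
              have "\<bar>(deriv ^^ n) f x\<bar> \<le> C * (L t ^ n * f t)" "\<bar>(deriv ^^ n) f t\<bar> \<le> C * (L t ^ n * f t)"
                using x True elim by (auto intro!: bnd)
              then show "\<bar>(deriv ^^ n) f x - (deriv ^^ n) f t\<bar> \<le> 2 * (C * (L t ^ n * f t))" by linarith
            qed (auto simp: fact_ge_1)
            also have "\<dots> = (2 * C * \<bar>w\<bar> ^ n) * (L t ^ n * f t)" by simp
            also have "\<dots> \<le> G w * (L t ^ n * f t)"
              unfolding G_def using lam L1 ft
              by (intro mult_right_mono) (auto intro!: mult_nonneg_nonneg add_nonneg_nonneg sum_nonneg)
            finally show ?thesis .
          next
            case False
            have tw: "t \<le> \<bar>w\<bar> ^ 2"
            proof -
              have "t \<le> (t / ln t) ^ 2" using elim by simp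
              also have "\<dots> \<le> \<bar>w\<bar> ^ 2" using False elim by (intro power_mono) auto
              finally show ?thesis .
            qed
            have w1: "\<bar>w\<bar> ^ 2 \<ge> 1" using tw elim by linarith
            \<comment> \<open>Allows missing powers of \<open>L t\<close> to be inserted at the
              price of powers of \<open>t\<close>, so that every order up to \<open>n\<close> is
              compared with \<open>L t ^ n\<close>.\<close>
            have tL: "1 \<le> t * L t" using L1 elim by (simp add: pos_divide_le_eq mult.commute)
            have "\<bar>D t w\<bar> \<le> \<bar>indicator {..t/2} w * f (t - w)\<bar> + \<bar>P t w\<bar>" unfolding D_def by linarith
            also have "\<bar>indicator {..t/2} w * f (t - w)\<bar> \<le> f (t / 2)"
              using less_imp_le[OF reg_tail_pos] by (auto simp: indicator_def intro: reg_tail_antimono)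
            also have "f (t / 2) \<le> t ^ N * f t" using elim by simp
            also have "\<dots> \<le> t ^ N * ((t * L t) ^ n * f t)"
              using elim ft tL by (intro mult_left_mono) (auto simp: one_le_power)
            also have "\<dots> = t ^ (N + n) * (L t ^ n * f t)" by (simp add: power_add power_mult_distrib)
            also have "\<bar>P t w\<bar> \<le> (\<Sum>j\<le>n. t ^ (N + n) * ((lam + 1) ^ j * \<bar>w\<bar> ^ j) * (L t ^ n * f t))"
              unfolding P_def
            proof (rule order.trans[OF sum_abs sum_mono])
              fix j assume j: "j \<in> {..n}"
              have "\<bar>(- w) ^ j / fact j * (deriv ^^ j) f t\<bar> = \<bar>w\<bar> ^ j / fact j * \<bar>(deriv ^^ j) f t\<bar>"
                by (simp add: abs_mult power_abs)
              also have "\<dots> \<le> \<bar>w\<bar> ^ j / 1 * ((lam + 1) ^ j * (L t ^ j * f t))"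
                using j elim by (intro mult_mono divide_left_mono T1) (auto simp: fact_ge_1)
              also have "\<dots> = ((lam + 1) ^ j * \<bar>w\<bar> ^ j) * (1 * L t ^ j * f t)" by simp
              also have "\<dots> \<le> ((lam + 1) ^ j * \<bar>w\<bar> ^ j) * (t ^ (N + j) * (t * L t) ^ (n - j) * L t ^ j * f t)"
              proof (intro mult_left_mono mult_right_mono)
                have "1 * 1 \<le> t ^ (N + j) * (t * L t) ^ (n - j)"
                  using elim tL by (intro mult_mono one_le_power) auto
                then show "1 \<le> t ^ (N + j) * (t * L t) ^ (n - j)" by simp
              qed (use ft L1 lam in auto)
              also have "t ^ (N + j) * (t * L t) ^ (n - j) * L t ^ j = t ^ (N + j + (n - j)) * L t ^ (n - j + j)"
                by (simp only: power_add power_mult_distrib ac_simps)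
              also have "\<dots> = t ^ (N + n) * L t ^ n" using j by simp
              finally show "\<bar>(- w) ^ j / fact j * (deriv ^^ j) f t\<bar> \<le> t ^ (N + n) * ((lam + 1) ^ j * \<bar>w\<bar> ^ j) * (L t ^ n * f t)"
                by (simp add: mult_ac)
            qed
            also have "t ^ (N + n) * (L t ^ n * f t) + (\<Sum>j\<le>n. t ^ (N + n) * ((lam + 1) ^ j * \<bar>w\<bar> ^ j) * (L t ^ n * f t))
               = t ^ (N + n) * (1 + (\<Sum>j\<le>n. (lam + 1) ^ j * \<bar>w\<bar> ^ j)) * (L t ^ n * f t)"
              by (simp add: sum_distrib_left sum_distrib_right algebra_simps)
            also have "\<dots> \<le> (\<bar>w\<bar> ^ 2) ^ (N + n) * (1 + (\<Sum>j\<le>n. (lam + 1) ^ j * \<bar>w\<bar> ^ j)) * (L t ^ n * f t)"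
              using tw elim lam L1 ft
              by (intro mult_right_mono power_mono add_nonneg_nonneg sum_nonneg mult_nonneg_nonneg) auto
            also have "\<dots> \<le> G w * (L t ^ n * f t)"
              unfolding G_def power_mult[symmetric] using C0 L1 ft by (intro mult_right_mono) auto
            finally show ?thesis by simp
          qed
        qed
      qed
    qed
    show ?thesis
    proof (rule integral_dominated_convergence_at_top)
      show "(\<lambda>w. D t w / (L t ^ n * f t)) \<in> borel_measurable \<nu>" for t
        unfolding D_def P_def by measurable
      have G_eq: "G = (\<lambda>w. 2 * C * \<bar>w\<bar> ^ n + (\<bar>w\<bar> ^ (2 * (N + n)) + (\<Sum>j\<le>n. (lam + 1) ^ j * \<bar>w\<bar> ^ (2 * (N + n) + j))))"
        unfolding G_def distrib_left sum_distrib_left mult_1_right by (simp add: power_add ac_simps)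
      show "integrable \<nu> G"
        unfolding G_eq
        by (intro Bochner_Integration.integrable_add Bochner_Integration.integrable_sum integrable_mult_right mom)
      show "\<forall>\<^sub>F t in at_top. AE w in \<nu>. norm (D t w / (L t ^ n * f t)) \<le> G w"
        using dom eventually_gt_at_top[of 1]
      proof eventually_elim
        case (elim t)
        show ?case
          using elim Lf[of t] by (intro AE_I2) (simp add: abs_divide pos_divide_le_eq)
      qed
      show "AE w in \<nu>. ((\<lambda>t. D t w / (L t ^ n * f t)) \<longlongrightarrow> 0) at_top"
      proof (rule AE_I2)
        fix w
        have "\<exists>x. t \<ge> T0 \<and> \<bar>w\<bar> \<le> t / 2 \<longrightarrow> \<bar>x - t\<bar> \<le> \<bar>w\<bar> \<and>
            D t w = (- w) ^ n / fact n * ((deriv ^^ n) f x - (deriv ^^ n) f t)" for t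
          using D_Taylor[of t w] by blast
        then obtain \<xi> where \<xi>: "\<And>t. t \<ge> T0 \<Longrightarrow> \<bar>w\<bar> \<le> t / 2 \<Longrightarrow> \<bar>\<xi> t - t\<bar> \<le> \<bar>w\<bar> \<and>
            D t w = (- w) ^ n / fact n * ((deriv ^^ n) f (\<xi> t) - (deriv ^^ n) f t)"
          by metis
        have ev: "\<forall>\<^sub>F t in at_top. \<bar>\<xi> t - t\<bar> \<le> \<bar>w\<bar> + 1"
          using eventually_ge_at_top[of "max T0 (2 * \<bar>w\<bar>)"] by eventually_elim (use \<xi> in force)
        have "((\<lambda>t. (- w) ^ n / fact n * ((deriv ^^ n) f (\<xi> t) / (L t ^ n * f t) - (deriv ^^ n) f t / (L t ^ n * f t)))
            \<longlongrightarrow> (- w) ^ n / fact n * ((- lam) ^ n - (- lam) ^ n)) at_top"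
          unfolding L_def by (intro tendsto_intros reg_tail_deriv_shift[OF n ev] reg_tail_asymp n) auto
        then have lim: "((\<lambda>t. (- w) ^ n / fact n * ((deriv ^^ n) f (\<xi> t) / (L t ^ n * f t) - (deriv ^^ n) f t / (L t ^ n * f t)))
            \<longlongrightarrow> 0) at_top" by simp
        have "\<forall>\<^sub>F t in at_top. (- w) ^ n / fact n * ((deriv ^^ n) f (\<xi> t) / (L t ^ n * f t) - (deriv ^^ n) f t / (L t ^ n * f t))
            = D t w / (L t ^ n * f t)"
          using eventually_ge_at_top[of "max T0 (2 * \<bar>w\<bar>)"]
        proof eventually_elim
          case (elim t)
          then have "D t w = (- w) ^ n / fact n * ((deriv ^^ n) f (\<xi> t) - (deriv ^^ n) f t)" using \<xi>[of t] by auto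
          then show ?case unfolding diff_divide_distrib[symmetric] by (simp only: times_divide_eq_right)
        qed
        with lim show "((\<lambda>t. D t w / (L t ^ n * f t)) \<longlongrightarrow> 0) at_top" by (rule Lim_transform_eventually)
      qed
    qed simp
  qed
  then have "((\<lambda>t. (\<integral>w. D t w \<partial>\<nu>) / (L t ^ n * f t)) \<longlongrightarrow> 0) at_top"
    by simp
  then have "(\<lambda>t. \<integral>w. D t w \<partial>\<nu>) \<in> o(\<lambda>t. L t ^ n * f t)"
  proof (rule smalloI_tendsto)
    show "\<forall>\<^sub>F t in at_top. L t ^ n * f t \<noteq> 0"
      using eventually_gt_at_top[of 1] by eventually_elim (rule less_imp_neq[OF Lf, symmetric])
  qed
  then show ?thesis unfolding intD L_def .
qed

end

section \<open>Countable random sums\<close>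

lemma finite_exhaust: "finite {x \<in> A. to_nat (x :: 'a :: countable) < n}"
  by (rule finite_subset[OF _ finite_vimageI[of "{..<n}" to_nat]]) auto

text \<open>Initial segments of an enumeration are cofinal among the finite subsets, so
  unconditional sums become limits of sequences, as measurability and monotone convergence
  require.\<close>

lemma filterlim_exhaust:
  "filterlim (\<lambda>n. {x \<in> A. to_nat (x :: 'a :: countable) < n}) (finite_subsets_at_top A) sequentially"
  unfolding filterlim_finite_subsets_at_top
proof (intro allI impI)
  fix F assume F: "finite F \<and> F \<subseteq> A"
  obtain N where N: "\<And>x. x \<in> F \<Longrightarrow> to_nat x < N"
    using F by (meson finite_imageI finite_nat_set_iff_bounded imageI)
  show "\<forall>\<^sub>F n in sequentially. finite {x \<in> A. to_nat x < n} \<and> F \<subseteq> {x \<in> A. to_nat x < n} \<and> {x \<in> A. to_nat x < n} \<subseteq> A"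
    by (rule eventually_mono[OF eventually_ge_at_top[of N]])
      (use F in \<open>auto intro: finite_exhaust less_le_trans[OF N]\<close>)
qed

lemma infsum_exhaust:
  fixes f :: "'a :: countable \<Rightarrow> real"
  assumes "f summable_on A"
  shows "(\<lambda>n. \<Sum>x\<in>{x \<in> A. to_nat x < n}. f x) \<longlonglongrightarrow> infsum f A"
  using filterlim_compose[OF _ filterlim_exhaust] has_sum_infsum[OF assms] unfolding has_sum_def by blast

text \<open>With \<open>B\<close> and \<open>n\<close> natural numbers, summability is a countable
  condition, which makes the set of summable points measurable.\<close>

lemma summable_on_iff_bounded:
  fixes f :: "'a :: countable \<Rightarrow> real"
  shows "f summable_on A \<longleftrightarrow> (\<exists>B::nat. \<forall>n. (\<Sum>x\<in>{x \<in> A. to_nat x < n}. \<bar>f x\<bar>) \<le> real B)"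
proof
  assume "f summable_on A"
  then have s: "(\<lambda>x. \<bar>f x\<bar>) summable_on A"
    using summable_on_iff_abs_summable_on_real by fastforce
  obtain B :: nat where B: "infsum (\<lambda>x. \<bar>f x\<bar>) A \<le> real B" using real_arch_simple by blast
  have "(\<Sum>x\<in>{x \<in> A. to_nat x < n}. \<bar>f x\<bar>) \<le> infsum (\<lambda>x. \<bar>f x\<bar>) A" for n
    by (rule finite_sum_le_infsum[OF s finite_exhaust]) auto
  with B show "\<exists>B::nat. \<forall>n. (\<Sum>x\<in>{x \<in> A. to_nat x < n}. \<bar>f x\<bar>) \<le> real B"
    using order.trans by blast
next
  assume "\<exists>B::nat. \<forall>n. (\<Sum>x\<in>{x \<in> A. to_nat x < n}. \<bar>f x\<bar>) \<le> real B"
  then obtain B :: nat where B: "\<And>n. (\<Sum>x\<in>{x \<in> A. to_nat x < n}. \<bar>f x\<bar>) \<le> real B" by blast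
  have "(\<lambda>x. \<bar>f x\<bar>) summable_on A"
  proof (rule nonneg_bdd_above_summable_on)
    show "bdd_above (sum (\<lambda>x. \<bar>f x\<bar>) ` {F. F \<subseteq> A \<and> finite F})"
    proof (rule bdd_aboveI2)
      fix F assume F: "F \<in> {F. F \<subseteq> A \<and> finite F}"
      then obtain N where N: "\<And>x. x \<in> F \<Longrightarrow> to_nat x < N"
        by (metis (no_types, lifting) finite_imageI finite_nat_set_iff_bounded imageI mem_Collect_eq)
      have "(\<Sum>x\<in>F. \<bar>f x\<bar>) \<le> (\<Sum>x\<in>{x \<in> A. to_nat x < N}. \<bar>f x\<bar>)"
        by (rule sum_mono2[OF finite_exhaust]) (use F N in auto)
      also have "\<dots> \<le> real B" by (rule B)
      finally show "(\<Sum>x\<in>F. \<bar>f x\<bar>) \<le> real B" .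
    qed
  qed simp
  then show "f summable_on A"
    using summable_on_iff_abs_summable_on_real by fastforce
qed

text \<open>\<open>infsum\<close> takes the default value 0 where the family is not summable, so it
  is a sequential limit on a measurable set and 0 off it.\<close>

lemma borel_measurable_infsum:
  fixes f :: "'a :: countable \<Rightarrow> 'b \<Rightarrow> real"
  assumes [measurable]: "\<And>i. i \<in> A \<Longrightarrow> f i \<in> borel_measurable M"
  shows "(\<lambda>\<omega>. infsum (\<lambda>i. f i \<omega>) A) \<in> borel_measurable M"
proof -
  have s [measurable]: "(\<lambda>\<omega>. \<Sum>i\<in>{i \<in> A. to_nat i < n}. f i \<omega>) \<in> borel_measurable M"
      "(\<lambda>\<omega>. \<Sum>i\<in>{i \<in> A. to_nat i < n}. \<bar>f i \<omega>\<bar>) \<in> borel_measurable M" for n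
    by (auto intro!: borel_measurable_sum borel_measurable_abs)
  have "infsum (\<lambda>i. f i \<omega>) A = (if \<exists>B::nat. \<forall>n. (\<Sum>i\<in>{i \<in> A. to_nat i < n}. \<bar>f i \<omega>\<bar>) \<le> real B
      then lim (\<lambda>n. \<Sum>i\<in>{i \<in> A. to_nat i < n}. f i \<omega>) else 0)" for \<omega>
  proof (cases "(\<lambda>i. f i \<omega>) summable_on A")
    case True
    then show ?thesis
      unfolding summable_on_iff_bounded[symmetric] using limI[OF infsum_exhaust[OF True]] by simp
  next
    case False
    then show ?thesis
      unfolding summable_on_iff_bounded[symmetric] by (simp add: infsum_not_exists)
  qed
  then show ?thesis by simp
qed

text \<open>Jensen's inequality for the convex power, with the \<open>a i\<close> normalised to
  total mass 1. It bounds moments of a weighted sum by moments of one summand, uniformly in the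
  number of terms.\<close>

lemma power_sum_le:
  fixes a x :: "'i \<Rightarrow> real"
  assumes "finite F" "\<And>i. i \<in> F \<Longrightarrow> a i \<ge> 0" "\<And>i. i \<in> F \<Longrightarrow> x i \<ge> 0"
  shows "(\<Sum>i\<in>F. a i * x i) ^ Suc p \<le> (\<Sum>i\<in>F. a i) ^ p * (\<Sum>i\<in>F. a i * x i ^ Suc p)"
proof (cases "(\<Sum>i\<in>F. a i) = 0")
  case True
  then have "a i = 0" if "i \<in> F" for i using sum_nonneg_eq_0_iff[of F a] assms that by auto
  then show ?thesis by simp
next
  case False
  define A where "A = (\<Sum>i\<in>F. a i)"
  have A: "A > 0" using False sum_nonneg[of F a] assms unfolding A_def by force
  have cvx: "convex_on {0..} (\<lambda>x::real. x ^ Suc p)"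
  proof (cases "even (Suc p)")
    case True
    show ?thesis by (rule convex_on_subset[OF convex_power_even[OF True]]) (auto simp: convex_real_interval)
  qed (rule convex_power_odd)
  have "(\<Sum>i\<in>F. (a i / A) *\<^sub>R x i) ^ Suc p \<le> (\<Sum>i\<in>F. (a i / A) * x i ^ Suc p)"
    by (rule convex_on_sum[OF _ _ cvx])
      (use assms A False in \<open>auto simp: sum_divide_distrib[symmetric] A_def\<close>)
  then have "((\<Sum>i\<in>F. a i * x i) / A) ^ Suc p \<le> (\<Sum>i\<in>F. a i * x i ^ Suc p) / A"
    by (simp add: sum_divide_distrib)
  then have "(\<Sum>i\<in>F. a i * x i) ^ Suc p \<le> (\<Sum>i\<in>F. a i * x i ^ Suc p) / A * A ^ Suc p"
    using A by (simp only: power_divide pos_divide_le_eq zero_less_power)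
  also have "\<dots> = A ^ p * (\<Sum>i\<in>F. a i * x i ^ Suc p)" using A by simp
  finally show ?thesis unfolding A_def .
qed

text \<open>Completing the square. With \<open>u\<close> a logarithm, this absorbs a power into
  \<open>exp (d * u\<^sup>2)\<close> at the price of a constant.\<close>

lemma mult_le_square_add:
  fixes p u d :: real
  assumes "d > 0"
  shows "p * u \<le> d * u\<^sup>2 + p\<^sup>2 / (4 * d)"
proof -
  have "0 \<le> (2 * d * u - p)\<^sup>2 / (4 * d)" using assms by simp
  also have "\<dots> = d * u\<^sup>2 + p\<^sup>2 / (4 * d) - p * u"
    using assms by (simp add: field_simps power2_eq_square)
  finally show ?thesis by simp
qed

text \<open>Below \<open>e\<^sup>2\<close> the exponent is bounded; above it, \<open>ln\<^sup>2 z / z\<close> decreases, so that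
  \<open>z \<le> \<epsilon> t\<close> gives \<open>z \<le> \<epsilon> t ln\<^sup>2 z / ln\<^sup>2 (\<epsilon> t)\<close>.\<close>
lemma truncated_exp_bound:
  fixes b \<kappa> B :: real
  assumes b: "b > 0" and \<kappa>: "\<kappa> > 0" and B: "B \<ge> 1"
  shows "\<exists>\<epsilon> K. 0 < \<epsilon> \<and> \<epsilon> \<le> 1 / 2 \<and> (\<forall>\<^sub>F t in at_top. \<forall>x\<ge>0.
    x * exp (b * (ln t)\<^sup>2 / t * min (B * x) (\<epsilon> * t)) \<le> K * exp (\<kappa> * (ln (max 1 x))\<^sup>2))"
proof -
  \<comment> \<open>Small enough for the coefficient \<open>4 * b * \<epsilon>\<close> of
    \<open>u\<^sup>2\<close> below to use at most half of \<open>\<kappa>\<close>; the other half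
    pays for the factor \<open>x \<le> exp u\<close>.\<close>
  define \<epsilon> where "\<epsilon> = min (1/2) (\<kappa> / (8 * b))"
  have \<epsilon>: "0 < \<epsilon>" "\<epsilon> \<le> 1/2" "4 * b * \<epsilon> \<le> \<kappa> / 2"
    using b \<kappa> by (auto simp: \<epsilon>_def min_def field_simps)
  define K where "K = exp (1 + 4 * b * \<epsilon> * (ln B)\<^sup>2 + 1 / (2 * \<kappa>))"
  have e1: "\<forall>\<^sub>F t::real in at_top. b * (ln t)\<^sup>2 / t * exp 2 \<le> 1" by real_asymp
  have e2: "\<forall>\<^sub>F t::real in at_top. (ln t)\<^sup>2 \<le> 2 * (ln (\<epsilon> * t))\<^sup>2" using \<epsilon>(1) by real_asymp
  have e3: "\<forall>\<^sub>F t::real in at_top. \<epsilon> * t > 1" using \<epsilon>(1) by real_asymp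
  have "\<forall>\<^sub>F t in at_top. \<forall>x\<ge>0.
    x * exp (b * (ln t)\<^sup>2 / t * min (B * x) (\<epsilon> * t)) \<le> K * exp (\<kappa> * (ln (max 1 x))\<^sup>2)"
    using e1 e2 e3 eventually_gt_at_top[of 1]
  proof eventually_elim
    case (elim t)
    show ?case
    proof (intro allI impI)
      fix x :: real assume x: "x \<ge> 0"
      define u where "u = ln (max 1 x)"
      define z where "z = min (B * x) (\<epsilon> * t)"
      have u0: "u \<ge> 0" unfolding u_def by simp
      have "b * (ln t)\<^sup>2 / t * z \<le> 1 + 2 * b * \<epsilon> * (ln B + u)\<^sup>2"
      proof (cases "z \<le> exp 2")
        case True
        have "b * (ln t)\<^sup>2 / t * z \<le> b * (ln t)\<^sup>2 / t * exp 2"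
          using True b elim by (intro mult_left_mono) auto
        also have "\<dots> \<le> 1" using elim by simp
        also have "\<dots> \<le> 1 + 2 * b * \<epsilon> * (ln B + u)\<^sup>2" using b \<epsilon> by simp
        finally show ?thesis .
      next
        case False
        have zz: "exp 2 \<le> z" "z \<le> \<epsilon> * t" "z \<le> B * x" using False unfolding z_def by auto
        have z1: "z > 1" using zz(1) one_less_exp_iff[of "2::real"] by linarith
        have y1: "\<epsilon> * t > 1" using z1 zz by linarith
        \<comment> \<open>\<open>ln y / y\<close> decreases beyond \<open>exp 1\<close>; with
          \<open>y = sqrt z\<close> this becomes the decrease of \<open>(ln z)\<^sup>2 / z\<close>
          beyond \<open>exp 2\<close>.\<close>
        have "ln (sqrt (\<epsilon> * t)) / sqrt (\<epsilon> * t) \<le> ln (sqrt z) / sqrt z"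
        proof (rule ln_x_over_x_mono)
          have "exp (1::real) = sqrt (exp 2)"
            by (rule real_sqrt_unique[symmetric]) (auto simp: exp_double[of 1, simplified])
          also have "\<dots> \<le> sqrt z" using zz by simp
          finally show "exp 1 \<le> sqrt z" .
        qed (use zz in auto)
        then have "ln (\<epsilon> * t) / sqrt (\<epsilon> * t) \<le> ln z / sqrt z"
          using z1 y1 by (simp add: ln_sqrt)
        then have "(ln (\<epsilon> * t) / sqrt (\<epsilon> * t))\<^sup>2 \<le> (ln z / sqrt z)\<^sup>2"
          using z1 y1 by (intro power_mono divide_nonneg_nonneg) auto
        then have "(ln (\<epsilon> * t))\<^sup>2 / (\<epsilon> * t) \<le> (ln z)\<^sup>2 / z"
          using z1 y1 by (simp add: power_divide)
        then have m: "(ln (\<epsilon> * t))\<^sup>2 * z \<le> (ln z)\<^sup>2 * (\<epsilon> * t)"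
          using z1 y1 by (simp add: divide_simps mult.commute split: if_splits)
        have "(ln t)\<^sup>2 * z \<le> 2 * (ln (\<epsilon> * t))\<^sup>2 * z" using elim z1 by (intro mult_right_mono) auto
        also have "\<dots> \<le> 2 * ((ln z)\<^sup>2 * (\<epsilon> * t))" using m by simp
        finally have "b / t * ((ln t)\<^sup>2 * z) \<le> b / t * (2 * ((ln z)\<^sup>2 * (\<epsilon> * t)))"
          using b elim by (intro mult_left_mono) auto
        then have "b * (ln t)\<^sup>2 / t * z \<le> 2 * b * \<epsilon> * (ln z)\<^sup>2"
          using elim by (simp add: field_simps)
        also have "\<dots> \<le> 2 * b * \<epsilon> * (ln B + u)\<^sup>2"
        proof (intro mult_left_mono power_mono)
          have "ln z \<le> ln (B * max 1 x)"
            using zz z1 B by (intro ln_mono) (auto intro: order.trans mult_left_mono)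
          also have "\<dots> = ln B + u" unfolding u_def using B by (simp add: ln_mult)
          finally show "ln z \<le> ln B + u" .
        qed (use z1 b \<epsilon> in auto)
        finally show ?thesis by simp
      qed
      also have "(ln B + u)\<^sup>2 \<le> 2 * (ln B)\<^sup>2 + 2 * u\<^sup>2"
        using zero_le_power2[of "ln B - u"] unfolding power2_diff power2_sum by simp
      finally have 1: "b * (ln t)\<^sup>2 / t * z \<le> 1 + 4 * b * \<epsilon> * (ln B)\<^sup>2 + 4 * b * \<epsilon> * u\<^sup>2"
        using b \<epsilon> by (simp add: algebra_simps)
      have 2: "4 * b * \<epsilon> * u\<^sup>2 \<le> \<kappa> / 2 * u\<^sup>2" using \<epsilon>(3) by (rule mult_right_mono) simp
      have 3: "u \<le> \<kappa> / 2 * u\<^sup>2 + 1 / (2 * \<kappa>)"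
        using mult_le_square_add[of "\<kappa>/2" 1 u] \<kappa> by simp
      have "x * exp (b * (ln t)\<^sup>2 / t * z) \<le> exp u * exp (b * (ln t)\<^sup>2 / t * z)"
        unfolding u_def by (intro mult_right_mono) auto
      also have "\<dots> = exp (u + b * (ln t)\<^sup>2 / t * z)" by (simp add: exp_add)
      also have "\<dots> \<le> exp ((1 + 4 * b * \<epsilon> * (ln B)\<^sup>2 + 1 / (2 * \<kappa>)) + \<kappa> * u\<^sup>2)"
        unfolding exp_le_cancel_iff using 1 2 3 by linarith
      also have "\<dots> = K * exp (\<kappa> * u\<^sup>2)" unfolding K_def by (simp only: exp_add)
      finally show "x * exp (b * (ln t)\<^sup>2 / t * min (B * x) (\<epsilon> * t)) \<le> K * exp (\<kappa> * (ln (max 1 x))\<^sup>2)"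
        unfolding z_def u_def .
    qed
  qed
  with \<epsilon> show ?thesis by blast
qed

text \<open>The slice where the squared logarithm lies in \<open>(n, n + 1]\<close> has probability
  at most \<open>C * exp (- (\<kappa> * n))\<close>, so the expectation is dominated by a geometric
  series of ratio \<open>exp (\<kappa>' - \<kappa>)\<close>.\<close>

lemma (in prob_space) integrable_exp_log_square:
  assumes [measurable]: "random_variable borel Z"
    and tail: "\<And>u. u \<ge> 1 \<Longrightarrow> prob {\<omega> \<in> space M. \<bar>Z \<omega>\<bar> > u} \<le> C * exp (- (\<kappa> * (ln u)\<^sup>2))"
    and \<kappa>: "0 \<le> \<kappa>'" "\<kappa>' < \<kappa>"
  shows "integrable M (\<lambda>\<omega>. exp (\<kappa>' * (ln (max 1 \<bar>Z \<omega>\<bar>))\<^sup>2))"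
proof (rule integrableI_bounded)
  define A where "A = (\<lambda>n::nat. {\<omega> \<in> space M. \<bar>Z \<omega>\<bar> > exp (sqrt (real n))})"
  have [measurable]: "A n \<in> sets M" for n unfolding A_def by measurable
  have C: "C \<ge> 0" using order.trans[OF measure_nonneg tail[of 1]] by simp
  have "(\<integral>\<^sup>+\<omega>. ennreal (norm (exp (\<kappa>' * (ln (max 1 \<bar>Z \<omega>\<bar>))\<^sup>2))) \<partial>M)
      \<le> (\<integral>\<^sup>+\<omega>. 1 + (\<Sum>n. ennreal (exp (\<kappa>' * (real n + 1))) * indicator (A n) \<omega>) \<partial>M)"
  proof (rule nn_integral_mono)
    fix \<omega> assume \<omega>: "\<omega> \<in> space M"
    define u where "u = ln (max 1 \<bar>Z \<omega>\<bar>)"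
    show "ennreal (norm (exp (\<kappa>' * (ln (max 1 \<bar>Z \<omega>\<bar>))\<^sup>2)))
        \<le> 1 + (\<Sum>n. ennreal (exp (\<kappa>' * (real n + 1))) * indicator (A n) \<omega>)"
    proof (cases "u = 0")
      case True
      then show ?thesis unfolding u_def[symmetric] by simp
    next
      case False
      have u: "u > 0" using False unfolding u_def by (simp add: ln_eq_zero_iff)
      \<comment> \<open>Ceiling minus 1 makes the lower inequality strict, as membership in
        \<open>A n\<close> demands.\<close>
      define n where "n = nat (\<lceil>u\<^sup>2\<rceil> - 1)"
      have "0 < u\<^sup>2" using u by simp
      then have n: "real n < u\<^sup>2" "u\<^sup>2 \<le> real n + 1" unfolding n_def by linarith+
      have "sqrt (real n) < u" using n(1) u by (simp add: real_less_lsqrt)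
      then have "exp (sqrt (real n)) < exp u" by simp
      also have "exp u = max 1 \<bar>Z \<omega>\<bar>" unfolding u_def by simp
      finally have "exp (sqrt (real n)) < \<bar>Z \<omega>\<bar>"
        using one_le_exp_iff[of "sqrt (real n)"] by (auto simp: less_max_iff_disj)
      then have "\<omega> \<in> A n" using \<omega> unfolding A_def by simp
      have "ennreal (norm (exp (\<kappa>' * u\<^sup>2))) \<le> ennreal (exp (\<kappa>' * (real n + 1))) * indicator (A n) \<omega>"
        using \<open>\<omega> \<in> A n\<close> n \<kappa> by (auto intro!: ennreal_leI mult_left_mono)
      also have "\<dots> \<le> (\<Sum>n. ennreal (exp (\<kappa>' * (real n + 1))) * indicator (A n) \<omega>)"
      proof -
        have "sum g {n} \<le> suminf g" for g :: "nat \<Rightarrow> ennreal"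
          by (rule sum_le_suminf) auto
        from this[of "\<lambda>n. ennreal (exp (\<kappa>' * (real n + 1))) * indicator (A n) \<omega>"] show ?thesis
          by (simp only: sum.insert_remove finite.emptyI empty_Diff sum.empty add_0_right)
      qed
      also have "\<dots> \<le> 1 + \<dots>" by simp
      finally show ?thesis unfolding u_def .
    qed
  qed
  also have "\<dots> = 1 + (\<Sum>n. ennreal (exp (\<kappa>' * (real n + 1))) * emeasure M (A n))"
    by (subst nn_integral_add) (simp_all add: nn_integral_suminf nn_integral_cmult_indicator emeasure_space_1)
  also have "\<dots> \<le> 1 + (\<Sum>n. ennreal (C * exp \<kappa>' * exp (\<kappa>' - \<kappa>) ^ n))"
  proof (intro add_left_mono suminf_le)
    fix n
    have "prob (A n) \<le> C * exp (- (\<kappa> * real n))"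
      using tail[of "exp (sqrt (real n))"] unfolding A_def by simp
    then have "exp (\<kappa>' * (real n + 1)) * prob (A n) \<le> exp (\<kappa>' * (real n + 1)) * (C * exp (- (\<kappa> * real n)))"
      by (rule mult_left_mono) simp
    also have "\<dots> = C * (exp (\<kappa>' * (real n + 1)) * exp (- (\<kappa> * real n)))" by simp
    also have "exp (\<kappa>' * (real n + 1)) * exp (- (\<kappa> * real n)) = exp \<kappa>' * exp (real n * (\<kappa>' - \<kappa>))"
      unfolding exp_add[symmetric] by (simp add: algebra_simps)
    also have "exp (real n * (\<kappa>' - \<kappa>)) = exp (\<kappa>' - \<kappa>) ^ n" by (rule exp_of_nat_mult)
    finally show "ennreal (exp (\<kappa>' * (real n + 1))) * emeasure M (A n) \<le> ennreal (C * exp \<kappa>' * exp (\<kappa>' - \<kappa>) ^ n)"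
      unfolding emeasure_eq_measure by (subst ennreal_mult[symmetric]) (auto intro!: ennreal_leI simp: mult.assoc)
  qed auto
  also have "\<dots> < \<infinity>"
  proof -
    have "summable (\<lambda>n. C * exp \<kappa>' * exp (\<kappa>' - \<kappa>) ^ n)"
      using \<kappa> by (intro summable_mult summable_geometric) simp
    then have "(\<Sum>n. ennreal (C * exp \<kappa>' * exp (\<kappa>' - \<kappa>) ^ n)) \<noteq> \<top>"
      using C by (intro ennreal_suminf_neq_top) auto
    then show ?thesis by (simp add: less_top)
  qed
  finally show "(\<integral>\<^sup>+\<omega>. ennreal (norm (exp (\<kappa>' * (ln (max 1 \<bar>Z \<omega>\<bar>))\<^sup>2))) \<partial>M) < \<infinity>" .
qed measurable

text \<open>The union bound passes to the limit along increasing finite unions, so a bound on the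
  finite sums of \<open>b\<close> is enough.\<close>

lemma (in prob_space) prob_UN_le:
  fixes A :: "'i :: countable \<Rightarrow> 'a set"
  assumes A: "\<And>i. A i \<in> events" and b: "\<And>i. prob (A i) \<le> b i"
    and S: "\<And>F. finite F \<Longrightarrow> (\<Sum>i\<in>F. b i) \<le> S"
  shows "prob (\<Union>i. A i) \<le> S"
proof -
  let ?E = "\<lambda>n. {i \<in> UNIV. to_nat (i :: 'i) < n}"
  define U where "U = (\<lambda>n. \<Union>i\<in>?E n. A i)"
  have "incseq U" unfolding U_def by (intro monoI) fastforce
  moreover have "range U \<subseteq> events"
    unfolding U_def using A finite_exhaust by (intro image_subsetI sets.finite_UN)
  ultimately have lim: "(\<lambda>n. prob (U n)) \<longlonglongrightarrow> prob (\<Union>n. U n)"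
    by (intro finite_Lim_measure_incseq)
  have "(\<Union>n. U n) = (\<Union>i. A i)" unfolding U_def by auto
  moreover have "prob (U n) \<le> S" for n
  proof -
    have "prob (U n) \<le> (\<Sum>i\<in>?E n. prob (A i))"
      unfolding U_def using A by (intro finite_measure_subadditive_finite finite_exhaust) auto
    also have "\<dots> \<le> (\<Sum>i\<in>?E n. b i)" by (intro sum_mono b)
    also have "\<dots> \<le> S" by (rule S[OF finite_exhaust])
    finally show ?thesis .
  qed
  ultimately show ?thesis using LIMSEQ_le_const2[OF lim] by auto
qed

section \<open>Weighted sums of independent variables\<close>

text \<open>\<open>\<kappa>0\<close> bounds the admissible constants in log-squared exponential
  moments of a summand, both tails included; it will be \<open>lam / 2\<close>. Convergence, moments
  and the estimates for large summands rest on it and not on the smoothness of the tail.\<close>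

locale weighted_sum = prob_space M for M :: "'a measure" +
  fixes X :: "int \<Rightarrow> 'a \<Rightarrow> real" and c :: "int \<Rightarrow> real" and \<kappa>0 :: real
  assumes indep: "indep_vars (\<lambda>_. borel) X UNIV"
    and ident: "\<And>i. distr M borel (X i) = distr M borel (X 0)"
    and c_summable: "(\<lambda>i. \<bar>c i\<bar>) summable_on UNIV"
    and exp_log_square: "\<And>\<kappa>. 0 \<le> \<kappa> \<Longrightarrow> \<kappa> < \<kappa>0 \<Longrightarrow> integrable M (\<lambda>\<omega>. exp (\<kappa> * (ln (max 1 \<bar>X 0 \<omega>\<bar>))\<^sup>2))"
    and \<kappa>0: "\<kappa>0 > 0"
begin

section \<open>Moments and almost sure convergence of the weighted series\<close>

lemma X_measurable [measurable]: "X i \<in> borel_measurable M"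
  using indep unfolding indep_vars_def by auto

definition c_norm :: real where "c_norm = (\<Sum>\<^sub>\<infinity>i. \<bar>c i\<bar>)"

lemma sum_c_le: "finite F \<Longrightarrow> (\<Sum>i\<in>F. \<bar>c i\<bar>) \<le> c_norm"
  unfolding c_norm_def by (rule finite_sum_le_infsum[OF c_summable]) auto

lemma c_le: "\<bar>c i\<bar> \<le> c_norm"
  using sum_c_le[of "{i}"] by simp

lemma c_norm_nonneg: "0 \<le> c_norm"
  using c_le[of 0] by linarith

lemma X_integral:
  fixes g :: "real \<Rightarrow> real"
  assumes "g \<in> borel_measurable borel"
  shows "expectation (\<lambda>\<omega>. g (X i \<omega>)) = expectation (\<lambda>\<omega>. g (X 0 \<omega>))"
    and "integrable M (\<lambda>\<omega>. g (X i \<omega>)) \<longleftrightarrow> integrable M (\<lambda>\<omega>. g (X 0 \<omega>))"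
  using integral_distr[OF X_measurable assms, of i] integral_distr[OF X_measurable assms, of 0]
    integrable_distr_eq[OF X_measurable assms, of i] integrable_distr_eq[OF X_measurable assms, of 0] ident[of i]
  by simp_all

text \<open>The power of \<open>\<bar>X i\<bar>\<close> is absorbed by raising
  \<open>\<kappa>\<close> by half its distance to \<open>\<kappa>0\<close>.\<close>

lemma integrable_power_exp:
  assumes "0 \<le> \<kappa>" "\<kappa> < \<kappa>0"
  shows "integrable M (\<lambda>\<omega>. \<bar>X i \<omega>\<bar> ^ p * exp (\<kappa> * (ln (max 1 \<bar>X i \<omega>\<bar>))\<^sup>2))"
proof -
  define d where "d = (\<kappa>0 - \<kappa>) / 2"
  have d: "d > 0" "0 \<le> \<kappa> + d" "\<kappa> + d < \<kappa>0" using assms by (auto simp: d_def field_simps)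
  define K where "K = exp ((real p)\<^sup>2 / (4 * d))"
  have "integrable M (\<lambda>\<omega>. \<bar>X 0 \<omega>\<bar> ^ p * exp (\<kappa> * (ln (max 1 \<bar>X 0 \<omega>\<bar>))\<^sup>2))"
  proof (rule Bochner_Integration.integrable_bound)
    show "integrable M (\<lambda>\<omega>. K * exp ((\<kappa> + d) * (ln (max 1 \<bar>X 0 \<omega>\<bar>))\<^sup>2))"
      by (intro integrable_mult_right exp_log_square d)
    show "AE \<omega> in M. norm (\<bar>X 0 \<omega>\<bar> ^ p * exp (\<kappa> * (ln (max 1 \<bar>X 0 \<omega>\<bar>))\<^sup>2))
        \<le> norm (K * exp ((\<kappa> + d) * (ln (max 1 \<bar>X 0 \<omega>\<bar>))\<^sup>2))"
    proof (rule AE_I2)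
      fix \<omega>
      define u where "u = ln (max 1 \<bar>X 0 \<omega>\<bar>)"
      have "\<bar>X 0 \<omega>\<bar> ^ p \<le> (max 1 \<bar>X 0 \<omega>\<bar>) ^ p" by (intro power_mono) auto
      also have "\<dots> = exp (real p * u)" unfolding u_def by (simp add: exp_of_nat_mult)
      also have "\<dots> \<le> exp (d * u\<^sup>2 + (real p)\<^sup>2 / (4 * d))"
        unfolding exp_le_cancel_iff by (rule mult_le_square_add[OF d(1)])
      finally have "\<bar>X 0 \<omega>\<bar> ^ p * exp (\<kappa> * u\<^sup>2) \<le> exp (d * u\<^sup>2 + (real p)\<^sup>2 / (4 * d)) * exp (\<kappa> * u\<^sup>2)"
        by (rule mult_right_mono) simp
      also have "\<dots> = K * exp ((\<kappa> + d) * u\<^sup>2)"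
        unfolding K_def exp_add[symmetric] by (simp add: algebra_simps)
      finally show "norm (\<bar>X 0 \<omega>\<bar> ^ p * exp (\<kappa> * (ln (max 1 \<bar>X 0 \<omega>\<bar>))\<^sup>2))
        \<le> norm (K * exp ((\<kappa> + d) * (ln (max 1 \<bar>X 0 \<omega>\<bar>))\<^sup>2))"
        unfolding u_def by (simp add: K_def)
    qed
  qed measurable
  then show ?thesis
    using X_integral(2)[of "\<lambda>x. \<bar>x\<bar> ^ p * exp (\<kappa> * (ln (max 1 \<bar>x\<bar>))\<^sup>2)" i] by simp
qed

lemma integrable_power: "integrable M (\<lambda>\<omega>. \<bar>X i \<omega>\<bar> ^ p)"
  using integrable_power_exp[of 0] \<kappa>0 by simp

text \<open>\<open>part UNIV\<close> is the whole sum and \<open>part (UNIV - {i})\<close> the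
  \<open>W\<^sub>i\<close> of the overview. Off the summable points the value is the default 0, so
  the decomposition of the sum is available only almost surely.\<close>

definition part :: "int set \<Rightarrow> 'a \<Rightarrow> real" where
  "part A \<omega> = (\<Sum>\<^sub>\<infinity>j\<in>A. c j * X j \<omega>)"

lemma part_measurable [measurable]: "part A \<in> borel_measurable M"
  unfolding part_def[abs_def] by (rule borel_measurable_infsum) measurable

definition abs_part :: "nat \<Rightarrow> 'a \<Rightarrow> real" where
  "abs_part n \<omega> = (\<Sum>j\<in>{j \<in> UNIV. to_nat j < n}. \<bar>c j\<bar> * \<bar>X j \<omega>\<bar>)"

lemma abs_part_measurable [measurable]: "abs_part n \<in> borel_measurable M"
  unfolding abs_part_def[abs_def] by measurable

lemma abs_part_mono: "m \<le> n \<Longrightarrow> abs_part m \<omega> \<le> abs_part n \<omega>"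
  unfolding abs_part_def by (rule sum_mono2[OF finite_exhaust]) auto

lemma abs_part_nonneg: "0 \<le> abs_part n \<omega>"
  unfolding abs_part_def by (rule sum_nonneg) auto

text \<open>A single majorant, the supremum of the absolute partial sums, yields both almost sure
  summability and the moments of every \<open>part A\<close>.\<close>

lemma SUP_abs_part_moment:
  "(\<integral>\<^sup>+\<omega>. (SUP n. ennreal (abs_part n \<omega> ^ Suc p)) \<partial>M) < \<infinity>"
proof -
  define K where "K = c_norm ^ p * (c_norm * expectation (\<lambda>\<omega>. \<bar>X 0 \<omega>\<bar> ^ Suc p))"
  have m: "(\<integral>\<^sup>+\<omega>. ennreal (abs_part n \<omega> ^ Suc p) \<partial>M) \<le> ennreal K" for n
  proof -
    let ?E = "{j \<in> UNIV. to_nat (j::int) < n}"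
    have E: "(\<Sum>j\<in>?E. \<bar>c j\<bar>) \<le> c_norm" "0 \<le> (\<Sum>j\<in>?E. \<bar>c j\<bar>)"
      by (rule sum_c_le[OF finite_exhaust], rule sum_nonneg, simp)
    have int: "integrable M (\<lambda>\<omega>. c_norm ^ p * (\<Sum>j\<in>?E. \<bar>c j\<bar> * \<bar>X j \<omega>\<bar> ^ Suc p))"
      by (intro integrable_mult_right Bochner_Integration.integrable_sum integrable_power)
    have "(\<integral>\<^sup>+\<omega>. ennreal (abs_part n \<omega> ^ Suc p) \<partial>M)
        \<le> (\<integral>\<^sup>+\<omega>. ennreal (c_norm ^ p * (\<Sum>j\<in>?E. \<bar>c j\<bar> * \<bar>X j \<omega>\<bar> ^ Suc p)) \<partial>M)"
    proof (intro nn_integral_mono ennreal_leI)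
      fix \<omega>
      have "abs_part n \<omega> ^ Suc p \<le> (\<Sum>j\<in>?E. \<bar>c j\<bar>) ^ p * (\<Sum>j\<in>?E. \<bar>c j\<bar> * \<bar>X j \<omega>\<bar> ^ Suc p)"
        unfolding abs_part_def by (rule power_sum_le[OF finite_exhaust]) auto
      also have "\<dots> \<le> c_norm ^ p * (\<Sum>j\<in>?E. \<bar>c j\<bar> * \<bar>X j \<omega>\<bar> ^ Suc p)"
        using E by (intro mult_right_mono power_mono sum_nonneg) auto
      finally show "abs_part n \<omega> ^ Suc p \<le> c_norm ^ p * (\<Sum>j\<in>?E. \<bar>c j\<bar> * \<bar>X j \<omega>\<bar> ^ Suc p)" .
    qed
    also have "\<dots> = ennreal (expectation (\<lambda>\<omega>. c_norm ^ p * (\<Sum>j\<in>?E. \<bar>c j\<bar> * \<bar>X j \<omega>\<bar> ^ Suc p)))"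
      by (rule nn_integral_eq_integral[OF int]) (auto intro!: AE_I2 mult_nonneg_nonneg sum_nonneg simp: c_norm_nonneg)
    also have "expectation (\<lambda>\<omega>. c_norm ^ p * (\<Sum>j\<in>?E. \<bar>c j\<bar> * \<bar>X j \<omega>\<bar> ^ Suc p))
        = c_norm ^ p * (\<Sum>j\<in>?E. \<bar>c j\<bar> * expectation (\<lambda>\<omega>. \<bar>X j \<omega>\<bar> ^ Suc p))"
      using integrable_power[of _ "Suc p"] by (subst integral_mult_right_zero, subst Bochner_Integration.integral_sum) auto
    also have "\<dots> = c_norm ^ p * ((\<Sum>j\<in>?E. \<bar>c j\<bar>) * expectation (\<lambda>\<omega>. \<bar>X 0 \<omega>\<bar> ^ Suc p))"
    proof -
      have "expectation (\<lambda>\<omega>. \<bar>X j \<omega>\<bar> ^ Suc p) = expectation (\<lambda>\<omega>. \<bar>X 0 \<omega>\<bar> ^ Suc p)" for j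
        by (rule X_integral(1)[of "\<lambda>x. \<bar>x\<bar> ^ Suc p"]) measurable
      then have "(\<Sum>j\<in>?E. \<bar>c j\<bar> * expectation (\<lambda>\<omega>. \<bar>X j \<omega>\<bar> ^ Suc p))
          = (\<Sum>j\<in>?E. \<bar>c j\<bar> * expectation (\<lambda>\<omega>. \<bar>X 0 \<omega>\<bar> ^ Suc p))"
        by (intro sum.cong refl arg_cong2[where f="(*)"])
      then show ?thesis by (simp only: sum_distrib_right)
    qed
    also have "\<dots> \<le> K"
      unfolding K_def using E c_norm_nonneg by (intro mult_left_mono mult_right_mono Bochner_Integration.integral_nonneg) auto
    finally show ?thesis by (simp add: ennreal_leI)
  qed
  have "(\<integral>\<^sup>+\<omega>. (SUP n. ennreal (abs_part n \<omega> ^ Suc p)) \<partial>M) = (SUP n. \<integral>\<^sup>+\<omega>. ennreal (abs_part n \<omega> ^ Suc p) \<partial>M)"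
    by (rule nn_integral_monotone_convergence_SUP)
      (auto intro!: monoI le_funI ennreal_leI power_mono abs_part_mono abs_part_nonneg simp del: power_Suc)
  also have "\<dots> \<le> ennreal K" by (rule SUP_least) (rule m)
  finally show ?thesis by (rule le_less_trans) simp
qed

lemma AE_summable: "AE \<omega> in M. (\<lambda>j. c j * X j \<omega>) summable_on UNIV"
proof -
  have "AE \<omega> in M. (SUP n. ennreal (abs_part n \<omega> ^ Suc 0)) \<noteq> \<infinity>"
    using SUP_abs_part_moment[of 0] by (intro nn_integral_noteq_infinite) auto
  then show ?thesis
  proof eventually_elim
    case (elim \<omega>)
    then obtain r where r: "(SUP n. ennreal (abs_part n \<omega>)) = ennreal r" "r \<ge> 0"
      by (cases "SUP n. ennreal (abs_part n \<omega>)") auto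
    have "abs_part n \<omega> \<le> r" for n
    proof -
      have "ennreal (abs_part n \<omega>) \<le> ennreal r" unfolding r(1)[symmetric] by (rule SUP_upper) simp
      then show ?thesis using r(2) by simp
    qed
    moreover obtain B :: nat where "r \<le> real B" using real_arch_simple by blast
    ultimately have "\<forall>n. abs_part n \<omega> \<le> real B" using order.trans by blast
    then show ?case unfolding summable_on_iff_bounded abs_part_def abs_mult by blast
  qed
qed

lemma part_power_integrable: "integrable M (\<lambda>\<omega>. \<bar>part A \<omega>\<bar> ^ p)"
proof (cases p)
  case (Suc q)
  show ?thesis
  proof (rule integrableI_bounded)
    have "(\<integral>\<^sup>+\<omega>. ennreal (norm (\<bar>part A \<omega>\<bar> ^ p)) \<partial>M) \<le> (\<integral>\<^sup>+\<omega>. (SUP n. ennreal (abs_part n \<omega> ^ Suc q)) \<partial>M)"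
    proof (rule nn_integral_mono_AE, use AE_summable in eventually_elim)
      fix \<omega> assume s: "(\<lambda>j. c j * X j \<omega>) summable_on UNIV"
      then have sA: "(\<lambda>j. c j * X j \<omega>) summable_on A" by (rule summable_on_subset_banach) auto
      let ?f = "\<lambda>n. \<Sum>j\<in>{j \<in> A. to_nat j < n}. c j * X j \<omega>"
      have "(\<lambda>n. ennreal (\<bar>?f n\<bar> ^ Suc q)) \<longlonglongrightarrow> ennreal (\<bar>part A \<omega>\<bar> ^ Suc q)"
        unfolding part_def by (intro tendsto_ennrealI tendsto_power tendsto_rabs infsum_exhaust sA)
      then have "ennreal (\<bar>part A \<omega>\<bar> ^ Suc q) \<le> (SUP n. ennreal (abs_part n \<omega> ^ Suc q))"
      proof (rule LIMSEQ_le_const2)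
        have "\<bar>?f n\<bar> \<le> abs_part n \<omega>" for n
        proof -
          have "\<bar>?f n\<bar> \<le> (\<Sum>j\<in>{j \<in> A. to_nat j < n}. \<bar>c j * X j \<omega>\<bar>)" by (rule sum_abs)
          also have "\<dots> \<le> abs_part n \<omega>"
            unfolding abs_part_def abs_mult by (rule sum_mono2[OF finite_exhaust]) auto
          finally show ?thesis .
        qed
        then show "\<exists>N. \<forall>n\<ge>N. ennreal (\<bar>?f n\<bar> ^ Suc q) \<le> (SUP n. ennreal (abs_part n \<omega> ^ Suc q))"
          by (intro exI allI impI SUP_upper2[OF UNIV_I] ennreal_leI power_mono) auto
      qed
      then show "ennreal (norm (\<bar>part A \<omega>\<bar> ^ p)) \<le> (SUP n. ennreal (abs_part n \<omega> ^ Suc q))"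
        using Suc by simp
    qed
    also have "\<dots> < \<infinity>" by (rule SUP_abs_part_moment)
    finally show "(\<integral>\<^sup>+\<omega>. ennreal (norm (\<bar>part A \<omega>\<bar> ^ p)) \<partial>M) < \<infinity>" .
  qed measurable
qed simp

lemma part_remove:
  assumes "(\<lambda>j. c j * X j \<omega>) summable_on UNIV"
  shows "part UNIV \<omega> = c i * X i \<omega> + part (UNIV - {i}) \<omega>"
proof -
  have "part (insert i (UNIV - {i})) \<omega> = c i * X i \<omega> + part (UNIV - {i}) \<omega>"
    unfolding part_def by (rule infsum_insert) (auto intro: summable_on_subset_banach[OF assms])
  then show ?thesis by (simp add: insert_absorb)
qed

text \<open>Negative values are cut off too: only upper bounds on sums are sought, partial sums then
  increase with the index set, and \<open>trunc y i\<close> still dominates \<open>c i * X i\<close>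
  wherever the latter is at most \<open>y\<close>.\<close>

definition trunc :: "real \<Rightarrow> int \<Rightarrow> 'a \<Rightarrow> real" where
  "trunc y i \<omega> = min (max 0 (c i * X i \<omega>)) y"

lemma trunc_measurable [measurable]: "trunc y i \<in> borel_measurable M"
  unfolding trunc_def[abs_def] by measurable

text \<open>The exponent is of order \<open>ln\<^sup>2 t / t\<close> so that Chernoff's bound yields \<open>exp (- b \<eta> ln\<^sup>2 t)\<close>, which
  for large \<open>b\<close> beats the tail \<open>exp (- (\<lambda>/2 + o(1)) ln\<^sup>2 t)\<close> of a single summand.\<close>
lemma trunc_exp_moment:
  assumes "b > 0"
  shows "\<exists>\<epsilon> K. 0 < \<epsilon> \<and> \<epsilon> \<le> 1 / 2 \<and> 0 \<le> K \<and> (\<forall>\<^sub>F t in at_top. \<forall>i.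
    expectation (\<lambda>\<omega>. exp (b * (ln t)\<^sup>2 / t * trunc (\<epsilon> * t) i \<omega>)) \<le> 1 + b * (ln t)\<^sup>2 / t * \<bar>c i\<bar> * K)"
proof -
  define \<kappa> where "\<kappa> = \<kappa>0 / 2"
  have \<kappa>: "0 < \<kappa>" "0 \<le> \<kappa>" "\<kappa> < \<kappa>0" using \<kappa>0 by (auto simp: \<kappa>_def)
  define B where "B = max 1 c_norm"
  have B: "B \<ge> 1" "\<And>i. \<bar>c i\<bar> \<le> B" using c_le unfolding B_def by (auto intro: max.coboundedI2)
  obtain \<epsilon> K where \<epsilon>: "0 < \<epsilon>" "\<epsilon> \<le> 1 / 2"
    and K: "\<forall>\<^sub>F t in at_top. \<forall>x\<ge>0. x * exp (b * (ln t)\<^sup>2 / t * min (B * x) (\<epsilon> * t)) \<le> K * exp (\<kappa> * (ln (max 1 x))\<^sup>2)"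
    using truncated_exp_bound[OF assms \<kappa>(1) B(1)] by blast
  define E where "E = expectation (\<lambda>\<omega>. exp (\<kappa> * (ln (max 1 \<bar>X 0 \<omega>\<bar>))\<^sup>2))"
  have E: "E \<ge> 0" unfolding E_def by (rule Bochner_Integration.integral_nonneg) auto
  have "\<forall>\<^sub>F t in at_top. \<forall>i. expectation (\<lambda>\<omega>. exp (b * (ln t)\<^sup>2 / t * trunc (\<epsilon> * t) i \<omega>))
      \<le> 1 + b * (ln t)\<^sup>2 / t * \<bar>c i\<bar> * (\<bar>K\<bar> * E)"
    using K eventually_gt_at_top[of 1]
  proof eventually_elim
    case (elim t)
    define \<theta> where "\<theta> = b * (ln t)\<^sup>2 / t"
    have \<theta>: "\<theta> \<ge> 0" unfolding \<theta>_def using elim assms by auto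
    have y: "0 \<le> \<epsilon> * t" using elim \<epsilon> by auto
    show ?case
    proof
      fix i
      have int: "integrable M (\<lambda>\<omega>. exp (\<kappa> * (ln (max 1 \<bar>X i \<omega>\<bar>))\<^sup>2))"
        using integrable_power_exp[of \<kappa> i 0] \<kappa> by simp
      have pt: "exp (\<theta> * trunc (\<epsilon> * t) i \<omega>) \<le> 1 + \<theta> * \<bar>c i\<bar> * (\<bar>K\<bar> * exp (\<kappa> * (ln (max 1 \<bar>X i \<omega>\<bar>))\<^sup>2))" for \<omega>
      proof -
        let ?v = "trunc (\<epsilon> * t) i \<omega>"
        have v0: "?v \<ge> 0" unfolding trunc_def using y by simp
        have v1: "?v \<le> \<bar>c i\<bar> * \<bar>X i \<omega>\<bar>"
        proof -
          have "?v \<le> \<bar>c i * X i \<omega>\<bar>" unfolding trunc_def by simp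
          then show ?thesis by (simp add: abs_mult)
        qed
        have "\<bar>c i\<bar> * \<bar>X i \<omega>\<bar> \<le> B * \<bar>X i \<omega>\<bar>" by (rule mult_right_mono[OF B(2)]) simp
        with v1 have v2: "?v \<le> min (B * \<bar>X i \<omega>\<bar>) (\<epsilon> * t)" unfolding trunc_def by simp
        \<comment> \<open>Used with \<open>x\<close> the exponent, this brings out the factor
          \<open>\<bar>c i\<bar>\<close> and makes the excess over 1 summable in
          \<open>i\<close>.\<close>
        have "exp x \<le> 1 + x * exp x" for x :: real
        proof -
          have "(1 - x) * exp x \<le> exp (- x) * exp x"
            using exp_ge_add_one_self[of "- x"] by (intro mult_right_mono) auto
          then show ?thesis by (simp add: algebra_simps flip: exp_add)
        qed
        then have "exp (\<theta> * ?v) \<le> 1 + \<theta> * ?v * exp (\<theta> * ?v)" .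
        also have "\<theta> * ?v * exp (\<theta> * ?v) \<le> \<theta> * (\<bar>c i\<bar> * \<bar>X i \<omega>\<bar>) * exp (\<theta> * min (B * \<bar>X i \<omega>\<bar>) (\<epsilon> * t))"
          using v0 v1 v2 \<theta> by (intro mult_mono) (auto intro: mult_left_mono)
        also have "\<dots> = \<theta> * \<bar>c i\<bar> * (\<bar>X i \<omega>\<bar> * exp (\<theta> * min (B * \<bar>X i \<omega>\<bar>) (\<epsilon> * t)))" by simp
        also have "\<dots> \<le> \<theta> * \<bar>c i\<bar> * (\<bar>K\<bar> * exp (\<kappa> * (ln (max 1 \<bar>X i \<omega>\<bar>))\<^sup>2))"
        proof (rule mult_left_mono)
          have "\<bar>X i \<omega>\<bar> * exp (\<theta> * min (B * \<bar>X i \<omega>\<bar>) (\<epsilon> * t)) \<le> K * exp (\<kappa> * (ln (max 1 \<bar>X i \<omega>\<bar>))\<^sup>2)"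
            using elim(1) unfolding \<theta>_def by simp
          also have "\<dots> \<le> \<bar>K\<bar> * exp (\<kappa> * (ln (max 1 \<bar>X i \<omega>\<bar>))\<^sup>2)" by (intro mult_right_mono) auto
          finally show "\<bar>X i \<omega>\<bar> * exp (\<theta> * min (B * \<bar>X i \<omega>\<bar>) (\<epsilon> * t)) \<le> \<bar>K\<bar> * exp (\<kappa> * (ln (max 1 \<bar>X i \<omega>\<bar>))\<^sup>2)" .
        qed (use \<theta> in simp)
        finally show ?thesis by simp
      qed
      have "expectation (\<lambda>\<omega>. exp (\<theta> * trunc (\<epsilon> * t) i \<omega>))
          \<le> expectation (\<lambda>\<omega>. 1 + \<theta> * \<bar>c i\<bar> * (\<bar>K\<bar> * exp (\<kappa> * (ln (max 1 \<bar>X i \<omega>\<bar>))\<^sup>2)))"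
      proof (rule integral_mono)
        show int2: "integrable M (\<lambda>\<omega>. 1 + \<theta> * \<bar>c i\<bar> * (\<bar>K\<bar> * exp (\<kappa> * (ln (max 1 \<bar>X i \<omega>\<bar>))\<^sup>2)))"
          by (intro Bochner_Integration.integrable_add integrable_mult_right int) simp
        show "integrable M (\<lambda>\<omega>. exp (\<theta> * trunc (\<epsilon> * t) i \<omega>))"
        proof (rule Bochner_Integration.integrable_bound[OF int2])
          show "AE \<omega> in M. norm (exp (\<theta> * trunc (\<epsilon> * t) i \<omega>))
              \<le> norm (1 + \<theta> * \<bar>c i\<bar> * (\<bar>K\<bar> * exp (\<kappa> * (ln (max 1 \<bar>X i \<omega>\<bar>))\<^sup>2)))"
            using pt by (intro AE_I2) (auto intro: order.trans[OF _ abs_ge_self])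
        qed measurable
      qed (rule pt)
      also have "\<dots> = 1 + \<theta> * \<bar>c i\<bar> * (\<bar>K\<bar> * expectation (\<lambda>\<omega>. exp (\<kappa> * (ln (max 1 \<bar>X i \<omega>\<bar>))\<^sup>2)))"
        by (subst Bochner_Integration.integral_add) (auto intro!: integrable_mult_right int simp: prob_space)
      also have "expectation (\<lambda>\<omega>. exp (\<kappa> * (ln (max 1 \<bar>X i \<omega>\<bar>))\<^sup>2)) = E"
        unfolding E_def by (rule X_integral(1)[of "\<lambda>x. exp (\<kappa> * (ln (max 1 \<bar>x\<bar>))\<^sup>2)"]) measurable
      finally show "expectation (\<lambda>\<omega>. exp (b * (ln t)\<^sup>2 / t * trunc (\<epsilon> * t) i \<omega>))
          \<le> 1 + b * (ln t)\<^sup>2 / t * \<bar>c i\<bar> * (\<bar>K\<bar> * E)" unfolding \<theta>_def .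
    qed
  qed
  with \<epsilon> E show ?thesis by (intro exI[of _ \<epsilon>] exI[of _ "\<bar>K\<bar> * E"]) auto
qed

lemma trunc_indep: "indep_vars (\<lambda>_. borel) (\<lambda>i \<omega>. exp (\<theta> * trunc y i \<omega>)) UNIV"
  unfolding trunc_def
  by (rule indep_vars_compose2[OF indep, where Y="\<lambda>i x. exp (\<theta> * min (max 0 (c i * x)) y)"]) measurable

text \<open>Chernoff's bound on finite partial sums, followed by a monotone limit: truncated terms
  are nonnegative, so the events increase with \<open>n\<close>, and the product of the exponential
  moments stays below \<open>exp (c_norm * K)\<close> for every \<open>n\<close>.\<close>

lemma trunc_sum_tail:
  assumes "b > 0" "\<eta> > 0"
  shows "\<exists>\<epsilon>. 0 < \<epsilon> \<and> \<epsilon> \<le> 1 / 2 \<and>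
    (\<lambda>t. prob {\<omega> \<in> space M. \<exists>n. (\<Sum>i\<in>{i \<in> UNIV. to_nat i < n}. trunc (\<epsilon> * t) i \<omega>) > \<eta> * t})
      \<in> O(\<lambda>t. exp (- (b * \<eta> * (ln t)\<^sup>2)))"
proof -
  obtain \<epsilon> K where \<epsilon>: "0 < \<epsilon>" "\<epsilon> \<le> 1 / 2" "0 \<le> K" and
    K: "\<forall>\<^sub>F t in at_top. \<forall>i. expectation (\<lambda>\<omega>. exp (b * (ln t)\<^sup>2 / t * trunc (\<epsilon> * t) i \<omega>)) \<le> 1 + b * (ln t)\<^sup>2 / t * \<bar>c i\<bar> * K"
    using trunc_exp_moment[OF assms(1)] by blast
  \<comment> \<open>Ensures \<open>\<theta> \<le> 1\<close>, so that the bound on the product does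
    not involve \<open>t\<close>.\<close>
  have e1: "\<forall>\<^sub>F t::real in at_top. b * (ln t)\<^sup>2 / t \<le> 1" by real_asymp
  have "\<forall>\<^sub>F t in at_top. norm (prob {\<omega> \<in> space M. \<exists>n. (\<Sum>i\<in>{i \<in> UNIV. to_nat i < n}. trunc (\<epsilon> * t) i \<omega>) > \<eta> * t})
      \<le> exp (c_norm * K) * norm (exp (- (b * \<eta> * (ln t)\<^sup>2)))"
    using K e1 eventually_gt_at_top[of 1]
  proof eventually_elim
    case (elim t)
    define \<theta> where "\<theta> = b * (ln t)\<^sup>2 / t"
    have \<theta>: "\<theta> > 0" "\<theta> \<le> 1" unfolding \<theta>_def using elim assms by auto
    let ?V = "\<lambda>i \<omega>. trunc (\<epsilon> * t) i \<omega>"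
    let ?E = "\<lambda>n. {i \<in> UNIV. to_nat (i::int) < n}"
    define U where "U = (\<lambda>n. {\<omega> \<in> space M. (\<Sum>i\<in>?E n. ?V i \<omega>) > \<eta> * t})"
    have V0: "?V i \<omega> \<ge> 0" for i \<omega> unfolding trunc_def using \<epsilon> elim by auto
    have Vt: "?V i \<omega> \<le> \<epsilon> * t" for i \<omega> unfolding trunc_def by auto
    have inc: "incseq U"
    proof (rule monoI)
      fix m n :: nat assume "m \<le> n"
      then have "(\<Sum>i\<in>?E m. ?V i \<omega>) \<le> (\<Sum>i\<in>?E n. ?V i \<omega>)" for \<omega>
        by (intro sum_mono2[OF finite_exhaust]) (auto simp: V0)
      then show "U m \<le> U n" unfolding U_def by (auto intro: less_le_trans)
    qed
    have "range U \<subseteq> events" unfolding U_def by auto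
    from finite_Lim_measure_incseq[OF this inc] have lim: "(\<lambda>n. prob (U n)) \<longlonglongrightarrow> prob (\<Union>n. U n)" .
    have bd: "prob (U n) \<le> exp (c_norm * K) * exp (- (b * \<eta> * (ln t)\<^sup>2))" for n
    proof -
      have int: "integrable M (\<lambda>\<omega>. exp (\<theta> * ?V i \<omega>))" for i
      proof (rule integrable_const_bound[where B = "exp (\<theta> * (\<epsilon> * t))"])
        show "AE \<omega> in M. norm (exp (\<theta> * ?V i \<omega>)) \<le> exp (\<theta> * (\<epsilon> * t))"
          using Vt \<theta> by (intro AE_I2) auto
      qed measurable
      have ind: "indep_vars (\<lambda>_. borel) (\<lambda>i \<omega>. exp (\<theta> * ?V i \<omega>)) (?E n)"
        using trunc_indep by (rule indep_vars_subset) auto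
      have prod_int: "integrable M (\<lambda>\<omega>. \<Prod>i\<in>?E n. exp (\<theta> * ?V i \<omega>))"
        by (rule indep_vars_integrable[OF finite_exhaust ind int])
      have "prob (U n) = prob {\<omega> \<in> space M. (\<Prod>i\<in>?E n. exp (\<theta> * ?V i \<omega>)) > exp (\<theta> * (\<eta> * t))}"
        unfolding U_def exp_sum[OF finite_exhaust, symmetric] sum_distrib_left[symmetric] using \<theta> by simp
      also have "\<dots> \<le> prob {\<omega> \<in> space M. (\<Prod>i\<in>?E n. exp (\<theta> * ?V i \<omega>)) \<ge> exp (\<theta> * (\<eta> * t))}"
        by (intro finite_measure_mono) auto
      also have "\<dots> \<le> expectation (\<lambda>\<omega>. \<Prod>i\<in>?E n. exp (\<theta> * ?V i \<omega>)) / exp (\<theta> * (\<eta> * t))"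
        by (rule integral_Markov_inequality_measure[OF prod_int, of "{}"]) (auto intro!: AE_I2 prod_nonneg)
      also have "expectation (\<lambda>\<omega>. \<Prod>i\<in>?E n. exp (\<theta> * ?V i \<omega>)) = (\<Prod>i\<in>?E n. expectation (\<lambda>\<omega>. exp (\<theta> * ?V i \<omega>)))"
        by (rule indep_vars_lebesgue_integral[OF finite_exhaust ind int])
      also have "\<dots> \<le> (\<Prod>i\<in>?E n. exp (\<bar>c i\<bar> * K))"
      proof (rule prod_mono, intro conjI)
        fix i
        show "0 \<le> expectation (\<lambda>\<omega>. exp (\<theta> * ?V i \<omega>))" by (rule Bochner_Integration.integral_nonneg) auto
        have "expectation (\<lambda>\<omega>. exp (\<theta> * ?V i \<omega>)) \<le> 1 + \<theta> * \<bar>c i\<bar> * K"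
          using elim(1) unfolding \<theta>_def by blast
        also have "\<dots> \<le> 1 + 1 * \<bar>c i\<bar> * K" using \<theta> \<epsilon> by (intro add_left_mono mult_right_mono) auto
        also have "\<dots> \<le> exp (\<bar>c i\<bar> * K)" using exp_ge_add_one_self[of "\<bar>c i\<bar> * K"] by simp
        finally show "expectation (\<lambda>\<omega>. exp (\<theta> * ?V i \<omega>)) \<le> exp (\<bar>c i\<bar> * K)" .
      qed
      also have "\<dots> = exp ((\<Sum>i\<in>?E n. \<bar>c i\<bar>) * K)"
        unfolding exp_sum[OF finite_exhaust, symmetric] sum_distrib_right ..
      also have "\<dots> \<le> exp (c_norm * K)"
        using sum_c_le[OF finite_exhaust, of UNIV n] \<epsilon> by (simp add: mult_right_mono)
      finally have "prob (U n) \<le> exp (c_norm * K) / exp (\<theta> * (\<eta> * t))" by (simp add: divide_right_mono)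
      also have "\<theta> * (\<eta> * t) = b * \<eta> * (ln t)\<^sup>2" unfolding \<theta>_def using elim by simp
      finally show ?thesis by (simp add: exp_minus divide_inverse)
    qed
    have "(\<Union>n. U n) = {\<omega> \<in> space M. \<exists>n. (\<Sum>i\<in>?E n. ?V i \<omega>) > \<eta> * t}" unfolding U_def by auto
    with LIMSEQ_le_const2[OF lim] bd show ?case by auto
  qed
  then show ?thesis using \<epsilon> by (intro exI[of _ \<epsilon>] conjI bigoI)
qed

end

section \<open>Probabilities of large summands\<close>

lemma Mbar_eq_measure:
  assumes "prob_space K" "sets K = sets borel"
  shows "Mbar K c t = measure K {x. c * x > t}"
proof -
  interpret prob_space K by fact
  have [measurable]: "(\<lambda>x. c * x) \<in> borel_measurable K"
    unfolding measurable_cong_sets[OF assms(2) refl] by measurable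
  have sp: "space K = UNIV" using sets_eq_imp_space_eq[OF assms(2)] by simp
  have "Mbar K c t = 1 - measure K {x. c * x \<le> t}"
    unfolding Mbar_def cdf_def by (subst measure_distr) (auto simp: vimage_def sp)
  also have "\<dots> = measure K (space K - {x. c * x \<le> t})"
    by (subst prob_compl) (auto simp: assms(2))
  also have "space K - {x. c * x \<le> t} = {x. c * x > t}" by (auto simp: sp)
  finally show ?thesis .
qed

context weighted_sum
begin

lemma Mbar_X: "Mbar (distr M borel (X 0)) a t = prob {\<omega> \<in> space M. a * X i \<omega> > t}"
proof -
  interpret D: prob_space "distr M borel (X 0)" by (rule prob_space_distr) measurable
  have "Mbar (distr M borel (X 0)) a t = measure (distr M borel (X i)) {x. a * x > t}"
    unfolding ident[of i] by (rule Mbar_eq_measure) (auto intro: D.prob_space_axioms)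
  also have "\<dots> = prob {\<omega> \<in> space M. a * X i \<omega> > t}"
    by (subst measure_distr) (auto intro!: arg_cong[where f=prob])
  finally show ?thesis .
qed

text \<open>Markov's inequality with an extra factor \<open>\<bar>c i * X i\<bar>\<close>, which is
  at least 1 on the event because \<open>y \<ge> 1\<close>; it makes the bound proportional to
  \<open>\<bar>c i\<bar>\<close>. Division of \<open>y\<close> by \<open>max 1 c_norm\<close> makes
  the rest uniform over the weights.\<close>

lemma big_tail:
  assumes \<kappa>: "0 \<le> \<kappa>" "\<kappa> < \<kappa>0"
  shows "\<exists>K\<ge>0. \<forall>y\<ge>max 1 c_norm. \<forall>i. prob {\<omega> \<in> space M. c i * X i \<omega> > y}
    \<le> \<bar>c i\<bar> * (K * exp (- (\<kappa> * (ln (y / max 1 c_norm))\<^sup>2)))"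
proof -
  define B where "B = max 1 c_norm"
  have B: "B \<ge> 1" "\<And>i. \<bar>c i\<bar> \<le> B" using c_le unfolding B_def by (auto intro: max.coboundedI2)
  let ?g = "\<lambda>x::real. \<bar>x\<bar> ^ 1 * exp (\<kappa> * (ln (max 1 \<bar>x\<bar>))\<^sup>2)"
  define K where "K = expectation (\<lambda>\<omega>. ?g (X 0 \<omega>))"
  have K: "K \<ge> 0" unfolding K_def by (rule Bochner_Integration.integral_nonneg) auto
  have "prob {\<omega> \<in> space M. c i * X i \<omega> > y} \<le> \<bar>c i\<bar> * (K * exp (- (\<kappa> * (ln (y / B))\<^sup>2)))" if y: "y \<ge> B" for y i
  proof -
    define v where "v = y / B"
    have v: "v \<ge> 1" using y B unfolding v_def by simp
    have y1: "y \<ge> 1" using y B by simp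
    let ?h = "\<lambda>\<omega>. \<bar>c i\<bar> * exp (- (\<kappa> * (ln v)\<^sup>2)) * ?g (X i \<omega>)"
    have int: "integrable M ?h" by (intro integrable_mult_right integrable_power_exp \<kappa>)
    have "prob {\<omega> \<in> space M. c i * X i \<omega> > y} = expectation (indicator {\<omega> \<in> space M. c i * X i \<omega> > y})"
      by simp
    also have "\<dots> \<le> expectation ?h"
    proof (rule integral_mono[OF _ int])
      show "integrable M (indicator {\<omega> \<in> space M. c i * X i \<omega> > y} :: 'a \<Rightarrow> real)"
        by (rule integrable_const_bound[where B = 1]) (auto simp: indicator_def)
      fix \<omega> assume "\<omega> \<in> space M"
      show "indicator {\<omega> \<in> space M. c i * X i \<omega> > y} \<omega> \<le> ?h \<omega>"
      proof (cases "c i * X i \<omega> > y")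
        case True
        have cx: "\<bar>c i\<bar> * \<bar>X i \<omega>\<bar> > y" using True abs_ge_self[of "c i * X i \<omega>"] unfolding abs_mult by linarith
        also have "\<bar>c i\<bar> * \<bar>X i \<omega>\<bar> \<le> B * \<bar>X i \<omega>\<bar>" by (rule mult_right_mono[OF B(2)]) simp
        finally have vx: "v < \<bar>X i \<omega>\<bar>" unfolding v_def using B by (simp add: pos_divide_less_eq mult.commute)
        then have "ln v \<le> ln (max 1 \<bar>X i \<omega>\<bar>)" using v by (intro ln_mono) auto
        then have "(ln v)\<^sup>2 \<le> (ln (max 1 \<bar>X i \<omega>\<bar>))\<^sup>2" using v by (intro power_mono) auto
        then have "\<kappa> * (ln v)\<^sup>2 \<le> \<kappa> * (ln (max 1 \<bar>X i \<omega>\<bar>))\<^sup>2" using \<kappa> by (intro mult_left_mono)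
        then have "1 \<le> exp (\<kappa> * (ln (max 1 \<bar>X i \<omega>\<bar>))\<^sup>2 + - (\<kappa> * (ln v)\<^sup>2))" by simp
        then have "1 * 1 \<le> (\<bar>c i\<bar> * \<bar>X i \<omega>\<bar>) * exp (\<kappa> * (ln (max 1 \<bar>X i \<omega>\<bar>))\<^sup>2 + - (\<kappa> * (ln v)\<^sup>2))"
          using cx y1 by (intro mult_mono) auto
        also have "\<dots> = ?h \<omega>" unfolding exp_add by simp
        finally show ?thesis by (simp add: indicator_def)
      qed (simp add: indicator_def)
    qed
    also have "expectation ?h = \<bar>c i\<bar> * exp (- (\<kappa> * (ln v)\<^sup>2)) * K"
      unfolding K_def using X_integral(1)[of ?g i] by simp
    finally show ?thesis unfolding v_def by (simp add: mult_ac)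
  qed
  with K show ?thesis unfolding B_def by blast
qed

text \<open>By independence a pair contributes at most the product of its two bounds, and summation
  over pairs gives a square. This doubles the constant in
  \<open>exp (- (\<kappa> * (ln t)\<^sup>2))\<close>.\<close>

lemma two_big:
  assumes q: "q \<ge> 0" and A: "\<And>i. prob {\<omega> \<in> space M. c i * X i \<omega> > y} \<le> \<bar>c i\<bar> * q"
  shows "prob {\<omega> \<in> space M. \<exists>i j. i \<noteq> j \<and> c i * X i \<omega> > y \<and> c j * X j \<omega> > y} \<le> (c_norm * q)\<^sup>2"
proof -
  define A where "A = (\<lambda>i. {\<omega> \<in> space M. c i * X i \<omega> > y})"
  have [measurable]: "A i \<in> events" for i unfolding A_def by measurable
  define D where "D = (\<lambda>i j. if i = j then {} else A i \<inter> A j)"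
  have [measurable]: "D i j \<in> events" for i j unfolding D_def by auto
  have Aq: "prob (A i) \<le> \<bar>c i\<bar> * q" for i using assms unfolding A_def by simp
  have pair: "prob (D i j) \<le> \<bar>c i\<bar> * q * (\<bar>c j\<bar> * q)" for i j
  proof (cases "i = j")
    case True
    then show ?thesis using q by (simp add: D_def)
  next
    case False
    have "prob (\<Inter>l\<in>{i, j}. X l -` {x. c l * x > y} \<inter> space M) = (\<Prod>l\<in>{i, j}. prob (X l -` {x. c l * x > y} \<inter> space M))"
      by (rule indep_varsD[OF indep]) auto
    moreover have "X l -` {x. c l * x > y} \<inter> space M = A l" for l unfolding A_def by auto
    ultimately have "prob (A i \<inter> A j) = prob (A i) * prob (A j)" using False by simp
    also have "\<dots> \<le> \<bar>c i\<bar> * q * (\<bar>c j\<bar> * q)" using q by (intro mult_mono Aq) auto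
    finally show ?thesis using False by (simp add: D_def)
  qed
  have "prob (\<Union>i. \<Union>j. D i j) \<le> (c_norm * q)\<^sup>2"
  proof (rule prob_UN_le)
    show "(\<Union>j. D i j) \<in> events" for i by measurable
    show "prob (\<Union>j. D i j) \<le> \<bar>c i\<bar> * q * (c_norm * q)" for i
    proof (rule prob_UN_le[OF _ pair])
      fix F :: "int set" assume F: "finite F"
      have "(\<Sum>j\<in>F. \<bar>c i\<bar> * q * (\<bar>c j\<bar> * q)) = \<bar>c i\<bar> * q * ((\<Sum>j\<in>F. \<bar>c j\<bar>) * q)"
        by (simp only: sum_distrib_left sum_distrib_right)
      also have "\<dots> \<le> \<bar>c i\<bar> * q * (c_norm * q)"
        using sum_c_le[OF F] q by (intro mult_left_mono mult_right_mono) auto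
      finally show "(\<Sum>j\<in>F. \<bar>c i\<bar> * q * (\<bar>c j\<bar> * q)) \<le> \<bar>c i\<bar> * q * (c_norm * q)" .
    qed measurable
    fix F :: "int set" assume F: "finite F"
    have "(\<Sum>i\<in>F. \<bar>c i\<bar> * q * (c_norm * q)) = (\<Sum>i\<in>F. \<bar>c i\<bar>) * q * (c_norm * q)"
      by (simp only: sum_distrib_left sum_distrib_right)
    also have "\<dots> \<le> c_norm * q * (c_norm * q)"
      using sum_c_le[OF F] q c_norm_nonneg by (intro mult_right_mono) auto
    finally show "(\<Sum>i\<in>F. \<bar>c i\<bar> * q * (c_norm * q)) \<le> (c_norm * q)\<^sup>2" by (simp add: power2_eq_square)
  qed
  also have "(\<Union>i. \<Union>j. D i j) = {\<omega> \<in> space M. \<exists>i j. i \<noteq> j \<and> c i * X i \<omega> > y \<and> c j * X j \<omega> > y}"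
    unfolding D_def A_def by (auto split: if_splits)
  finally show ?thesis .
qed

text \<open>A summand not above \<open>y\<close> is at most its truncation, and truncations at the
  remaining indices are nonnegative, so partial sums over \<open>A\<close> stay below the full
  truncated ones.\<close>

lemma part_le_trunc:
  assumes s: "(\<lambda>j. c j * X j \<omega>) summable_on UNIV" and y: "y \<ge> 0"
    and V: "\<And>n. (\<Sum>i\<in>{i \<in> UNIV. to_nat i < n}. trunc y i \<omega>) \<le> z"
    and A: "\<And>i. i \<in> A \<Longrightarrow> c i * X i \<omega> \<le> y"
  shows "part A \<omega> \<le> z"
proof -
  have "(\<lambda>n. \<Sum>j\<in>{j \<in> A. to_nat j < n}. c j * X j \<omega>) \<longlonglongrightarrow> part A \<omega>"
    unfolding part_def by (rule infsum_exhaust) (auto intro: summable_on_subset_banach[OF s])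
  then show ?thesis
  proof (rule LIMSEQ_le_const2)
    have "(\<Sum>j\<in>{j \<in> A. to_nat j < n}. c j * X j \<omega>) \<le> z" for n
    proof -
      have "(\<Sum>j\<in>{j \<in> A. to_nat j < n}. c j * X j \<omega>) \<le> (\<Sum>j\<in>{j \<in> A. to_nat j < n}. trunc y j \<omega>)"
        using A by (intro sum_mono) (auto simp: trunc_def)
      also have "\<dots> \<le> (\<Sum>i\<in>{i \<in> UNIV. to_nat i < n}. trunc y i \<omega>)"
        using y by (intro sum_mono2[OF finite_exhaust]) (auto simp: trunc_def)
      also have "\<dots> \<le> z" by (rule V)
      finally show ?thesis .
    qed
    then show "\<exists>N. \<forall>n\<ge>N. (\<Sum>j\<in>{j \<in> A. to_nat j < n}. c j * X j \<omega>) \<le> z" by blast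
  qed
qed

text \<open>Unless the truncated summands add up to \<open>\<eta> t\<close> or two summands exceed \<open>\<epsilon> t\<close>, the event that the
  sum exceeds \<open>t\<close> has exactly one \<open>i \<in> I\<close> with \<open>part (UNIV - {i}) \<le> t / 2\<close>, or else some summand
  outside \<open>I\<close> exceeds \<open>(1 - \<eta>) t\<close>.\<close>
lemma one_big_jump:
  assumes I: "finite I" and \<eta>: "0 < \<eta>" "\<eta> \<le> 1 / 2" and \<kappa>: "0 \<le> \<kappa>" "\<kappa> < 2 * \<kappa>0"
  shows "\<exists>R. R \<in> O(\<lambda>t. exp (- (\<kappa> * (ln t)\<^sup>2))) \<and> (\<forall>\<^sub>F t in at_top.
    \<bar>prob {\<omega> \<in> space M. part UNIV \<omega> > t}
      - (\<Sum>i\<in>I. prob {\<omega> \<in> space M. part UNIV \<omega> > t \<and> part (UNIV - {i}) \<omega> \<le> t / 2})\<bar>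
    \<le> (real (card I) + 1) * (R t + prob {\<omega> \<in> space M. \<exists>i. i \<notin> I \<and> c i * X i \<omega> > (1 - \<eta>) * t}))"
proof -
  \<comment> \<open>Chernoff's bound yields the constant \<open>b * \<eta>\<close>; this choice
    makes it exceed \<open>\<kappa>\<close>.\<close>
  define b where "b = (\<kappa> + 1) / \<eta>"
  have b: "b > 0" "b * \<eta> = \<kappa> + 1" using \<eta> \<kappa> by (auto simp: b_def)
  \<comment> \<open>Strictly between \<open>\<kappa> / 2\<close> and \<open>\<kappa>0\<close>, so
    that two large summands give a constant \<open>2 * \<kappa>'\<close> above
    \<open>\<kappa>\<close>.\<close>
  define \<kappa>' where "\<kappa>' = (\<kappa> / 2 + \<kappa>0) / 2"
  have \<kappa>': "0 \<le> \<kappa>'" "\<kappa>' < \<kappa>0" "\<kappa> < 2 * \<kappa>'" using \<kappa> \<kappa>0 by (auto simp: \<kappa>'_def field_simps)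
  obtain \<epsilon> where \<epsilon>: "0 < \<epsilon>" "\<epsilon> \<le> 1 / 2" and
    T: "(\<lambda>t. prob {\<omega> \<in> space M. \<exists>n. (\<Sum>i\<in>{i \<in> UNIV. to_nat i < n}. trunc (\<epsilon> * t) i \<omega>) > \<eta> * t})
      \<in> O(\<lambda>t. exp (- (b * \<eta> * (ln t)\<^sup>2)))"
    using trunc_sum_tail[OF b(1) \<eta>(1)] by blast
  define B where "B = max 1 c_norm"
  have B: "B \<ge> 1" unfolding B_def by simp
  obtain K where K: "K \<ge> 0" "\<And>y i. y \<ge> B \<Longrightarrow> prob {\<omega> \<in> space M. c i * X i \<omega> > y}
    \<le> \<bar>c i\<bar> * (K * exp (- (\<kappa>' * (ln (y / B))\<^sup>2)))"
    using big_tail[OF \<kappa>'(1,2)] unfolding B_def by blast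
  define TT where "TT = (\<lambda>t. {\<omega> \<in> space M. \<exists>n. (\<Sum>i\<in>{i \<in> UNIV. to_nat i < n}. trunc (\<epsilon> * t) i \<omega>) > \<eta> * t})"
  define BB where "BB = (\<lambda>t. {\<omega> \<in> space M. \<exists>i j. i \<noteq> j \<and> c i * X i \<omega> > \<epsilon> * t \<and> c j * X j \<omega> > \<epsilon> * t})"
  define NN where "NN = (\<lambda>t. {\<omega> \<in> space M. \<exists>i. i \<notin> I \<and> c i * X i \<omega> > (1 - \<eta>) * t})"
  have [measurable]: "TT t \<in> events" "BB t \<in> events" "NN t \<in> events" for t
    unfolding TT_def BB_def NN_def by measurable
  define R where "R = (\<lambda>t. prob (TT t) + prob (BB t))"
  have "R \<in> O(\<lambda>t. exp (- (\<kappa> * (ln t)\<^sup>2)))"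
    unfolding R_def
  proof (rule sum_in_bigo)
    have "(\<lambda>t::real. exp (- ((\<kappa> + 1) * (ln t)\<^sup>2))) \<in> O(\<lambda>t. exp (- (\<kappa> * (ln t)\<^sup>2)))"
      by (rule bigoI[where c=1]) (auto intro!: always_eventually mult_right_mono)
    with T show "(\<lambda>t. prob (TT t)) \<in> O(\<lambda>t. exp (- (\<kappa> * (ln t)\<^sup>2)))"
      unfolding TT_def b(2) by (rule landau_o.big_trans)
    have "(\<lambda>t. prob (BB t)) \<in> O(\<lambda>t. exp (- (2 * \<kappa>' * (ln (\<epsilon> * t / B))\<^sup>2)))"
    proof (rule bigoI[where c="(c_norm * K)\<^sup>2"])
      have "\<forall>\<^sub>F t::real in at_top. \<epsilon> * t \<ge> B" using \<epsilon>(1) by real_asymp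
      then show "\<forall>\<^sub>F t in at_top. norm (prob (BB t)) \<le> (c_norm * K)\<^sup>2 * norm (exp (- (2 * \<kappa>' * (ln (\<epsilon> * t / B))\<^sup>2)))"
      proof eventually_elim
        case (elim t)
        have "prob (BB t) \<le> (c_norm * (K * exp (- (\<kappa>' * (ln (\<epsilon> * t / B))\<^sup>2))))\<^sup>2"
          unfolding BB_def using K elim by (intro two_big) auto
        also have "\<dots> = (c_norm * K)\<^sup>2 * (exp (- (\<kappa>' * (ln (\<epsilon> * t / B))\<^sup>2)))\<^sup>2"
          by (simp add: power_mult_distrib)
        also have "(exp (- (\<kappa>' * (ln (\<epsilon> * t / B))\<^sup>2)))\<^sup>2 = exp (- (2 * \<kappa>' * (ln (\<epsilon> * t / B))\<^sup>2))"
          by (simp add: exp_double[symmetric])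
        finally show ?case by simp
      qed
    qed
    also have "(\<lambda>t. exp (- (2 * \<kappa>' * (ln (\<epsilon> * t / B))\<^sup>2))) \<in> O(\<lambda>t. exp (- (\<kappa> * (ln t)\<^sup>2)))"
    proof (rule bigoI[where c=1])
      \<comment> \<open>The slack between \<open>\<kappa>\<close> and \<open>2 * \<kappa>'\<close>
        covers the change from \<open>t\<close> to \<open>\<epsilon> * t / B\<close>, which alters
        \<open>(ln t)\<^sup>2\<close> only by a term of lower order.\<close>
      define r where "r = \<kappa> / (2 * \<kappa>')"
      have r: "r < 1" "\<kappa> = 2 * \<kappa>' * r" using \<kappa>' \<kappa> unfolding r_def by auto
      have "\<forall>\<^sub>F t::real in at_top. r * (ln t)\<^sup>2 \<le> (ln (\<epsilon> * t / B))\<^sup>2"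
        using r(1) \<epsilon>(1) B by real_asymp
      then show "\<forall>\<^sub>F t::real in at_top. norm (exp (- (2 * \<kappa>' * (ln (\<epsilon> * t / B))\<^sup>2))) \<le> 1 * norm (exp (- (\<kappa> * (ln t)\<^sup>2)))"
      proof eventually_elim
        case (elim t)
        have "2 * \<kappa>' * (r * (ln t)\<^sup>2) \<le> 2 * \<kappa>' * (ln (\<epsilon> * t / B))\<^sup>2"
          using elim \<kappa>' by (intro mult_left_mono) auto
        then show ?case using r(2) by (simp add: mult.assoc)
      qed
    qed
    finally show "(\<lambda>t. prob (BB t)) \<in> O(\<lambda>t. exp (- (\<kappa> * (ln t)\<^sup>2)))" .
  qed
  moreover have "\<forall>\<^sub>F t in at_top.
    \<bar>prob {\<omega> \<in> space M. part UNIV \<omega> > t}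
      - (\<Sum>i\<in>I. prob {\<omega> \<in> space M. part UNIV \<omega> > t \<and> part (UNIV - {i}) \<omega> \<le> t / 2})\<bar>
    \<le> (real (card I) + 1) * (R t + prob (NN t))"
    using eventually_gt_at_top[of 0]
  proof eventually_elim
    case (elim t)
    define G where "G = {\<omega> \<in> space M. part UNIV \<omega> > t}"
    define H where "H = (\<lambda>i. {\<omega> \<in> space M. part UNIV \<omega> > t \<and> part (UNIV - {i}) \<omega> \<le> t / 2})"
    have [measurable]: "G \<in> events" "H i \<in> events" for i unfolding G_def H_def by measurable
    have ind [simp]: "integrable M (indicator A :: 'a \<Rightarrow> real)" if "A \<in> events" for A
      by (rule integrable_const_bound[where B = 1]) (use that in \<open>auto simp: indicator_def\<close>)
    define Bad where "Bad = TT t \<union> BB t \<union> NN t"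
    have [measurable]: "Bad \<in> events" unfolding Bad_def by measurable
    have "AE \<omega> in M. \<bar>indicator G \<omega> - (\<Sum>i\<in>I. indicator (H i) \<omega>)\<bar> \<le> (real (card I) + 1) * indicator Bad \<omega>"
      using AE_summable AE_space
    proof eventually_elim
      fix \<omega> assume s: "(\<lambda>j. c j * X j \<omega>) summable_on UNIV" and \<omega>: "\<omega> \<in> space M"
      show "\<bar>indicator G \<omega> - (\<Sum>i\<in>I. indicator (H i) \<omega>)\<bar> \<le> (real (card I) + 1) * indicator Bad \<omega>"
      proof (cases "\<omega> \<in> Bad")
        case True
        have "(\<Sum>i\<in>I. indicator (H i) \<omega> :: real) \<le> real (card I)"
          using sum_mono[of I "\<lambda>i. indicator (H i) \<omega> :: real" "\<lambda>_. 1"] by (simp add: indicator_def)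
        moreover have "(\<Sum>i\<in>I. indicator (H i) \<omega> :: real) \<ge> 0" by (intro sum_nonneg) auto
        moreover have "0 \<le> (indicator G \<omega> :: real)" "indicator G \<omega> \<le> (1::real)" by (auto simp: indicator_def)
        ultimately have "\<bar>indicator G \<omega> - (\<Sum>i\<in>I. indicator (H i) \<omega>)\<bar> \<le> real (card I) + 1" by linarith
        then show ?thesis using True by simp
      next
        case False
        have V: "(\<Sum>i\<in>{i \<in> UNIV. to_nat i < n}. trunc (\<epsilon> * t) i \<omega>) \<le> \<eta> * t" for n
          using False \<omega> unfolding Bad_def TT_def by (auto simp: not_less)
        have nb: "c j * X j \<omega> \<le> \<epsilon> * t" if "c i * X i \<omega> > \<epsilon> * t" "i \<noteq> j" for i j
        proof (rule ccontr)
          assume "\<not> c j * X j \<omega> \<le> \<epsilon> * t"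
          then have "\<omega> \<in> BB t" using that \<omega> unfolding BB_def not_le by blast
          then show False using False unfolding Bad_def by blast
        qed
        have nn: "c i * X i \<omega> \<le> (1 - \<eta>) * t" if "i \<notin> I" for i
          using False \<omega> that unfolding Bad_def NN_def by (auto simp: not_less)
        have y: "0 \<le> \<epsilon> * t" "\<epsilon> * t \<le> t / 2" "\<eta> * t \<le> t / 2" "t / 2 < t"
          using \<epsilon> \<eta> elim mult_right_mono[of \<epsilon> "1/2" t] mult_right_mono[of \<eta> "1/2" t] by auto
        show ?thesis
        proof (cases "part UNIV \<omega> > t")
          case False
          then show ?thesis by (simp add: G_def H_def)
        next
          case S: True
          \<comment> \<open>Some summand exceeds \<open>\<epsilon> * t\<close>, else the sum is at
            most \<open>\<eta> * t\<close>. The others then add up to at most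
            \<open>\<eta> * t \<le> t / 2\<close>, and if its index were outside \<open>I\<close>
            the total would be at most \<open>(1 - \<eta>) * t + \<eta> * t = t\<close>.\<close>
          have ex: "\<exists>i\<in>I. part (UNIV - {i}) \<omega> \<le> t / 2"
          proof (rule ccontr)
            assume no: "\<not> ?thesis"
            show False
            proof (cases "\<exists>j. c j * X j \<omega> > \<epsilon> * t")
              case True
              then obtain j where j: "c j * X j \<omega> > \<epsilon> * t" by blast
              have W: "part (UNIV - {j}) \<omega> \<le> \<eta> * t"
                using nb[OF j] by (intro part_le_trunc[OF s y(1) V]) auto
              have "part (UNIV - {j}) \<omega> \<le> t / 2" using W y(3) by linarith
              with no have "j \<notin> I" by blast
              from nn[OF this] part_remove[OF s, of j] W S show False by (simp add: algebra_simps)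
            next
              case False
              have "part UNIV \<omega> \<le> \<eta> * t"
                using False by (intro part_le_trunc[OF s y(1) V]) (auto simp: not_less)
              with S y show False by linarith
            qed
          qed
          then obtain i where i: "i \<in> I" "part (UNIV - {i}) \<omega> \<le> t / 2" by blast
          \<comment> \<open>A remaining sum of at most \<open>t / 2\<close> forces the removed term
            above \<open>t / 2 \<ge> \<epsilon> * t\<close>, and two such terms are
            excluded.\<close>
          have uniq: "j = i" if "part (UNIV - {j}) \<omega> \<le> t / 2" for j
          proof (rule ccontr)
            assume "j \<noteq> i"
            moreover have "c i * X i \<omega> > \<epsilon> * t" "c j * X j \<omega> > \<epsilon> * t"
              using part_remove[OF s, of i] part_remove[OF s, of j] i that S y by linarith+
            ultimately show False using nb[of i j] by auto
          qed
          have "indicator (H j) \<omega> = (if j = i then 1 else 0 :: real)" for j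
          proof (cases "j = i")
            case True
            then show ?thesis using i(2) S \<omega> by (simp add: H_def)
          next
            case False
            then have "\<omega> \<notin> H j" using uniq[of j] unfolding H_def by blast
            with False show ?thesis by simp
          qed
          then have "(\<Sum>j\<in>I. indicator (H j) \<omega> :: real) = 1"
            using i I by simp
          then show ?thesis using S \<omega> by (simp add: G_def)
        qed
      qed
    qed
    moreover have int: "integrable M (\<lambda>\<omega>. indicator G \<omega> - (\<Sum>i\<in>I. indicator (H i) \<omega>) :: real)"
      by (intro Bochner_Integration.integrable_diff Bochner_Integration.integrable_sum) auto
    ultimately have "expectation (\<lambda>\<omega>. \<bar>indicator G \<omega> - (\<Sum>i\<in>I. indicator (H i) \<omega>)\<bar>)
        \<le> expectation (\<lambda>\<omega>. (real (card I) + 1) * indicator Bad \<omega>)"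
      by (intro integral_mono_AE integrable_abs) auto
    also have "\<dots> = (real (card I) + 1) * prob Bad" by simp
    also have "prob Bad \<le> prob (TT t) + prob (BB t) + prob (NN t)"
      unfolding Bad_def
      by (intro order.trans[OF measure_Un_le] add_right_mono measure_Un_le) auto
    finally have *: "expectation (\<lambda>\<omega>. \<bar>indicator G \<omega> - (\<Sum>i\<in>I. indicator (H i) \<omega>)\<bar>)
        \<le> (real (card I) + 1) * (R t + prob (NN t))"
      unfolding R_def by (simp add: mult_left_mono)
    have "expectation (\<lambda>\<omega>. indicator G \<omega> - (\<Sum>i\<in>I. indicator (H i) \<omega>)) = prob G - (\<Sum>i\<in>I. prob (H i))"
      by (subst Bochner_Integration.integral_diff)
        (auto simp: Bochner_Integration.integral_sum intro!: Bochner_Integration.integrable_sum)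
    with integral_abs_bound[of M "\<lambda>\<omega>. indicator G \<omega> - (\<Sum>i\<in>I. indicator (H i) \<omega>)"] *
    show ?case unfolding G_def H_def by linarith
  qed
  ultimately show ?thesis unfolding NN_def by blast
qed

section \<open>Independence and the convolution formula\<close>

lemma indep_part: "indep_var borel (part (UNIV - {i})) borel (X i)"
proof -
  have 1: "indep_var (PiM (UNIV - {i}) (\<lambda>_. borel)) (\<lambda>\<omega>. restrict (\<lambda>j. X j \<omega>) (UNIV - {i}))
      (PiM {i} (\<lambda>_. borel)) (\<lambda>\<omega>. restrict (\<lambda>j. X j \<omega>) {i})"
    by (rule indep_var_restrict[OF indep]) auto
  have 2: "(\<lambda>x. \<Sum>\<^sub>\<infinity>j\<in>UNIV - {i}. c j * x j) \<in> borel_measurable (PiM (UNIV - {i}) (\<lambda>_. borel))"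
    by (rule borel_measurable_infsum) measurable
  have 3: "(\<lambda>x. x i) \<in> borel_measurable (PiM {i} (\<lambda>_. borel))"
    by (rule measurable_component_singleton) simp
  have "(\<lambda>x. \<Sum>\<^sub>\<infinity>j\<in>UNIV - {i}. c j * x j) \<circ> (\<lambda>\<omega>. restrict (\<lambda>j. X j \<omega>) (UNIV - {i})) = part (UNIV - {i})"
    by (rule ext, unfold part_def comp_def, rule infsum_cong) simp
  moreover have "(\<lambda>x. x i) \<circ> (\<lambda>\<omega>. restrict (\<lambda>j. X j \<omega>) {i}) = X i" by auto
  ultimately show ?thesis using indep_var_compose[OF 1 2 3] by simp
qed

text \<open>Removing the \<open>i\<close>th term is an almost sure identity, and independence turns
  the joint law into a product measure, whose section at \<open>w\<close> is an upper tail event of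
  the \<open>i\<close>th term.\<close>

lemma prob_convolution:
  "prob {\<omega> \<in> space M. part UNIV \<omega> > t \<and> part (UNIV - {i}) \<omega> \<le> s}
    = (\<integral>w. indicator {..s} w * Mbar (distr M borel (X 0)) (c i) (t - w) \<partial>distr M borel (part (UNIV - {i})))"
proof -
  define W where "W = part (UNIV - {i})"
  have [measurable]: "W \<in> borel_measurable M" unfolding W_def by measurable
  interpret DW: prob_space "distr M borel W" by (rule prob_space_distr) measurable
  interpret DX: prob_space "distr M borel (X i)" by (rule prob_space_distr) measurable
  define Q where "Q = {p :: real \<times> real. fst p + c i * snd p > t \<and> fst p \<le> s}"
  have Q [measurable]: "Q \<in> sets (borel \<Otimes>\<^sub>M borel)"
  proof -
    have "Q = {p \<in> space (borel \<Otimes>\<^sub>M borel). fst p + c i * snd p > t \<and> fst p \<le> s}"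
      unfolding Q_def by (simp add: space_pair_measure)
    also have "\<dots> \<in> sets (borel \<Otimes>\<^sub>M borel)" by measurable
    finally show ?thesis .
  qed
  have m: "emeasure (distr M borel (X i)) (Pair w -` Q)
      = ennreal (indicator {..s} w * Mbar (distr M borel (X 0)) (c i) (t - w))" for w
  proof (cases "w \<le> s")
    case True
    then have "Pair w -` Q = {x. c i * x > t - w}" unfolding Q_def by auto
    then have "emeasure (distr M borel (X i)) (Pair w -` Q) = ennreal (measure (distr M borel (X i)) {x. c i * x > t - w})"
      by (simp add: DX.emeasure_eq_measure)
    also have "measure (distr M borel (X i)) {x. c i * x > t - w} = Mbar (distr M borel (X 0)) (c i) (t - w)"
      unfolding ident[of i, symmetric] by (rule Mbar_eq_measure[symmetric]) (auto intro: DX.prob_space_axioms)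
    finally show ?thesis using True by simp
  next
    case False
    then have "Pair w -` Q = {}" unfolding Q_def by auto
    with False show ?thesis by simp
  qed
  have nonneg: "0 \<le> indicator {..s} w * Mbar (distr M borel (X 0)) (c i) (t - w)" for w
    unfolding Mbar_X[of _ _ 0] by simp
  have meas: "(\<lambda>w. indicator {..s} w * Mbar (distr M borel (X 0)) (c i) (t - w)) \<in> borel_measurable (distr M borel W)"
  proof -
    have "(\<lambda>w. emeasure (distr M borel (X i)) (Pair w -` Q)) \<in> borel_measurable (distr M borel W)"
      by (rule DX.measurable_emeasure_Pair) (use Q in \<open>simp cong: sets_pair_measure_cong\<close>)
    then have "(\<lambda>w. enn2real (emeasure (distr M borel (X i)) (Pair w -` Q))) \<in> borel_measurable (distr M borel W)"
      by (rule borel_measurable_enn2real)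
    then show ?thesis unfolding m by (simp add: nonneg)
  qed
  have "prob {\<omega> \<in> space M. part UNIV \<omega> > t \<and> W \<omega> \<le> s} = prob {\<omega> \<in> space M. (W \<omega>, X i \<omega>) \<in> Q}"
  proof (rule finite_measure_eq_AE)
    show "AE \<omega> in M. \<omega> \<in> {\<omega> \<in> space M. part UNIV \<omega> > t \<and> W \<omega> \<le> s} \<longleftrightarrow> \<omega> \<in> {\<omega> \<in> space M. (W \<omega>, X i \<omega>) \<in> Q}"
      using AE_summable
    proof eventually_elim
      case (elim \<omega>)
      show ?case unfolding Q_def W_def using part_remove[OF elim, of i] by (auto simp: add.commute)
    qed
  qed measurable
  also have "ennreal \<dots> = emeasure (distr M (borel \<Otimes>\<^sub>M borel) (\<lambda>\<omega>. (W \<omega>, X i \<omega>))) Q"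
    by (subst emeasure_distr) (auto simp: emeasure_eq_measure intro!: arg_cong[where f=prob])
  also have "distr M (borel \<Otimes>\<^sub>M borel) (\<lambda>\<omega>. (W \<omega>, X i \<omega>)) = distr M borel W \<Otimes>\<^sub>M distr M borel (X i)"
    using indep_part[of i] unfolding indep_var_distribution_eq W_def by simp
  also have "emeasure (distr M borel W \<Otimes>\<^sub>M distr M borel (X i)) Q = (\<integral>\<^sup>+w. emeasure (distr M borel (X i)) (Pair w -` Q) \<partial>distr M borel W)"
    by (rule DX.emeasure_pair_measure_alt) (use Q in \<open>simp cong: sets_pair_measure_cong\<close>)
  also have "\<dots> = (\<integral>\<^sup>+w. ennreal (indicator {..s} w * Mbar (distr M borel (X 0)) (c i) (t - w)) \<partial>distr M borel W)"
    unfolding m ..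
  finally have E: "ennreal (prob {\<omega> \<in> space M. part UNIV \<omega> > t \<and> W \<omega> \<le> s})
      = (\<integral>\<^sup>+w. ennreal (indicator {..s} w * Mbar (distr M borel (X 0)) (c i) (t - w)) \<partial>distr M borel W)" .
  have "(\<integral>w. indicator {..s} w * Mbar (distr M borel (X 0)) (c i) (t - w) \<partial>distr M borel W)
      = enn2real (\<integral>\<^sup>+w. ennreal (indicator {..s} w * Mbar (distr M borel (X 0)) (c i) (t - w)) \<partial>distr M borel W)"
    by (rule integral_eq_nn_integral[OF meas]) (simp add: nonneg)
  also have "\<dots> = prob {\<omega> \<in> space M. part UNIV \<omega> > t \<and> W \<omega> \<le> s}"
    unfolding E[symmetric] by simp
  finally show ?thesis unfolding W_def by simp
qed

end

section \<open>Comparison of weighted tails\<close>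

lemma is_hazard_rate_reg_tail:
  assumes "prob_space N" "sets N = sets borel" and haz: "is_hazard_rate (cdf N) h"
    and h: "h \<sim>[at_top] (\<lambda>t. lam * ln t / t)" and lam: "lam > 0"
    and sv: "smoothly_varying (-1) m h"
  shows "reg_tail lam m (\<lambda>t. 1 - cdf N t)"
proof (rule reg_tail_hazard[OF _ _ _ h lam sv])
  interpret real_distribution N
    using assms(1,2) by (simp add: real_distribution_def real_distribution_axioms_def)
  show "antimono (\<lambda>t. 1 - cdf N t)" by (auto simp: monotone_def cdf_nondecreasing)
  \<comment> \<open>\<open>is_hazard_rate\<close> gives a positive tail only for large arguments;
    monotonicity extends this to all \<open>t\<close>.\<close>
  show "0 < 1 - cdf N t" for t
  proof -
    obtain s where "s \<ge> t" "cdf N s < 1"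
      using eventually_happens[OF eventually_conj[OF haz[unfolded is_hazard_rate_def] eventually_ge_at_top[of t]]]
      by auto
    then show ?thesis using cdf_nondecreasing[of t s] by linarith
  qed
  show "\<forall>\<^sub>F t in at_top. ((\<lambda>t. 1 - cdf N t) has_real_derivative - (h t * (1 - cdf N t))) (at t)"
    using haz unfolding is_hazard_rate_def
    by eventually_elim (auto intro!: derivative_eq_intros)
qed

lemma Mbar_scale:
  assumes "prob_space K" "sets K = sets borel" "a > 0"
  shows "Mbar K (a * b) t = Mbar K b (t / a)"
  unfolding Mbar_eq_measure[OF assms(1,2)] using assms(3)
  by (simp add: pos_divide_less_eq mult_ac)

lemma higher_deriv_ultimately_zero:
  assumes "\<And>t. t > a \<Longrightarrow> f t = (0::real)"
  shows "t > a \<Longrightarrow> (deriv ^^ j) f t = 0"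
proof (induction j arbitrary: t)
  case (Suc j)
  have "\<forall>\<^sub>F x in nhds t. (deriv ^^ j) f x = 0"
    using eventually_nhds_in_open[of "{a<..}" t] Suc by (auto elim: eventually_mono)
  from deriv_cong_ev[OF this refl] show ?case by simp
qed (use assms in simp)

lemma ln_over_self_power_bigomega:
  "(\<lambda>t. exp (- (real k * ln t))) \<in> O(\<lambda>t. (ln t / t) ^ k)"
proof (rule bigoI[where c=1])
  have "\<forall>\<^sub>F t::real in at_top. 1 / t \<le> ln t / t" by real_asymp
  then show "\<forall>\<^sub>F t in at_top. norm (exp (- (real k * ln t))) \<le> 1 * norm ((ln t / t) ^ k)"
    using eventually_gt_at_top[of 1]
  proof eventually_elim
    case (elim t)
    have "exp (- (real k * ln t)) = (1 / t) ^ k"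
      using elim(2) by (simp add: exp_minus exp_of_nat_mult power_one_over inverse_eq_divide)
    also have "\<dots> \<le> (ln t / t) ^ k" using elim by (intro power_mono) auto
    finally show ?case by simp
  qed
qed

text \<open>\<open>eff a\<close> is the size of the weight \<open>a\<close> as seen by the upper tail: \<open>\<bar>a\<bar>\<close> if \<open>F\<close> is tail balanced,
  and \<open>max a 0\<close> if \<open>F\<close> vanishes near \<open>-\<infinity>\<close>.\<close>
locale tail_ordering =
  fixes K :: "real measure" and lam :: real and m :: nat and eff :: "real \<Rightarrow> real" and C s0 :: real
  assumes K: "prob_space K" "sets K = sets borel" and lam: "lam > 0" and m: "m > 0"
    and T: "reg_tail lam m (Mbar K 1)"
    and eff_pos: "\<And>a. eff a > 0 \<Longrightarrow> eff a = \<bar>a\<bar> \<and> reg_tail lam m (Mbar K a)"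
    and eff_nonneg: "\<And>a. eff a \<ge> 0"
    and eff_mult: "\<And>a b. b > 0 \<Longrightarrow> eff (a * b) = eff a * b"
    and C: "C > 0" and s0: "s0 \<ge> 0"
    and compare: "\<And>a t. eff a > 0 \<Longrightarrow> t \<ge> s0 * \<bar>a\<bar> \<Longrightarrow>
      Mbar K a t \<le> C * Mbar K 1 (t / \<bar>a\<bar>) \<and> Mbar K 1 (t / \<bar>a\<bar>) \<le> C * Mbar K a t"
    and zero: "\<And>a t. eff a = 0 \<Longrightarrow> t \<ge> s0 * \<bar>a\<bar> \<Longrightarrow> Mbar K a t = 0"
begin

lemma T_pos: "Mbar K 1 t > 0"
  by (rule reg_tail_pos[OF T lam m])

lemma Mbar_pos: "eff a > 0 \<Longrightarrow> Mbar K a t > 0"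
  using eff_pos reg_tail_pos[OF _ lam m] by blast

lemma Mbar_zero: "eff a = 0 \<Longrightarrow> \<forall>\<^sub>F t in at_top. Mbar K a t = 0"
  using eventually_ge_at_top[of "s0 * \<bar>a\<bar>"] by eventually_elim (rule zero)

lemma Mbar_bigtheta:
  assumes "eff a > 0"
  shows "Mbar K a \<in> O(\<lambda>t. Mbar K 1 (t / \<bar>a\<bar>))" and "(\<lambda>t. Mbar K 1 (t / \<bar>a\<bar>)) \<in> O(Mbar K a)"
proof -
  have ev: "\<forall>\<^sub>F t in at_top. Mbar K a t \<le> C * Mbar K 1 (t / \<bar>a\<bar>) \<and> Mbar K 1 (t / \<bar>a\<bar>) \<le> C * Mbar K a t"
    using eventually_ge_at_top[of "s0 * \<bar>a\<bar>"] by eventually_elim (rule compare[OF assms])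
  show "Mbar K a \<in> O(\<lambda>t. Mbar K 1 (t / \<bar>a\<bar>))"
    by (rule bigoI[where c=C]) (use ev in eventually_elim, use T_pos Mbar_pos[OF assms] in \<open>simp add: abs_of_pos\<close>)
  show "(\<lambda>t. Mbar K 1 (t / \<bar>a\<bar>)) \<in> O(Mbar K a)"
    by (rule bigoI[where c=C]) (use ev in eventually_elim, use T_pos Mbar_pos[OF assms] in \<open>simp add: abs_of_pos\<close>)
qed

text \<open>By the ratio bound with \<open>\<mu> < lam\<close>, passing from the weight
  \<open>b\<close> to \<open>a\<close> costs a constant times \<open>t\<close> to the power
  \<open>- \<mu> * ln (b / a)\<close>. The strict inequality in the hypothesis leaves room for a
  \<open>\<mu>\<close> with which this beats the power \<open>- j\<close>.\<close>

lemma T_gap: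
  assumes "0 < a" "a < b" "real j < lam * ln (b / a)"
  shows "(\<lambda>t. Mbar K 1 (t / a)) \<in> o(\<lambda>t. (ln t / t) ^ j * Mbar K 1 (t / b))"
proof -
  define r where "r = ln (b / a)"
  have r: "r > 0" "r = ln b - ln a" using assms by (auto simp: r_def ln_div)
  define \<mu> where "\<mu> = (real j / r + lam) / 2"
  have jr: "real j / r < lam" using assms(3) r by (simp add: r_def[symmetric] pos_divide_less_eq)
  have \<mu>: "\<mu> < lam" "real j < \<mu> * r" "0 \<le> \<mu>"
  proof -
    have mid: "x < (x + lam) / 2 \<and> (x + lam) / 2 < lam" if "x < lam" for x using that by simp
    show "\<mu> < lam" using mid[OF jr] unfolding \<mu>_def by simp
    have "real j / r < \<mu>" using mid[OF jr] unfolding \<mu>_def by blast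
    then show "real j < \<mu> * r" using r by (simp add: pos_divide_less_eq)
    show "0 \<le> \<mu>" unfolding \<mu>_def using r lam by simp
  qed
  obtain T0 where T0: "T0 \<ge> 1" "\<And>t s. t \<ge> T0 \<Longrightarrow> s \<ge> t \<Longrightarrow>
      Mbar K 1 s \<le> Mbar K 1 t * exp (- (\<mu> / 2 * ((ln s)\<^sup>2 - (ln t)\<^sup>2)))"
    using reg_tail_ratio_lower[OF T lam m \<mu>(1)] by blast
  define c where "c = \<mu> / 2 * r * (ln a + ln b)"
  have "(\<lambda>t. Mbar K 1 (t / a)) \<in> O(\<lambda>t. exp (- (\<mu> * r * ln t)) * Mbar K 1 (t / b))"
  proof (rule bigoI[where c = "exp c"])
    show "\<forall>\<^sub>F t in at_top. norm (Mbar K 1 (t / a)) \<le> exp c * norm (exp (- (\<mu> * r * ln t)) * Mbar K 1 (t / b))"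
      using eventually_ge_at_top[of "T0 * b"] eventually_gt_at_top[of 0]
    proof eventually_elim
      case (elim t)
      have "t / b \<ge> T0" using elim assms by (simp add: pos_le_divide_eq)
      moreover have "t / a \<ge> t / b" using elim assms by (intro divide_left_mono) auto
      ultimately have "Mbar K 1 (t / a) \<le> Mbar K 1 (t / b) * exp (- (\<mu> / 2 * ((ln (t / a))\<^sup>2 - (ln (t / b))\<^sup>2)))"
        by (rule T0(2))
      also have "- (\<mu> / 2 * ((ln (t / a))\<^sup>2 - (ln (t / b))\<^sup>2)) = c + - (\<mu> * r * ln t)"
        using elim assms unfolding c_def r(2) by (simp add: ln_div power2_eq_square field_simps)
      finally show ?case using T_pos unfolding exp_add by (simp add: abs_of_pos mult_ac)
    qed
  qed
  also have "(\<lambda>t. exp (- (\<mu> * r * ln t)) * Mbar K 1 (t / b)) \<in> o(\<lambda>t. (ln t / t) ^ j * Mbar K 1 (t / b))"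
  proof (rule landau_o.small_big_mult[OF _ landau_o.big_refl])
    have "(\<lambda>t. exp (- (\<mu> * r * ln t))) \<in> o(\<lambda>t::real. exp (- (real j * ln t)))"
      using \<mu>(2) by real_asymp
    also note ln_over_self_power_bigomega
    finally show "(\<lambda>t. exp (- (\<mu> * r * ln t))) \<in> o(\<lambda>t. (ln t / t) ^ j)" .
  qed
  finally show ?thesis .
qed

lemma Mbar_gap:
  assumes "eff b > 0" "eff a < eff b" "eff a > 0 \<Longrightarrow> real j < lam * ln (\<bar>b\<bar> / \<bar>a\<bar>)"
  shows "Mbar K a \<in> o(\<lambda>t. (ln t / t) ^ j * Mbar K b t)"
proof (cases "eff a > 0")
  case True
  note Mbar_bigtheta(1)[OF True]
  also have "(\<lambda>t. Mbar K 1 (t / \<bar>a\<bar>)) \<in> o(\<lambda>t. (ln t / t) ^ j * Mbar K 1 (t / \<bar>b\<bar>))"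
    using assms True eff_pos[OF True] eff_pos[OF assms(1)] by (intro T_gap) auto
  also have "(\<lambda>t. (ln t / t) ^ j * Mbar K 1 (t / \<bar>b\<bar>)) \<in> O(\<lambda>t. (ln t / t) ^ j * Mbar K b t)"
    by (intro landau_o.big.mult Mbar_bigtheta assms) simp
  finally show ?thesis .
next
  case False
  then have "eff a = 0" using eff_nonneg[of a] by linarith
  from landau_o.small.in_cong[OF Mbar_zero[OF this]] show ?thesis by simp
qed

text \<open>Unequal sizes give strict negligibility, by \<open>Mbar_gap\<close> with
  \<open>j = 0\<close>; equal positive sizes give ratios between \<open>1 / C\<^sup>2\<close> and
  \<open>C\<^sup>2\<close>. A relation in the wrong direction would make a positive function
  negligible against itself.\<close>

lemma tail_preceq_iff: "tail_preceq K a b \<longleftrightarrow> eff a \<le> eff b"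
proof -
  have less: "Mbar K a \<in> o(Mbar K b)" if "eff a < eff b" for a b
  proof -
    have b: "eff b > 0" using that eff_nonneg[of a] by linarith
    have "real 0 < lam * ln (\<bar>b\<bar> / \<bar>a\<bar>)" if "eff a > 0"
      using that \<open>eff a < eff b\<close> eff_pos[OF b] eff_pos[OF that] lam by simp
    from Mbar_gap[OF b that this] show ?thesis by simp
  qed
  show ?thesis
  proof
    assume pre: "tail_preceq K a b"
    show "eff a \<le> eff b"
    proof (rule ccontr)
      assume "\<not> eff a \<le> eff b"
      then have lt: "eff b < eff a" by simp
      have "Mbar K a \<in> O(Mbar K b)"
        using pre unfolding tail_preceq_def
      proof
        assume "tail_prec K a b"
        then show ?thesis unfolding tail_prec_def by (rule landau_o.small_imp_big)
      next
        assume "tail_equiv K a b"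
        then obtain \<epsilon> where \<epsilon>: "\<epsilon> > 0" "\<forall>\<^sub>F t in at_top. \<epsilon> * Mbar K a t \<le> Mbar K b t \<and> Mbar K b t \<le> Mbar K a t / \<epsilon>"
          unfolding tail_equiv_def by blast
        show ?thesis
        proof (rule bigoI[where c = "1 / \<epsilon>"], use \<epsilon>(2) in eventually_elim)
          fix t assume "\<epsilon> * Mbar K a t \<le> Mbar K b t \<and> Mbar K b t \<le> Mbar K a t / \<epsilon>"
          then show "norm (Mbar K a t) \<le> 1 / \<epsilon> * norm (Mbar K b t)"
            using \<epsilon>(1) Mbar_eq_measure[OF K, of a t] Mbar_eq_measure[OF K, of b t] by (simp add: field_simps)
        qed
      qed
      also note less[OF lt]
      finally have "Mbar K a \<in> o(Mbar K a)" .
      moreover have "eff a > 0" using lt eff_nonneg[of b] by linarith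
      then have "Mbar K a t \<noteq> 0" for t using Mbar_pos[of a t] by simp
      ultimately show False by (simp add: landau_o.small_refl_iff)
    qed
  next
    assume le: "eff a \<le> eff b"
    show "tail_preceq K a b"
    proof (cases "eff a < eff b")
      case True
      then show ?thesis using less unfolding tail_preceq_def tail_prec_def by blast
    next
      case False
      with le have eq: "eff a = eff b" by simp
      have "tail_equiv K a b"
      proof (cases "eff a = 0")
        case True
        with eq have "\<forall>\<^sub>F t in at_top. Mbar K a t = 0" "\<forall>\<^sub>F t in at_top. Mbar K b t = 0"
          by (auto intro: Mbar_zero)
        then have "\<forall>\<^sub>F t in at_top. 1 * Mbar K a t \<le> Mbar K b t \<and> Mbar K b t \<le> Mbar K a t / 1"
          by eventually_elim simp
        then show ?thesis unfolding tail_equiv_def by (intro exI[of _ 1]) simp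
      next
        case False
        then have a: "eff a > 0" using eff_nonneg[of a] by linarith
        then have b: "eff b > 0" and ab: "\<bar>a\<bar> = \<bar>b\<bar>" using eq eff_pos[of a] eff_pos[of b] by auto
        have "\<forall>\<^sub>F t in at_top. 1 / C\<^sup>2 * Mbar K a t \<le> Mbar K b t \<and> Mbar K b t \<le> Mbar K a t / (1 / C\<^sup>2)"
          using eventually_ge_at_top[of "s0 * \<bar>a\<bar>"]
        proof eventually_elim
          case (elim t)
          have A: "Mbar K a t \<le> C * Mbar K 1 (t / \<bar>a\<bar>)" "Mbar K 1 (t / \<bar>a\<bar>) \<le> C * Mbar K a t"
            using compare[OF a elim] by auto
          have B: "Mbar K b t \<le> C * Mbar K 1 (t / \<bar>a\<bar>)" "Mbar K 1 (t / \<bar>a\<bar>) \<le> C * Mbar K b t"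
            using compare[OF b, of t] elim ab by auto
          have "Mbar K a t \<le> C * (C * Mbar K b t)" "Mbar K b t \<le> C * (C * Mbar K a t)"
            using order.trans[OF A(1) mult_left_mono[OF B(2)]] order.trans[OF B(1) mult_left_mono[OF A(2)]] C by auto
          then show ?case using C by (simp add: field_simps power2_eq_square)
        qed
        then show ?thesis unfolding tail_equiv_def using C by (intro exI[of _ "1 / C\<^sup>2"]) auto
      qed
      then show ?thesis unfolding tail_preceq_def ..
    qed
  qed
qed

text \<open>For large \<open>u\<close> the product \<open>u * Mbar K 1 u\<close> decreases. With
  \<open>u\<close> inversely proportional to a weight this yields a factor proportional to the
  weight, hence a convergent sum over infinitely many small weights.\<close>

lemma T_linear_decay: "\<exists>v0>0. \<forall>v\<ge>v0. \<forall>u\<ge>v. Mbar K 1 u \<le> v / u * Mbar K 1 v"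
proof -
  define \<mu> where "\<mu> = lam / 2"
  have \<mu>: "0 < \<mu>" "\<mu> < lam" using lam by (auto simp: \<mu>_def)
  obtain T0 where T0: "T0 \<ge> 1" "\<And>t s. t \<ge> T0 \<Longrightarrow> s \<ge> t \<Longrightarrow>
      Mbar K 1 s \<le> Mbar K 1 t * exp (- (\<mu> / 2 * ((ln s)\<^sup>2 - (ln t)\<^sup>2)))"
    using reg_tail_ratio_lower[OF T lam m \<mu>(2)] by blast
  \<comment> \<open>Beyond \<open>exp (1 / \<mu>)\<close> the mean of \<open>ln u\<close> and
    \<open>ln v\<close> is at least \<open>1 / \<mu>\<close>, which makes
    \<open>\<mu> / 2 * ((ln u)\<^sup>2 - (ln v)\<^sup>2)\<close> at least
    \<open>ln u - ln v\<close>.\<close>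
  have "Mbar K 1 u \<le> v / u * Mbar K 1 v" if v: "v \<ge> max T0 (exp (1 / \<mu>))" and u: "u \<ge> v" for u v
  proof -
    have v1: "v \<ge> 1" using v T0 by simp
    have "1 / \<mu> \<le> ln v" using v v1 by (simp add: ln_ge_iff)
    moreover have "ln v \<le> ln u" using u v1 by simp

    then have "ln v \<le> (ln u + ln v) / 2" by simp
    ultimately have "1 / \<mu> \<le> (ln u + ln v) / 2" by (rule order.trans)
    then have "\<mu> * (1 / \<mu>) \<le> \<mu> * ((ln u + ln v) / 2)" using \<mu> by (intro mult_left_mono) auto
    then have "1 \<le> \<mu> / 2 * (ln u + ln v)" using \<mu> by simp
    then have "(ln u - ln v) * 1 \<le> (ln u - ln v) * (\<mu> / 2 * (ln u + ln v))"
      using \<open>ln v \<le> ln u\<close> by (intro mult_left_mono) auto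
    also have "\<dots> = \<mu> / 2 * ((ln u)\<^sup>2 - (ln v)\<^sup>2)" by (simp add: power2_eq_square field_simps)
    finally have "exp (- (\<mu> / 2 * ((ln u)\<^sup>2 - (ln v)\<^sup>2))) \<le> exp (ln v - ln u)" by simp
    also have "\<dots> = v / u" using u v1 by (simp add: exp_diff)
    finally have "Mbar K 1 v * exp (- (\<mu> / 2 * ((ln u)\<^sup>2 - (ln v)\<^sup>2))) \<le> Mbar K 1 v * (v / u)"
      using T_pos[of v] by (intro mult_left_mono) auto
    with T0(2)[of v u] v u show ?thesis by (simp add: mult.commute)
  qed
  then show ?thesis using T0(1) by (intro exI[of _ "max T0 (exp (1 / \<mu>))"]) auto
qed

text \<open>Against the tail of \<open>b\<close>, that of \<open>a\<close> is smaller by roughly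
  \<open>t\<close> to the power \<open>lam * ln \<bar>b / a\<bar>\<close>. Derivatives of order
  \<open>j\<close> with \<open>j + lam * ln \<bar>b / a\<bar> > k\<close> are therefore absorbed by
  the error, and the floor keeps exactly the others.\<close>

lemma laplace_expansion:
  assumes \<nu>: "prob_space \<nu>" "sets \<nu> = sets borel" "\<And>p. integrable \<nu> (\<lambda>w. \<bar>w\<bar> ^ p)"
    and km: "k \<le> m" and a: "eff a \<le> eff b" "eff b * exp (- real k / lam) \<le> eff a" and b: "eff b > 0"
  shows "(\<lambda>t. (\<integral>w. indicator {..t/2} w * Mbar K a (t - w) \<partial>\<nu>)
      - laplace_char \<nu> (nat (int k + \<lfloor>lam * ln \<bar>a / b\<bar>\<rfloor>)) (Mbar K a) t)
    \<in> o(\<lambda>t. (ln t / t) ^ k * Mbar K b t)"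
proof -
  have a0: "eff a > 0" using a(2) b by (meson exp_gt_zero less_le_trans mult_pos_pos)
  have ea: "eff a = \<bar>a\<bar>" "reg_tail lam m (Mbar K a)" and eb: "eff b = \<bar>b\<bar>"
    using eff_pos[OF a0] eff_pos[OF b] by auto
  have pos: "\<bar>a\<bar> > 0" "\<bar>b\<bar> > 0" using a0 b ea eb by auto
  define n where "n = nat (int k + \<lfloor>lam * ln \<bar>a / b\<bar>\<rfloor>)"
  define P where "P = (\<lambda>t. \<integral>w. indicator {..t/2} w * Mbar K a (t - w) \<partial>\<nu>)"
  have E: "(\<lambda>t. P t - laplace_char \<nu> i (Mbar K a) t) \<in> o(\<lambda>t. (ln t / t) ^ i * Mbar K a t)" if "i \<le> m" for i
    unfolding P_def by (rule reg_tail_expansion[OF ea(2) lam m that \<nu>])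
  have "(\<lambda>t. P t - laplace_char \<nu> n (Mbar K a) t) \<in> o(\<lambda>t. (ln t / t) ^ k * Mbar K b t)"
  proof (cases "eff a = eff b")
    case True
    then have "\<bar>a / b\<bar> = 1" using ea eb pos by simp
    then have n: "n = k" unfolding n_def by simp
    have "Mbar K a \<in> O(Mbar K b)"
      using landau_o.big_trans[OF Mbar_bigtheta(1)[OF a0]] Mbar_bigtheta(2)[OF b] True ea eb by simp
    then have "(\<lambda>t. (ln t / t) ^ k * Mbar K a t) \<in> O(\<lambda>t. (ln t / t) ^ k * Mbar K b t)"
      by (intro landau_o.big.mult) simp
    with E[OF km] show ?thesis unfolding n by (rule landau_o.small_big_trans)
  next
    case False
    with a have lt: "\<bar>a\<bar> < \<bar>b\<bar>" using ea eb by simp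
    define x where "x = lam * ln \<bar>a / b\<bar>"
    have "ln (\<bar>a\<bar> / \<bar>b\<bar>) < 0" using lt pos by simp
    then have x0: "x < 0" unfolding x_def abs_divide using lam by (simp add: mult_less_0_iff)
    have "- real k / lam \<le> ln (\<bar>a\<bar> / \<bar>b\<bar>)"
    proof -
      have "exp (- real k / lam) \<le> \<bar>a\<bar> / \<bar>b\<bar>" using a(2) ea eb pos by (simp add: pos_le_divide_eq mult.commute)
      then show ?thesis using pos by (subst ln_ge_iff) auto
    qed
    then have "lam * (- real k / lam) \<le> lam * ln (\<bar>a\<bar> / \<bar>b\<bar>)" using lam by (intro mult_left_mono) auto
    then have xk: "- real k \<le> x" unfolding x_def abs_divide using lam by simp
    have n: "real n \<le> real k + x" "real k + x < real n + 1" "n < k"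
    proof -
      \<comment> \<open>The lower bound on \<open>eff a\<close> keeps the integer nonnegative, so
        the conversion by \<open>nat\<close> loses nothing.\<close>
      have "\<lfloor>x\<rfloor> \<ge> - int k" using xk by (simp add: le_floor_iff)
      then have nn: "int n = int k + \<lfloor>x\<rfloor>" unfolding n_def x_def by simp
      then have "real_of_int (int n) = real k + real_of_int \<lfloor>x\<rfloor>" by simp
      then show "real n \<le> real k + x" "real k + x < real n + 1" by linarith+
      then show "n < k" using x0 by linarith
    qed
    \<comment> \<open>Here \<open>o((ln t / t)\<^sup>n f)\<close> is too weak: one more term is expanded, and then dropped.\<close>
    define j where "j = k - Suc n"
    have kj: "k = Suc n + j" unfolding j_def using n(3) by simp
    have "real j < lam * ln (\<bar>b\<bar> / \<bar>a\<bar>)"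
    proof -
      have "ln (\<bar>b\<bar> / \<bar>a\<bar>) = - ln \<bar>a / b\<bar>" using pos by (simp add: ln_div abs_divide)
      then have "lam * ln (\<bar>b\<bar> / \<bar>a\<bar>) = - x" unfolding x_def by simp
      then show ?thesis using n(2) kj by simp
    qed
    with Mbar_gap[OF b, of a j] lt ea eb have "Mbar K a \<in> o(\<lambda>t. (ln t / t) ^ j * Mbar K b t)" by simp
    then have gap: "(\<lambda>t. (ln t / t) ^ Suc n * Mbar K a t) \<in> o(\<lambda>t. (ln t / t) ^ Suc n * ((ln t / t) ^ j * Mbar K b t))"
      by (rule landau_o.small.mult_left)
    have nm: "Suc n \<le> m" using n(3) km by simp
    define d where "d = (-1) ^ Suc n / fact (Suc n) * integral\<^sup>L \<nu> (\<lambda>x. x ^ Suc n)"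
    have split: "P t - laplace_char \<nu> n (Mbar K a) t
        = (P t - laplace_char \<nu> (Suc n) (Mbar K a) t) + d * (deriv ^^ Suc n) (Mbar K a) t" for t
      unfolding laplace_char_def d_def by (simp only: sum.atMost_Suc diff_diff_eq2 diff_add_eq)
    have "(\<lambda>t. d * (deriv ^^ Suc n) (Mbar K a) t) \<in> O(\<lambda>t. (ln t / t) ^ Suc n * Mbar K a t)"
    proof -
      have "(deriv ^^ Suc n) (Mbar K a) \<in> O(\<lambda>t. (- (lam * ln t / t)) ^ Suc n * Mbar K a t)"
        using ea(2) nm unfolding reg_tail_def by (intro asymp_equiv_imp_bigo) blast
      also have "(\<lambda>t. (- (lam * ln t / t)) ^ Suc n * Mbar K a t) = (\<lambda>t. (- lam) ^ Suc n * ((ln t / t) ^ Suc n * Mbar K a t))"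
        unfolding mult.assoc[symmetric] power_mult_distrib[symmetric] by simp
      also have "\<dots> \<in> O(\<lambda>t. (ln t / t) ^ Suc n * Mbar K a t)"
        by (rule bigoI[where c="\<bar>(- lam) ^ Suc n\<bar>"]) (auto simp: abs_mult simp del: power_Suc)
      finally have 1: "(deriv ^^ Suc n) (Mbar K a) \<in> O(\<lambda>t. (ln t / t) ^ Suc n * Mbar K a t)" .
      have "(\<lambda>t. d * (deriv ^^ Suc n) (Mbar K a) t) \<in> O((deriv ^^ Suc n) (Mbar K a))"
        by (rule bigoI[where c="\<bar>d\<bar>"]) (auto simp: abs_mult simp del: funpow.simps)
      from landau_o.big_trans[OF this 1] show ?thesis .
    qed
    then have "(\<lambda>t. P t - laplace_char \<nu> n (Mbar K a) t) \<in> O(\<lambda>t. (ln t / t) ^ Suc n * Mbar K a t)"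
      unfolding split by (intro sum_in_bigo landau_o.small_imp_big[OF E[OF nm]])
    also note gap
    also have "(\<lambda>t. (ln t / t) ^ Suc n * ((ln t / t) ^ j * Mbar K b t)) = (\<lambda>t. (ln t / t) ^ k * Mbar K b t)"
      unfolding kj power_add by (simp only: mult.assoc)
    finally show ?thesis .
  qed
  then show ?thesis unfolding n_def P_def .
qed

end

section \<open>The tail expansion\<close>

context weighted_sum
begin

text \<open>Because the weights tend to 0, the sizes outside \<open>I\<close> are bounded by some
  \<open>\<beta>\<close> strictly below the threshold. This room permits lowering the level from
  \<open>t\<close> to \<open>(1 - \<eta>) * t\<close>, and \<open>T_linear_decay\<close> allows the
  union bound over all remaining weights.\<close>

lemma small_weights:
  fixes k :: nat
  assumes ord: "tail_ordering (distr M borel (X 0)) lam m eff C s0"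
    and c0: "filterlim c (nhds 0) cofinite" and b: "eff (c i1) > 0"
  defines "I \<equiv> {i. eff (c i1) * exp (- real k / lam) \<le> eff (c i)}"
  shows "finite I"
    and "\<exists>\<eta>>0. \<eta> \<le> 1 / 2 \<and> (\<lambda>t. prob {\<omega> \<in> space M. \<exists>i. i \<notin> I \<and> c i * X i \<omega> > (1 - \<eta>) * t})
      \<in> o(\<lambda>t. (ln t / t) ^ k * Mbar (distr M borel (X 0)) (c i1) t)"
proof -
  interpret tail_ordering "distr M borel (X 0)" lam m eff C s0 by fact
  let ?K = "distr M borel (X 0)"
  define A where "A = eff (c i1) * exp (- real k / lam)"
  have A: "A > 0" unfolding A_def using b by simp
  have eff_le: "eff a \<le> \<bar>a\<bar>" for a using eff_pos[of a] eff_nonneg[of a] by (cases "eff a = 0") auto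
  have fin: "finite {i. e \<le> \<bar>c i\<bar>}" if "e > 0" for e
  proof -
    have "\<forall>\<^sub>F i in cofinite. dist (c i) 0 < e" using c0 that by (rule tendstoD)
    then show ?thesis by (simp add: eventually_cofinite not_less)
  qed
  have "I \<subseteq> {i. A \<le> \<bar>c i\<bar>}" unfolding I_def A_def[symmetric] using eff_le order.trans by blast
  then show "finite I" using fin[OF A] finite_subset by blast
  \<comment> \<open>Only these finitely many weights outside \<open>I\<close> can come close to the
    threshold \<open>A\<close>; the others have size below \<open>A / 2\<close>.\<close>
  define J where "J = {i. i \<notin> I \<and> A / 2 \<le> \<bar>c i\<bar>}"
  have J: "finite J" unfolding J_def using fin[of "A / 2"] A by (auto intro: finite_subset[rotated])
  define \<beta> where "\<beta> = Max (insert (A / 2) ((\<lambda>i. eff (c i)) ` J))"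
  have \<beta>0: "A / 2 \<le> \<beta>" unfolding \<beta>_def using J by (intro Max_ge) auto
  have "eff (c i) < A" if "i \<in> J" for i
    using that unfolding J_def I_def A_def by (simp add: not_le)
  then have \<beta>A: "\<beta> < A" unfolding \<beta>_def using J A by (subst Max_less_iff) auto
  have \<beta>: "eff (c i) \<le> \<beta>" if "i \<notin> I" for i
  proof (cases "A / 2 \<le> \<bar>c i\<bar>")
    case True
    then show ?thesis unfolding \<beta>_def using J that by (intro Max_ge) (auto simp: J_def)
  next
    case False
    then show ?thesis using eff_le[of "c i"] \<beta>0 by linarith
  qed
  have \<beta>pos: "\<beta> > 0" using \<beta>0 A by linarith
  \<comment> \<open>The midpoint of \<open>\<beta> / A\<close> and 1: it gives
    \<open>\<beta> / \<rho> < A\<close>, while \<open>\<eta> = 1 - \<rho>\<close> stays at most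
    1/2.\<close>
  define \<rho> where "\<rho> = (1 + \<beta> / A) / 2"
  have \<rho>: "1 / 2 \<le> \<rho>" "\<rho> < 1" "\<beta> / \<rho> < A" "\<rho> > 0"
  proof -
    have "0 < \<beta> / A" "\<beta> / A < 1" using \<beta>pos A \<beta>A by auto
    then show "1 / 2 \<le> \<rho>" "\<rho> < 1" "\<rho> > 0" unfolding \<rho>_def by auto
    moreover have "\<beta> < A * \<rho>" unfolding \<rho>_def using A \<beta>A by (simp add: field_simps)
    ultimately show "\<beta> / \<rho> < A" by (simp add: pos_divide_less_eq)
  qed
  obtain v0 where v0: "v0 > 0" "\<And>v u. v \<ge> v0 \<Longrightarrow> u \<ge> v \<Longrightarrow> Mbar ?K 1 u \<le> v / u * Mbar ?K 1 v"
    using T_linear_decay by blast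
  let ?N = "\<lambda>t. prob {\<omega> \<in> space M. \<exists>i. i \<notin> I \<and> c i * X i \<omega> > (1 - (1 - \<rho>)) * t}"
  have "?N \<in> O(\<lambda>t. Mbar ?K 1 (t / (\<beta> / \<rho>)))"
  proof (rule bigoI[where c = "c_norm * (C / \<beta>)"])
    have e1: "\<forall>\<^sub>F t::real in at_top. \<rho> * t \<ge> s0 * c_norm"
      by (rule eventually_mono[OF eventually_ge_at_top[of "s0 * c_norm / \<rho>"]])
        (use \<rho>(4) in \<open>simp add: pos_divide_le_eq mult.commute\<close>)
    have e2: "\<forall>\<^sub>F t::real in at_top. \<rho> * t / \<beta> \<ge> v0"
      using \<rho>(4) \<beta>pos by real_asymp
    show "\<forall>\<^sub>F t in at_top. norm (?N t) \<le> c_norm * (C / \<beta>) * norm (Mbar ?K 1 (t / (\<beta> / \<rho>)))"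
      using e1 e2 eventually_gt_at_top[of 0]
    proof eventually_elim
      case (elim t)
      define q where "q = C / \<beta> * Mbar ?K 1 (\<rho> * t / \<beta>)"
      have q: "q \<ge> 0" unfolding q_def using C \<beta>pos T_pos[of "\<rho> * t / \<beta>"] by simp
      define S where "S = (\<lambda>i. if i \<in> I then {} else {\<omega> \<in> space M. c i * X i \<omega> > \<rho> * t})"
      have S: "prob (S i) \<le> \<bar>c i\<bar> * q" for i
      proof (cases "i \<in> I")
        case True
        then show ?thesis using q by (simp add: S_def)
      next
        case False
        have "s0 * \<bar>c i\<bar> \<le> s0 * c_norm" using s0 by (intro mult_left_mono c_le)
        with elim have le: "s0 * \<bar>c i\<bar> \<le> \<rho> * t" by linarith
        have "Mbar ?K (c i) (\<rho> * t) \<le> \<bar>c i\<bar> * q"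
        proof (cases "eff (c i) = 0")
          case True
          then show ?thesis using zero[OF True le] q by simp
        next
          case nz: False
          then have pos: "eff (c i) > 0" using eff_nonneg[of "c i"] by linarith
          then have ci: "\<bar>c i\<bar> > 0" "\<bar>c i\<bar> \<le> \<beta>" using eff_pos[OF pos] \<beta>[OF False] by auto
          have "Mbar ?K (c i) (\<rho> * t) \<le> C * Mbar ?K 1 (\<rho> * t / \<bar>c i\<bar>)" using compare[OF pos le] by simp
          also have "Mbar ?K 1 (\<rho> * t / \<bar>c i\<bar>) \<le> (\<rho> * t / \<beta>) / (\<rho> * t / \<bar>c i\<bar>) * Mbar ?K 1 (\<rho> * t / \<beta>)"
            using elim ci \<rho> \<beta>pos by (intro v0(2) divide_left_mono) auto
          also have "(\<rho> * t / \<beta>) / (\<rho> * t / \<bar>c i\<bar>) = \<bar>c i\<bar> / \<beta>" using elim \<rho> by simp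
          finally show ?thesis unfolding q_def using C by (simp add: mult_ac)
        qed
        then show ?thesis using False Mbar_X[of "c i" "\<rho> * t" i] by (simp add: S_def)
      qed
      have "prob (\<Union>i. S i) \<le> c_norm * q"
      proof (rule prob_UN_le[OF _ S])
        show "S i \<in> events" for i unfolding S_def by simp
        show "(\<Sum>i\<in>F. \<bar>c i\<bar> * q) \<le> c_norm * q" if "finite F" for F
          unfolding sum_distrib_right[symmetric] using sum_c_le[OF that] q by (rule mult_right_mono)
      qed
      also have "(\<Union>i. S i) = {\<omega> \<in> space M. \<exists>i. i \<notin> I \<and> c i * X i \<omega> > (1 - (1 - \<rho>)) * t}"
        unfolding S_def by (auto split: if_splits)
      finally show ?case
        using T_pos[of "\<rho> * t / \<beta>"] unfolding q_def by (simp add: abs_of_pos mult_ac)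
    qed
  qed
  \<comment> \<open>Taking logarithms, \<open>\<beta> / \<rho> < A\<close> says that
    \<open>k < lam * ln (\<bar>c i1\<bar> / (\<beta> / \<rho>))\<close>, the gap that
    \<open>T_gap\<close> demands.\<close>
  also have "(\<lambda>t. Mbar ?K 1 (t / (\<beta> / \<rho>))) \<in> o(\<lambda>t. (ln t / t) ^ k * Mbar ?K 1 (t / \<bar>c i1\<bar>))"
  proof (rule T_gap)
    have e: "eff (c i1) = \<bar>c i1\<bar>" using eff_pos[OF b] by simp
    then have ci: "\<bar>c i1\<bar> > 0" using b by simp
    show 0: "0 < \<beta> / \<rho>" using \<beta>pos \<rho> by simp
    have "exp (- real k / lam) \<le> 1" using lam by simp
    then have "A \<le> \<bar>c i1\<bar> * 1" unfolding A_def e by (intro mult_left_mono) auto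
    with \<rho>(3) show "\<beta> / \<rho> < \<bar>c i1\<bar>" by simp
    have "\<beta> / \<rho> < \<bar>c i1\<bar> * exp (- (real k / lam))" using \<rho>(3) unfolding A_def e by simp
    then have "exp (real k / lam) < \<bar>c i1\<bar> / (\<beta> / \<rho>)"
      using 0 unfolding pos_less_divide_eq[OF 0] by (simp add: exp_minus field_simps)
    then have "ln (exp (real k / lam)) < ln (\<bar>c i1\<bar> / (\<beta> / \<rho>))"
      using 0 by (intro ln_strict_mono) auto
    then have "real k / lam < ln (\<bar>c i1\<bar> / (\<beta> / \<rho>))" by (simp only: ln_exp)
    then show "real k < lam * ln (\<bar>c i1\<bar> / (\<beta> / \<rho>))" using lam by (simp add: pos_divide_less_eq mult.commute)
  qed
  also have "(\<lambda>t. (ln t / t) ^ k * Mbar ?K 1 (t / \<bar>c i1\<bar>)) \<in> O(\<lambda>t. (ln t / t) ^ k * Mbar ?K (c i1) t)"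
    by (intro landau_o.big.mult Mbar_bigtheta b) simp
  finally show "\<exists>\<eta>>0. \<eta> \<le> 1 / 2 \<and> (\<lambda>t. prob {\<omega> \<in> space M. \<exists>i. i \<notin> I \<and> c i * X i \<omega> > (1 - \<eta>) * t})
      \<in> o(\<lambda>t. (ln t / t) ^ k * Mbar (distr M borel (X 0)) (c i1) t)"
    using \<rho> by (intro exI[of _ "1 - \<rho>"]) auto
qed

lemma tail_expansion:
  fixes k :: nat
  assumes ord: "tail_ordering (distr M borel (X 0)) lam m eff C s0" and \<kappa>0: "\<kappa>0 = lam / 2"
    and c0: "filterlim c (nhds 0) cofinite" and b: "eff (c i1) > 0"
    and max: "\<And>i. eff (c i) \<le> eff (c i1)" and km: "k \<le> m"
  defines "I \<equiv> {i. eff (c i1) * exp (- real k / lam) \<le> eff (c i)}"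
  shows "(\<lambda>t. prob {\<omega> \<in> space M. part UNIV \<omega> > t}
      - (\<Sum>i\<in>I. laplace_char (distr M borel (part (UNIV - {i}))) (nat (int k + \<lfloor>lam * ln \<bar>c i / c i1\<bar>\<rfloor>))
          (Mbar (distr M borel (X 0)) (c i)) t))
    \<in> o(\<lambda>t. (ln t / t) ^ k * Mbar (distr M borel (X 0)) (c i1) t)"
proof -
  interpret tail_ordering "distr M borel (X 0)" lam m eff C s0 by fact
  let ?K = "distr M borel (X 0)"
  let ?g = "\<lambda>t. (ln t / t) ^ k * Mbar ?K (c i1) t"
  define P where "P = (\<lambda>i t. prob {\<omega> \<in> space M. part UNIV \<omega> > t \<and> part (UNIV - {i}) \<omega> \<le> t / 2})"
  define H where "H = (\<lambda>i. laplace_char (distr M borel (part (UNIV - {i}))) (nat (int k + \<lfloor>lam * ln \<bar>c i / c i1\<bar>\<rfloor>)) (Mbar ?K (c i)))"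
  have I: "finite I" unfolding I_def by (rule small_weights(1)[OF ord c0 b])
  obtain \<eta> where \<eta>: "\<eta> > 0" "\<eta> \<le> 1 / 2"
    and N: "(\<lambda>t. prob {\<omega> \<in> space M. \<exists>i. i \<notin> I \<and> c i * X i \<omega> > (1 - \<eta>) * t}) \<in> o(?g)"
    using small_weights(2)[OF ord c0 b, of k] unfolding I_def by blast
  \<comment> \<open>Below \<open>lam = 2 * \<kappa>0\<close>, as \<open>one_big_jump\<close>
    requires, and above the constant \<open>3/4 * lam\<close> of the lower bound for the leading
    tail used next; the difference swallows the power of \<open>t\<close>.\<close>
  define \<kappa> where "\<kappa> = 9 / 10 * lam"
  obtain R where R: "R \<in> O(\<lambda>t. exp (- (\<kappa> * (ln t)\<^sup>2)))"
    and jump: "\<forall>\<^sub>F t in at_top. \<bar>prob {\<omega> \<in> space M. part UNIV \<omega> > t} - (\<Sum>i\<in>I. P i t)\<bar>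
      \<le> (real (card I) + 1) * (R t + prob {\<omega> \<in> space M. \<exists>i. i \<notin> I \<and> c i * X i \<omega> > (1 - \<eta>) * t})"
    using one_big_jump[OF I \<eta>, of \<kappa>] lam unfolding P_def \<kappa>_def \<kappa>0 by auto
  have "R \<in> o(?g)"
  proof -
    note R
    also have "(\<lambda>t. exp (- (\<kappa> * (ln t)\<^sup>2))) \<in> o(\<lambda>t. exp (- (real k * ln t)) * exp (- (3 / 2 * lam / 2 * (ln t)\<^sup>2)))"
      unfolding \<kappa>_def using lam by real_asymp
    also have "(\<lambda>t. exp (- (real k * ln t)) * exp (- (3 / 2 * lam / 2 * (ln t)\<^sup>2))) \<in> O(?g)"
      using eff_pos[OF b] lam m by (intro landau_o.big.mult ln_over_self_power_bigomega reg_tail_bigomega_exp[where m=m]) auto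
    finally show ?thesis .
  qed
  from sum_in_smallo(1)[OF this N]
  have "(\<lambda>t. (real (card I) + 1) * (R t + prob {\<omega> \<in> space M. \<exists>i. i \<notin> I \<and> c i * X i \<omega> > (1 - \<eta>) * t})) \<in> o(?g)"
    by (subst landau_o.small.cmult_in_iff) (use of_nat_0_le_iff[of "card I"] in linarith)
  then have 1: "(\<lambda>t. prob {\<omega> \<in> space M. part UNIV \<omega> > t} - (\<Sum>i\<in>I. P i t)) \<in> o(?g)"
  proof (rule landau_o.big_small_trans[rotated])
    show "(\<lambda>t. prob {\<omega> \<in> space M. part UNIV \<omega> > t} - (\<Sum>i\<in>I. P i t))
      \<in> O(\<lambda>t. (real (card I) + 1) * (R t + prob {\<omega> \<in> space M. \<exists>i. i \<notin> I \<and> c i * X i \<omega> > (1 - \<eta>) * t}))"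
    proof (rule bigoI[where c=1], use jump in eventually_elim)
      case (elim t)
      then show ?case unfolding real_norm_def mult_1 by (rule order.trans[OF _ abs_ge_self])
    qed
  qed
  have 2: "(\<lambda>t. P i t - H i t) \<in> o(?g)" if "i \<in> I" for i
    unfolding P_def H_def prob_convolution
  proof (rule laplace_expansion[OF _ _ _ km max _ b])
    show "prob_space (distr M borel (part (UNIV - {i})))" by (rule prob_space_distr) measurable
    show "integrable (distr M borel (part (UNIV - {i}))) (\<lambda>w. \<bar>w\<bar> ^ p)" for p
      by (subst integrable_distr_eq) (auto intro: part_power_integrable)
    show "eff (c i1) * exp (- real k / lam) \<le> eff (c i)" using that unfolding I_def by simp
  qed simp
  have "(\<lambda>t. (prob {\<omega> \<in> space M. part UNIV \<omega> > t} - (\<Sum>i\<in>I. P i t)) + (\<Sum>i\<in>I. P i t - H i t)) \<in> o(?g)"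
    by (intro sum_in_smallo 1 big_sum_in_smallo 2)
  then show ?thesis unfolding sum_subtractf H_def by simp
qed

text \<open>Serves the degenerate case in which no weight reaches an unbounded tail: each term is
  almost surely at most \<open>s0 * \<bar>c i\<bar>\<close>, hence the sum at most
  \<open>s0 * c_norm\<close>.\<close>

lemma tail_ultimately_zero:
  assumes z: "\<And>i t. t \<ge> s0 * \<bar>c i\<bar> \<Longrightarrow> Mbar (distr M borel (X 0)) (c i) t = 0" and s0: "s0 \<ge> 0"
    and t: "t \<ge> s0 * c_norm"
  shows "prob {\<omega> \<in> space M. part UNIV \<omega> > t} = 0"
proof -
  have "AE \<omega> in M. c i * X i \<omega> \<le> s0 * \<bar>c i\<bar>" for i
  proof -
    have "prob {\<omega> \<in> space M. c i * X i \<omega> > s0 * \<bar>c i\<bar>} = 0"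
      unfolding Mbar_X[symmetric] by (rule z) simp
    then have "AE \<omega> in M. \<not> c i * X i \<omega> > s0 * \<bar>c i\<bar>" by (subst AE_iff_measurable[OF _ refl]) (auto simp: emeasure_eq_measure)
    then show ?thesis by eventually_elim simp
  qed
  then have "AE \<omega> in M. \<forall>i. c i * X i \<omega> \<le> s0 * \<bar>c i\<bar>" by (simp add: AE_all_countable)
  with AE_summable have "AE \<omega> in M. \<not> part UNIV \<omega> > t"
  proof eventually_elim
    case (elim \<omega>)
    have "part UNIV \<omega> \<le> (\<Sum>\<^sub>\<infinity>i. s0 * \<bar>c i\<bar>)"
      unfolding part_def using elim by (intro infsum_mono summable_on_cmult_right c_summable) auto
    also have "\<dots> = s0 * c_norm" unfolding c_norm_def by (rule infsum_cmult_right')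
    finally show ?case using t by simp
  qed
  then have "emeasure M {\<omega> \<in> space M. \<not> \<not> part UNIV \<omega> > t} = 0" by (subst (asm) AE_iff_measurable[OF _ refl]) auto
  then show ?thesis by (simp add: measure_def)
qed

end

text \<open>If \<open>F\<close> vanishes near minus infinity, nonpositive weights have an ultimately
  vanishing tail, and \<open>max b 0\<close> works with \<open>C = 1\<close>. In the balanced case
  \<open>abs\<close> works: negative weights rescale \<open>Mbar K (-1)\<close>, which is regular by
  the hypotheses on the reflected hazard rate and comparable with \<open>Mbar K 1\<close> by
  balance.\<close>

lemma tail_ordering_exists:
  assumes K: "prob_space K" "sets K = sets borel" and haz: "is_hazard_rate (cdf K) h"
    and lam: "lam > 0" and h: "h \<sim>[at_top] (\<lambda>t. lam * ln t / t)"
    and m: "m > 0" and sv: "smoothly_varying (-1) m h"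
    and tails: "(\<exists>a. \<forall>t\<le>a. cdf K t = 0) \<or>
         ((\<exists>L>0. ((\<lambda>t. (1 - cdf K t) / cdf K (- t)) \<longlongrightarrow> L) at_top) \<and>
          (\<exists>hm. is_hazard_rate (cdf (distr K borel (\<lambda>x. (-1) * x))) hm
                \<and> hm \<sim>[at_top] (\<lambda>t. lam * ln t / t) \<and> smoothly_varying (-1) m hm))"
  shows "\<exists>eff C s0. tail_ordering K lam m eff C s0 \<and> Mbar K (-1) \<in> O(Mbar K 1)"
proof -
  interpret prob_space K by fact
  have sp: "space K = UNIV" using sets_eq_imp_space_eq[OF K(2)] by simp
  have [measurable]: "(\<lambda>x. c * x) \<in> borel_measurable K" for c :: real
    unfolding measurable_cong_sets[OF K(2) refl] by measurable
  have [measurable]: "A \<in> sets borel \<Longrightarrow> A \<in> sets K" for A using K(2) by simp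
  note Mb = Mbar_eq_measure[OF K]
  have Mbar1: "Mbar K 1 t = 1 - cdf K t" for t
  proof -
    have "Mbar K 1 t = prob (space K - {..t})" unfolding Mb by (rule arg_cong[where f=prob]) (auto simp: sp)
    also have "\<dots> = 1 - cdf K t" unfolding cdf_def by (rule prob_compl) simp
    finally show ?thesis .
  qed
  have T: "reg_tail lam m (Mbar K 1)"
    using is_hazard_rate_reg_tail[OF K haz h lam sv] unfolding Mbar1[abs_def] .
  have Mbar_pos_scale: "Mbar K a t = Mbar K 1 (t / a)" if "a > 0" for a t
    using Mbar_scale[OF K that, of 1] by simp
  have Mbar_neg_scale: "Mbar K a t = Mbar K (-1) (t / \<bar>a\<bar>)" if "a < 0" for a t
    using Mbar_scale[OF K, of "- a" "-1"] that by simp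
  have T_scale: "reg_tail lam m (Mbar K a)" if "a > 0" for a
    using reg_tail_scale[OF T that] by (simp add: Mbar_pos_scale[OF that, abs_def])
  from tails show ?thesis
  proof
    assume "\<exists>a. \<forall>t\<le>a. cdf K t = 0"
    then obtain a where a: "cdf K a = 0" by blast
    have zero: "Mbar K b t = 0" if "b \<le> 0" "t \<ge> \<bar>a\<bar> * \<bar>b\<bar>" for b t
    proof -
      have "{x. b * x > t} \<subseteq> {..a}"
      proof
        fix x assume "x \<in> {x. b * x > t}"
        then have "\<bar>b\<bar> * (- x) > \<bar>b\<bar> * \<bar>a\<bar>" using that by (simp add: mult.commute)
        then have "- x > \<bar>a\<bar>" using mult_left_mono[of "- x" "\<bar>a\<bar>" "\<bar>b\<bar>"] by linarith
        then show "x \<in> {..a}" by simp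
      qed
      then have "Mbar K b t \<le> cdf K a" unfolding Mb cdf_def by (intro finite_measure_mono) auto
      then show ?thesis using a by (simp add: Mb measure_le_0_iff)
    qed
    have "tail_ordering K lam m (\<lambda>b. max b 0) 1 \<bar>a\<bar>"
    proof
      show "max b 0 > 0 \<Longrightarrow> max b 0 = \<bar>b\<bar> \<and> reg_tail lam m (Mbar K b)" for b
        by (auto simp: less_max_iff_disj intro: T_scale)
      show "d > 0 \<Longrightarrow> max (b * d) 0 = max b 0 * d" for b d :: real
        by (auto simp: max_def mult_le_0_iff zero_le_mult_iff)
      show "max b 0 > 0 \<Longrightarrow> t \<ge> \<bar>a\<bar> * \<bar>b\<bar> \<Longrightarrow>
          Mbar K b t \<le> 1 * Mbar K 1 (t / \<bar>b\<bar>) \<and> Mbar K 1 (t / \<bar>b\<bar>) \<le> 1 * Mbar K b t" for b t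
        using Mbar_pos_scale[of b t] by (auto simp: less_max_iff_disj)
      show "max b 0 = 0 \<Longrightarrow> t \<ge> \<bar>a\<bar> * \<bar>b\<bar> \<Longrightarrow> Mbar K b t = 0" for b t
        by (rule zero) (auto simp: max_def split: if_splits)
    qed (use K lam m T in auto)
    moreover have "\<forall>\<^sub>F t in at_top. Mbar K (-1) t = 0"
      using eventually_ge_at_top[of "\<bar>a\<bar>"] by eventually_elim (rule zero, auto)
    then have "Mbar K (-1) \<in> O(Mbar K 1)" by (subst landau_o.big.in_cong) auto
    ultimately show ?thesis by blast
  next
    assume "(\<exists>L>0. ((\<lambda>t. (1 - cdf K t) / cdf K (- t)) \<longlongrightarrow> L) at_top) \<and>
          (\<exists>hm. is_hazard_rate (cdf (distr K borel (\<lambda>x. (-1) * x))) hm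
                \<and> hm \<sim>[at_top] (\<lambda>t. lam * ln t / t) \<and> smoothly_varying (-1) m hm)"
    then obtain L hm where L: "L > 0" "((\<lambda>t. (1 - cdf K t) / cdf K (- t)) \<longlongrightarrow> L) at_top"
      and hm: "is_hazard_rate (cdf (distr K borel (\<lambda>x. (-1) * x))) hm"
        "hm \<sim>[at_top] (\<lambda>t. lam * ln t / t)" "smoothly_varying (-1) m hm" by blast
    have Tm: "reg_tail lam m (Mbar K (-1))"
      unfolding Mbar_def[abs_def]
    proof (rule is_hazard_rate_reg_tail[OF _ _ hm(1,2) lam hm(3)])
      show "prob_space (distr K borel (\<lambda>x. (-1) * x))" by (rule prob_space_distr) measurable
    qed simp
    have "L / 2 < L" "L < 2 * L" using L by auto
    from order_tendstoD(1)[OF L(2) this(1)] order_tendstoD(2)[OF L(2) this(2)]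
    have r: "\<forall>\<^sub>F t in at_top. L / 2 < (1 - cdf K t) / cdf K (- t)" "\<forall>\<^sub>F t in at_top. (1 - cdf K t) / cdf K (- t) < 2 * L"
      by auto
    \<comment> \<open>Balance concerns the event \<open>X \<le> - t\<close>, whereas
      \<open>Mbar K (-1) t\<close> measures \<open>X < - t\<close>. A shift by 1 bridges the
      difference at the cost of a factor 2.\<close>
    have sh: "\<forall>\<^sub>F t in at_top. Mbar K (-1) (t - 1) / Mbar K (-1) t < 2"
      by (rule order_tendstoD(2)[OF reg_tail_shift(1)[OF Tm lam m]]) auto
    have "\<forall>\<^sub>F t in at_top. Mbar K 1 t \<le> 4 * L * Mbar K (-1) t \<and> Mbar K (-1) t \<le> 2 / L * Mbar K 1 t"
      using r sh
    proof eventually_elim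
      case (elim t)
      have "cdf K (- t) \<noteq> 0" using elim(1) L by auto
      then have F: "cdf K (- t) > 0" unfolding cdf_def using measure_nonneg[of K "{..- t}"] by linarith
      have 1: "Mbar K (-1) t \<le> cdf K (- t)" unfolding Mb cdf_def by (intro finite_measure_mono) auto
      have 2: "cdf K (- t) \<le> Mbar K (-1) (t - 1)" unfolding Mb cdf_def by (intro finite_measure_mono) auto
      have 3: "Mbar K (-1) (t - 1) < 2 * Mbar K (-1) t"
        using elim(3) reg_tail_pos[OF Tm lam m, of t] by (simp add: pos_divide_less_eq)
      have 4: "Mbar K 1 t < 2 * L * cdf K (- t)" "L / 2 * cdf K (- t) < Mbar K 1 t"
        using elim(1,2) F unfolding Mbar1 by (simp_all add: pos_divide_less_eq pos_less_divide_eq)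
      have "2 * L * cdf K (- t) \<le> 2 * L * (2 * Mbar K (-1) t)" using 2 3 L by (intro mult_left_mono) auto
      moreover have "Mbar K (-1) t \<le> 2 / L * Mbar K 1 t"
      proof -
        have "cdf K (- t) \<le> 2 / L * Mbar K 1 t" using 4(2) L by (simp add: field_simps)
        with 1 show ?thesis by linarith
      qed
      ultimately show ?case using 4 by simp
    qed
    then obtain s1 where s1: "\<And>t. t \<ge> s1 \<Longrightarrow> Mbar K 1 t \<le> 4 * L * Mbar K (-1) t \<and> Mbar K (-1) t \<le> 2 / L * Mbar K 1 t"
      by (auto simp: eventually_at_top_linorder)
    define C where "C = max 1 (max (4 * L) (2 / L))"
    have C: "C \<ge> 1" "C \<ge> 4 * L" "C \<ge> 2 / L" unfolding C_def by auto
    define s0 where "s0 = max 0 s1"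
    have cmp: "Mbar K 1 t \<le> C * Mbar K (-1) t \<and> Mbar K (-1) t \<le> C * Mbar K 1 t" if "t \<ge> s0" for t
    proof -
      have "4 * L * Mbar K (-1) t \<le> C * Mbar K (-1) t" "2 / L * Mbar K 1 t \<le> C * Mbar K 1 t"
        by (rule mult_right_mono[OF C(2) less_imp_le[OF reg_tail_pos[OF Tm lam m]]],
            rule mult_right_mono[OF C(3) less_imp_le[OF reg_tail_pos[OF T lam m]]])
      with s1[of t] that show ?thesis unfolding s0_def by force
    qed
    have "tail_ordering K lam m abs C s0"
    proof
      show "\<bar>b\<bar> > 0 \<Longrightarrow> \<bar>b\<bar> = \<bar>b\<bar> \<and> reg_tail lam m (Mbar K b)" for b
      proof (cases "b > 0")
        case True
        then show ?thesis using T_scale by simp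
      next
        case False
        moreover assume "\<bar>b\<bar> > 0"
        ultimately have "Mbar K b = (\<lambda>t. Mbar K (-1) (t / \<bar>b\<bar>))"
          by (intro ext Mbar_neg_scale) simp
        then show ?thesis using reg_tail_scale[OF Tm \<open>\<bar>b\<bar> > 0\<close>] by simp
      qed
      show "d > 0 \<Longrightarrow> \<bar>b * d\<bar> = \<bar>b\<bar> * d" for b d :: real by (simp add: abs_mult)
      show "Mbar K b t \<le> C * Mbar K 1 (t / \<bar>b\<bar>) \<and> Mbar K 1 (t / \<bar>b\<bar>) \<le> C * Mbar K b t"
        if "\<bar>b\<bar> > 0" "t \<ge> s0 * \<bar>b\<bar>" for b t
      proof (cases "b > 0")
        case True
        have "1 * Mbar K 1 (t / b) \<le> C * Mbar K 1 (t / b)"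
          using C reg_tail_pos[OF T lam m] by (intro mult_right_mono) (auto intro: less_imp_le)
        then show ?thesis using True Mbar_pos_scale[of b t] by simp
      next
        case False
        then have "b < 0" using that by simp
        moreover have "t / \<bar>b\<bar> \<ge> s0" using that by (simp add: pos_le_divide_eq)
        ultimately show ?thesis using cmp[of "t / \<bar>b\<bar>"] Mbar_neg_scale[of b t] by simp
      qed
      show "\<bar>b\<bar> = 0 \<Longrightarrow> t \<ge> s0 * \<bar>b\<bar> \<Longrightarrow> Mbar K b t = 0" for b t
        unfolding Mb by (auto simp: not_less[symmetric])
    qed (use K lam m T C in \<open>auto simp: s0_def\<close>)
    moreover have "Mbar K (-1) \<in> O(Mbar K 1)"
    proof (rule bigoI[where c = C], rule eventually_mono[OF eventually_ge_at_top[of s0]])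
      fix t assume "t \<ge> s0"
      then show "norm (Mbar K (-1) t) \<le> C * norm (Mbar K 1 t)"
        using cmp[of t] reg_tail_pos[OF Tm lam m, of t] reg_tail_pos[OF T lam m, of t] by simp
    qed
    ultimately show ?thesis by blast
  qed
qed

text \<open>The lower tail is dominated by the upper one, which has a log-normal bound for large
  arguments; a larger constant covers the bounded range left over.\<close>

lemma abs_tail_bound:
  assumes K: "prob_space K" "sets K = sets borel" and T: "reg_tail lam m (Mbar K 1)"
    and lam: "lam > 0" and m: "m > 0" and neg: "Mbar K (-1) \<in> O(Mbar K 1)"
    and \<kappa>: "0 \<le> \<kappa>" "\<kappa> < lam / 2"
  shows "\<exists>C. \<forall>u\<ge>1. measure K {x. \<bar>x\<bar> > u} \<le> C * exp (- (\<kappa> * (ln u)\<^sup>2))"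
proof -
  interpret prob_space K by fact
  note Mb = Mbar_eq_measure[OF K]
  have O: "Mbar K 1 \<in> O(\<lambda>t. exp (- (2 * \<kappa> / 2 * (ln t)\<^sup>2)))"
    using \<kappa> by (intro reg_tail_bigo_exp[OF T lam m]) simp
  from sum_in_bigo(1)[OF O landau_o.big_trans[OF neg O]]
  obtain C where "\<forall>\<^sub>F t in at_top. norm (Mbar K 1 t + Mbar K (-1) t) \<le> C * norm (exp (- (2 * \<kappa> / 2 * (ln t)\<^sup>2)))"
    by (elim landau_o.bigE)
  then obtain u0 where u0: "\<And>t. t \<ge> u0 \<Longrightarrow> norm (Mbar K 1 t + Mbar K (-1) t) \<le> C * norm (exp (- (2 * \<kappa> / 2 * (ln t)\<^sup>2)))"
    by (auto simp: eventually_at_top_linorder)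
  define C' where "C' = max C (exp (\<kappa> * (ln (max 1 u0))\<^sup>2))"
  have "measure K {x. \<bar>x\<bar> > u} \<le> C' * exp (- (\<kappa> * (ln u)\<^sup>2))" if u: "u \<ge> 1" for u
  proof (cases "u \<ge> u0")
    case True
    have "{x. \<bar>x\<bar> > u} = {x. 1 * x > u} \<union> {x. (-1) * x > u}" by auto
    then have "measure K {x. \<bar>x\<bar> > u} \<le> Mbar K 1 u + Mbar K (-1) u"
      unfolding Mb by (simp only:) (rule measure_Un_le; simp add: K(2))
    also have "\<dots> \<le> C * exp (- (\<kappa> * (ln u)\<^sup>2))"
      using u0[OF True] by (simp add: abs_le_iff)
    also have "\<dots> \<le> C' * exp (- (\<kappa> * (ln u)\<^sup>2))" unfolding C'_def by (intro mult_right_mono) auto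
    finally show ?thesis .
  next
    case False
    then have "ln u \<le> ln (max 1 u0)" using u by (intro ln_mono) auto
    then have "(ln u)\<^sup>2 \<le> (ln (max 1 u0))\<^sup>2" using u by (intro power_mono) auto
    then have "\<kappa> * (ln u)\<^sup>2 \<le> \<kappa> * (ln (max 1 u0))\<^sup>2" using \<kappa> by (intro mult_left_mono)
    then have "1 \<le> exp (\<kappa> * (ln (max 1 u0))\<^sup>2) * exp (- (\<kappa> * (ln u)\<^sup>2))" by (simp flip: exp_add)
    also have "\<dots> \<le> C' * exp (- (\<kappa> * (ln u)\<^sup>2))" unfolding C'_def by (intro mult_right_mono) auto
    finally show ?thesis using prob_le_1 order.trans by blast
  qed
  then show ?thesis by blast
qed

text \<open>All but finitely many weights satisfy \<open>\<bar>c i\<bar> \<le> 1\<close>, and for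
  these \<open>\<bar>c i\<bar> \<le> \<bar>c i\<bar> powr \<delta>\<close>.\<close>

lemma abs_summable_of_powr_summable:
  fixes c :: "'i \<Rightarrow> real"
  assumes "filterlim c (nhds 0) cofinite" "0 < \<delta>" "\<delta> < 1" "(\<lambda>i. \<bar>c i\<bar> powr \<delta>) summable_on UNIV"
  shows "(\<lambda>i. \<bar>c i\<bar>) summable_on UNIV"
proof -
  define J where "J = {i. \<not> \<bar>c i\<bar> < 1}"
  have "\<forall>\<^sub>F i in cofinite. dist (c i) 0 < 1" using assms(1) by (rule tendstoD) simp
  then have J: "finite J" unfolding J_def by (simp add: eventually_cofinite)
  have "(\<lambda>i. \<bar>c i\<bar>) summable_on (UNIV - J)"
  proof (rule summable_on_comparison_test)
    show "(\<lambda>i. \<bar>c i\<bar> powr \<delta>) summable_on (UNIV - J)" by (rule summable_on_subset_banach[OF assms(4)]) auto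
    fix i assume "i \<in> UNIV - J"
    then have c: "\<bar>c i\<bar> \<le> 1" unfolding J_def by simp
    show "\<bar>c i\<bar> \<le> \<bar>c i\<bar> powr \<delta>"
    proof (cases "c i = 0")
      case False
      have "\<bar>c i\<bar> powr 1 \<le> \<bar>c i\<bar> powr \<delta>" using c assms(3) False by (intro powr_mono') auto
      then show ?thesis using False by simp
    qed simp
  qed simp
  moreover have "(\<lambda>i. \<bar>c i\<bar>) summable_on J" using J by (rule summable_on_finite)
  ultimately have "(\<lambda>i. \<bar>c i\<bar>) summable_on (UNIV - J \<union> J)" by (rule summable_on_Un_disjoint) auto
  then show ?thesis by simp
qed

theorem theorem2p3p3:
  fixes M :: "'a measure" and X :: "int \<Rightarrow> 'a \<Rightarrow> real" and c :: "int \<Rightarrow> real"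
    and F h :: "real \<Rightarrow> real" and lam :: real and m k :: nat and i1 :: int
  assumes "prob_space M"
    and "prob_space.indep_vars M (\<lambda>_. borel) X UNIV"
    and "\<forall>i. distr M borel (X i) = distr M borel (X 0)"
    and "F = cdf (distr M borel (X 0))"
    and "filterlim c (nhds 0) cofinite"
    and "\<exists>\<delta>>0. \<delta> < 1 \<and> (\<lambda>i. \<bar>c i\<bar> powr \<delta>) summable_on UNIV"
    and "m > 0"
    and "is_hazard_rate F h"
    and "lam > 0"
    and "h \<sim>[at_top] (\<lambda>t. lam * ln t / t)"
    and "smoothly_varying (-1) m h"
    and "(\<exists>a. \<forall>t\<le>a. F t = 0) \<or>
         ((\<exists>L>0. ((\<lambda>t. (1 - F t) / F (- t)) \<longlongrightarrow> L) at_top) \<and>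
          (\<exists>hm. is_hazard_rate (cdf (distr (distr M borel (X 0)) borel (\<lambda>x. (-1) * x))) hm
                \<and> hm \<sim>[at_top] (\<lambda>t. lam * ln t / t)
                \<and> smoothly_varying (-1) m hm))"
    and "\<forall>i. tail_preceq (distr M borel (X 0)) (c i) (c i1)"
    and "0 < k" and "k \<le> m"
  shows "(\<lambda>t. (1 - cdf (distr M borel (\<lambda>\<omega>. \<Sum>\<^sub>\<infinity>j. c j * X j \<omega>)) t)
           - (\<Sum>\<^sub>\<infinity>i. if tail_preceq (distr M borel (X 0)) (c i1 * exp (- real k / lam)) (c i)
                 then laplace_char (distr M borel (\<lambda>\<omega>. \<Sum>\<^sub>\<infinity>j\<in>UNIV - {i}. c j * X j \<omega>))
                        (nat (int k + \<lfloor>lam * ln \<bar>c i / c i1\<bar>\<rfloor>))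
                        (Mbar (distr M borel (X 0)) (c i)) t
                 else 0))
         \<in> o(\<lambda>t. h t ^ k * Mbar (distr M borel (X 0)) (c i1) t)"
proof -
  interpret prob_space M by fact
  note lam = \<open>lam > 0\<close> and m = \<open>m > 0\<close>
  have X0 [measurable]: "random_variable borel (X 0)"
    using assms(2) unfolding indep_vars_def by auto
  define K where "K = distr M borel (X 0)"
  have K: "prob_space K" "sets K = sets borel" unfolding K_def by (auto intro: prob_space_distr)
  obtain eff C s0 where ord: "tail_ordering K lam m eff C s0" and neg: "Mbar K (-1) \<in> O(Mbar K 1)"
    using tail_ordering_exists[OF K _ lam _ m] assms(4,8,10,11,12) unfolding K_def by blast
  interpret T: tail_ordering K lam m eff C s0 by (rule ord)
  have c_summable: "(\<lambda>i. \<bar>c i\<bar>) summable_on UNIV"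
    using assms(5,6) abs_summable_of_powr_summable by blast
  interpret W: weighted_sum M X c "lam / 2"
  proof
    show "indep_vars (\<lambda>_. borel) X UNIV" by fact
    show "distr M borel (X i) = distr M borel (X 0)" for i using assms(3) by blast
    show "(\<lambda>i. \<bar>c i\<bar>) summable_on UNIV" by fact
    show "lam / 2 > 0" using lam by simp
    fix \<kappa> :: real assume \<kappa>: "0 \<le> \<kappa>" "\<kappa> < lam / 2"
    \<comment> \<open>The tail bound must hold with a constant strictly larger than that of the
      moment to be shown, yet still below \<open>lam / 2\<close>.\<close>
    define \<kappa>2 where "\<kappa>2 = (\<kappa> + lam / 2) / 2"
    have \<kappa>2: "\<kappa> < \<kappa>2" "0 \<le> \<kappa>2" "\<kappa>2 < lam / 2" using \<kappa> unfolding \<kappa>2_def by auto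
    obtain C' where C': "\<And>u. u \<ge> 1 \<Longrightarrow> measure K {x. \<bar>x\<bar> > u} \<le> C' * exp (- (\<kappa>2 * (ln u)\<^sup>2))"
      using abs_tail_bound[OF K T.T lam m neg \<kappa>2(2,3)] by blast
    show "integrable M (\<lambda>\<omega>. exp (\<kappa> * (ln (max 1 \<bar>X 0 \<omega>\<bar>))\<^sup>2))"
    proof (rule integrable_exp_log_square[OF X0 _ \<kappa>(1) \<kappa>2(1)])
      fix u :: real assume "u \<ge> 1"
      have "measure K {x. \<bar>x\<bar> > u} = prob {\<omega> \<in> space M. \<bar>X 0 \<omega>\<bar> > u}"
        unfolding K_def by (subst measure_distr) (auto intro!: arg_cong[where f=prob])
      with C'[OF \<open>u \<ge> 1\<close>] show "prob {\<omega> \<in> space M. \<bar>X 0 \<omega>\<bar> > u} \<le> C' * exp (- (\<kappa>2 * (ln u)\<^sup>2))" by simp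
    qed
  qed
  define A where "A = eff (c i1) * exp (- real k / lam)"
  define I where "I = {i. A \<le> eff (c i)}"
  define H where "H = (\<lambda>i. laplace_char (distr M borel (W.part (UNIV - {i})))
    (nat (int k + \<lfloor>lam * ln \<bar>c i / c i1\<bar>\<rfloor>)) (Mbar K (c i)))"
  have part: "W.part B = (\<lambda>\<omega>. \<Sum>\<^sub>\<infinity>j\<in>B. c j * X j \<omega>)" for B
    unfolding W.part_def[abs_def] ..
  have preceq: "tail_preceq K (c i1 * exp (- real k / lam)) (c i) \<longleftrightarrow> i \<in> I" for i
    unfolding T.tail_preceq_iff I_def A_def by (simp add: T.eff_mult)
  have max: "eff (c i) \<le> eff (c i1)" for i
    using assms(13) unfolding K_def[symmetric] T.tail_preceq_iff by blast
  have lhs: "1 - cdf (distr M borel (W.part UNIV)) t = prob {\<omega> \<in> space M. W.part UNIV \<omega> > t}" for t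
  proof -
    have "cdf (distr M borel (W.part UNIV)) t = prob {\<omega> \<in> space M. W.part UNIV \<omega> \<le> t}"
      unfolding cdf_def by (subst measure_distr) (auto intro!: arg_cong[where f=prob])
    also have "1 - \<dots> = prob (space M - {\<omega> \<in> space M. W.part UNIV \<omega> \<le> t})"
      by (rule prob_compl[symmetric]) measurable
    also have "space M - {\<omega> \<in> space M. W.part UNIV \<omega> \<le> t} = {\<omega> \<in> space M. W.part UNIV \<omega> > t}" by auto
    finally show ?thesis .
  qed
  \<comment> \<open>The error is first obtained with \<open>ln t / t\<close> in place of
    \<open>h\<close>; the two are of the same order.\<close>
  have "(\<lambda>t. prob {\<omega> \<in> space M. W.part UNIV \<omega> > t} - (\<Sum>\<^sub>\<infinity>i. if i \<in> I then H i t else 0))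
      \<in> o(\<lambda>t. (ln t / t) ^ k * Mbar K (c i1) t)"
  proof (cases "eff (c i1) > 0")
    case True
    have "finite I"
      unfolding I_def A_def using W.small_weights(1)[OF ord[unfolded K_def] assms(5) True] .
    then have "(\<Sum>\<^sub>\<infinity>i\<in>I. H i t) = (\<Sum>i\<in>I. H i t)" for t by (rule infsum_finite)
    moreover have "(\<Sum>\<^sub>\<infinity>i. if i \<in> I then H i t else 0) = (\<Sum>\<^sub>\<infinity>i\<in>I. H i t)" for t
      by (rule infsum_cong_neutral) auto
    ultimately show ?thesis
      using W.tail_expansion[OF ord[unfolded K_def] refl assms(5) True max \<open>k \<le> m\<close>]
      unfolding H_def I_def A_def K_def by simp
  next
    case False
    \<comment> \<open>All weighted summands, hence the sum, are bounded above and every term ultimately vanishes.\<close>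
    then have e0: "eff (c i) = 0" for i using max[of i] T.eff_nonneg[of "c i"] by linarith
    have z: "Mbar K (c i) t = 0" if "t \<ge> s0 * \<bar>c i\<bar>" for i t using T.zero[OF e0 that] .
    have H0: "H i t = 0" if "t > s0 * W.c_norm" for i t
    proof -
      have "Mbar K (c i) s = 0" if "s > s0 * W.c_norm" for s
        using that mult_left_mono[OF W.c_le T.s0, of i] by (intro z) linarith
      from higher_deriv_ultimately_zero[OF this \<open>t > s0 * W.c_norm\<close>] show ?thesis
        unfolding H_def laplace_char_def by simp
    qed
    have "\<forall>\<^sub>F t in at_top. prob {\<omega> \<in> space M. W.part UNIV \<omega> > t} - (\<Sum>\<^sub>\<infinity>i. if i \<in> I then H i t else 0) = 0"
      using eventually_gt_at_top[of "s0 * W.c_norm"]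
    proof eventually_elim
      case (elim t)
      have "prob {\<omega> \<in> space M. W.part UNIV \<omega> > t} = 0"
        by (rule W.tail_ultimately_zero[OF z[unfolded K_def] T.s0]) (use elim in auto)
      moreover have "(\<lambda>i. if i \<in> I then H i t else 0) = (\<lambda>_. 0)" using H0[OF elim] by auto
      ultimately show ?case by simp
    qed
    from landau_o.small.in_cong[OF this] show ?thesis by simp
  qed
  also have "(\<lambda>t. (ln t / t) ^ k * Mbar K (c i1) t) \<in> O(\<lambda>t. h t ^ k * Mbar K (c i1) t)"
  proof (intro landau_o.big.mult landau_o.big_power)
    have "(\<lambda>t. ln t / t) \<in> O(\<lambda>t::real. lam * ln t / t)" using lam by real_asymp
    also have "(\<lambda>t. lam * ln t / t) \<in> O(h)"
      using assms(10) by (intro asymp_equiv_imp_bigo) (simp add: asymp_equiv_sym)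
    finally show "(\<lambda>t. ln t / t) \<in> O(h)" .
  qed simp
  finally show ?thesis
    unfolding K_def[symmetric] preceq unfolding H_def lhs[symmetric] unfolding part .
qed

end
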